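(* Let $M=M^{n|m}$ be a supermanifold and $X$ a vector field on $M$. For mixed forms on $M$ the following identity holds: $$\bar d\,e(X)+e(X)\,\bar d=\delta_X\,\sigma,$$ where $\delta_X$ is the Lie derivative along $X$ and $\sigma=\sigma_{1|0}:\Omega^{r|s}_{p|q}(M)\to\Omega^{r+1|s}_{p+1|q}(M)$ is the stability isomorphism.
   Context: Conventions. $\tilde{\ }$ denotes parity; repeated indices are summed; derivatives act from the left; $\Pi$ is parity reversion; $\mathrm{Ber}$ is the Berezinian; $x^A$ are local coordinates on $M$. All matrices below are even, i.e. an entry has parity equal to the sum of the parities of its two indices. Mixed forms on a superspace. For a vector superspace $V$ of dimension $n|m$, with $\mathrm{Vol}\,V=\mathrm{Ber}\,V^*$ (elements written by their coefficient in a chosen basis), $\Lambda^{r|s}_{p|q}(V)$ is the space of smooth $\mathrm{Vol}\,V$-valued maps $\mathcal L(p,w)$ of $p$ even and $q$ odd covectors on $V\oplus\mathbb R^{r|s}$ (points of $((V\oplus\mathbb R^{r|s})^* )^p\times((V\oplus\mathbb R^{r|s})^*\Pi)^q$), defined at arguments for which the Berezinian conditions make sense (odd covectors, and odd rows of $w$, linearly independent). The matrices are $p=(p_A{}^K)$, $w=(w_F{}^K)$, where $K$ runs over $p|q$ values and numbers the covectors (columns), $F$ runs over $r|s$ values, and $p$ is placed over $w$. The conditions are: $\mathcal L(ph,wh)=\mathcal L(p,w)\,\mathrm{Ber}\,h$ for $h\in GL(p|q)$; $\mathcal L(p+aw,gw)=\mathcal L(p,w)\,\mathrm{Ber}\,g$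 for $g\in GL(r|s)$ and all matrices $a=(a_A{}^F)$ with $n|m$ rows and $r|s$ columns; and $$\frac{\partial^2\mathcal L}{\partial p_A{}^K\partial p_B{}^L}+(-1)^{\tilde A\tilde B+(\tilde A+\tilde B)\tilde L}\frac{\partial^2\mathcal L}{\partial p_B{}^K\partial p_A{}^L}=0,$$ $$\frac{\partial^2\mathcal L}{\partial p_A{}^K\partial w_F{}^L}+(-1)^{\tilde A\tilde F+(\tilde A+\tilde F)\tilde L}\frac{\partial^2\mathcal L}{\partial w_F{}^K\partial p_A{}^L}=0,$$ $$\frac{\partial^2\mathcal L}{\partial w_F{}^K\partial w_G{}^L}+(-1)^{\tilde F\tilde G+(\tilde F+\tilde G)\tilde L}\frac{\partial^2\mathcal L}{\partial w_G{}^K\partial w_F{}^L}=0 .$$ Mixed forms on $M$. $\Omega^{r|s}_{p|q}(M)$ is the space of sections of the corresponding bundle associated with $TM$ (fiber $\Lambda^{r|s}_{p|q}(T_xM)$); in local coordinates $\mathcal L=\mathcal L(x,p,w)$. The following operators are well-defined. Stability isomorphisms (acting fiberwise) $\sigma_{k|l}:\Omega^{r|s}_{p|q}\to\Omega^{r+k|s+l}_{p+k|q+l}$, $$(\sigma_{k|l}\mathcal L)\begin{pmatrix}p_1&p_2\\ w_{11}&w_{12}\\ w_{21}&w_{22}\end{pmatrix}=\mathcal L\begin{pmatrix}p_1-p_2w_{22}^{-1}w_{21}\\ w_{11}-w_{12}w_{22}^{-1}w_{21}\end{pmatrix}\cdot\mathrm{Ber}\,w_{22},$$ where the new $k|l$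 columns and rows are the last ones (last among even, respectively odd), extended uniquely to all admissible arguments. Differential $\bar d:\Omega^{r|s}_{p|q}\to\Omega^{r+1|s}_{p|q}$ (an even operator), $$\bar d\mathcal L=(-1)^r\,w_{r+1}{}^K(-1)^{\tilde A\tilde K}\frac{\partial}{\partial x^A}\frac{\partial\mathcal L}{\partial p_A{}^K}.$$ For a vector field $X=X^A\,\partial/\partial x^A$, the operator $e(X):\Omega^{r|s}_{p|q}\to\Omega^{r|s}_{p+1|q}$, $$e(X)\mathcal L=(-1)^rX^A\left(p_A{}^{p+1}-(-1)^{\tilde B\tilde K}p_A{}^Kp_B{}^{p+1}\frac{\partial}{\partial p_B{}^K}-(-1)^{\tilde F\tilde K}p_A{}^Kw_F{}^{p+1}\frac{\partial}{\partial w_F{}^K}\right)\mathcal L.$$ Here $w_{r+1}$ is the additional (last even) row, $p+1$ labels the additional (last even) column, and $K$, $F$ run over the original columns and rows of the argument of $\mathcal L$. Lie derivative $\delta_X:\Omega^{r|s}_{p|q}\to\Omega^{r|s}_{p|q}$ along $X$ (corresponding to the infinitesimal transformation $x^A\mapsto x^A+\varepsilon X^A(x)$, $\varepsilon^2=0$): $$\delta_X\mathcal L=X^A\frac{\partial\mathcal L}{\partial x^A}-(-1)^{\tilde A\tilde X}\frac{\partial X^B}{\partial x^A}\,p_B{}^K\frac{\partial\mathcal L}{\partial p_A{}^K}+(-1)^{\tilde A(\tilde X+1)}\frac{\partial X^A}{\partial x^A}\,\mathcal L .$$ *)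

theory Defs
  imports "HOL-Analysis.Analysis" "HOL-Combinatorics.Permutations" "HOL-Library.Groups_Big_Fun"
begin

section \<open>Real Grassmann algebras\<close>

text \<open>An element of the Grassmann algebra on the generators \<open>'g\<close> is a family of real coefficients
  \<open>coeff a I\<close> of the monomials \<open>\<xi>\<^sub>I\<close>, the product of the generators in the finite set \<open>I\<close> in
  increasing order. Infinitely many nonzero coefficients are allowed; every element used below
  involves only finitely many generators.\<close>

typedef 'g gr = "{f :: 'g set \<Rightarrow> real. \<forall>I. infinite I \<longrightarrow> f I = 0}"
  morphisms coeff Abs_gr
  by (rule exI[of _ "\<lambda>_. 0"]) simp

setup_lifting type_definition_gr

definition gr_of :: "('g set \<Rightarrow> real) \<Rightarrow> 'g gr" where
  "gr_of f = Abs_gr (\<lambda>I. if finite I then f I else 0)"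

lemma coeff_gr_of: "coeff (gr_of f) I = (if finite I then f I else 0)"
  unfolding gr_of_def by (subst Abs_gr_inverse) auto

lemma coeff_infinite: "infinite I \<Longrightarrow> coeff a I = 0"
  using coeff[of a] by simp

lemma gr_eqI: "(\<And>I. finite I \<Longrightarrow> coeff a I = coeff b I) \<Longrightarrow> a = b"
  by (metis coeff_infinite coeff_inject ext)

definition inversions :: "'g::linorder set \<Rightarrow> 'g set \<Rightarrow> nat" where
  "inversions I J = card {(i, j). i \<in> I \<and> j \<in> J \<and> j < i}"

text \<open>For disjoint finite \<open>I\<close> and \<open>J\<close>, \<open>\<xi>\<^sub>I \<xi>\<^sub>J = gsign I J *\<^sub>R \<xi>\<^sub>I\<^sub>\<union>\<^sub>J\<close>.\<close>
definition gsign :: "'g::linorder set \<Rightarrow> 'g set \<Rightarrow> real" where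
  "gsign I J = (-1) ^ inversions I J"

lemma inversions_Un_left:
  assumes "finite I" "finite J" "finite K" "I \<inter> J = {}"
  shows "inversions (I \<union> J) K = inversions I K + inversions J K"
proof -
  have "{(i, j). i \<in> I \<union> J \<and> j \<in> K \<and> j < i}
      = {(i, j). i \<in> I \<and> j \<in> K \<and> j < i} \<union> {(i, j). i \<in> J \<and> j \<in> K \<and> j < i}" by auto
  moreover have "finite {(i, j). i \<in> I \<and> j \<in> K \<and> j < i}" "finite {(i, j). i \<in> J \<and> j \<in> K \<and> j < i}"
    using assms by (auto intro: finite_subset[of _ "I \<times> K"] finite_subset[of _ "J \<times> K"])
  ultimately show ?thesis
    using assms(4) by (auto simp: inversions_def intro!: card_Un_disjoint)
qed

lemma inversions_Un_right:
  assumes "finite I" "finite J" "finite K" "J \<inter> K = {}"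
  shows "inversions I (J \<union> K) = inversions I J + inversions I K"
proof -
  have "{(i, j). i \<in> I \<and> j \<in> J \<union> K \<and> j < i}
      = {(i, j). i \<in> I \<and> j \<in> J \<and> j < i} \<union> {(i, j). i \<in> I \<and> j \<in> K \<and> j < i}" by auto
  moreover have "finite {(i, j). i \<in> I \<and> j \<in> J \<and> j < i}" "finite {(i, j). i \<in> I \<and> j \<in> K \<and> j < i}"
    using assms by (auto intro: finite_subset[of _ "I \<times> J"] finite_subset[of _ "I \<times> K"])
  ultimately show ?thesis
    using assms(4) by (auto simp: inversions_def intro!: card_Un_disjoint)
qed

lemma gsign_empty [simp]: "gsign {} J = 1" "gsign I {} = 1"
  by (simp_all add: gsign_def inversions_def)

instantiation gr :: (linorder) real_algebra_1
begin

lift_definition zero_gr :: "'a gr" is "\<lambda>_. 0" by simp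
definition one_gr :: "'a gr" where "one_gr = gr_of (\<lambda>I. if I = {} then 1 else 0)"
lift_definition plus_gr :: "'a gr \<Rightarrow> 'a gr \<Rightarrow> 'a gr" is "\<lambda>a b I. a I + b I" by simp
lift_definition minus_gr :: "'a gr \<Rightarrow> 'a gr \<Rightarrow> 'a gr" is "\<lambda>a b I. a I - b I" by simp
lift_definition uminus_gr :: "'a gr \<Rightarrow> 'a gr" is "\<lambda>a I. - a I" by simp
lift_definition scaleR_gr :: "real \<Rightarrow> 'a gr \<Rightarrow> 'a gr" is "\<lambda>c a I. c * a I" by simp
definition times_gr :: "'a gr \<Rightarrow> 'a gr \<Rightarrow> 'a gr" where
  "times_gr a b = gr_of (\<lambda>I. \<Sum>J\<in>Pow I. gsign J (I - J) * coeff a J * coeff b (I - J))"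

lemma coeff_times: "finite I \<Longrightarrow>
    coeff (a * b) I = (\<Sum>J\<in>Pow I. gsign J (I - J) * coeff a J * coeff b (I - J))"
  by (simp add: times_gr_def coeff_gr_of)

lemma coeff_one: "coeff 1 I = (if I = {} then 1 else 0)"
  by (auto simp: one_gr_def coeff_gr_of)

instance
proof
  fix a b c :: "'a gr" and x y :: real
  show "a + b + c = a + (b + c)" by transfer (simp add: algebra_simps)
  show "a + b = b + a" by transfer (simp add: algebra_simps)
  show "0 + a = a" by transfer simp
  show "- a + a = 0" by transfer simp
  show "a - b = a + - b" by transfer simp
  show "x *\<^sub>R (a + b) = x *\<^sub>R a + x *\<^sub>R b" by transfer (simp add: algebra_simps)
  show "(x + y) *\<^sub>R a = x *\<^sub>R a + y *\<^sub>R a" by transfer (simp add: algebra_simps)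
  show "x *\<^sub>R y *\<^sub>R a = (x * y) *\<^sub>R a" by transfer (simp add: algebra_simps)
  show "1 *\<^sub>R a = a" by transfer simp
  show "(0 :: 'a gr) \<noteq> 1"
    by (metis coeff_one zero_gr.rep_eq zero_neq_one)
  show "(a + b) * c = a * c + b * c"
    by (rule gr_eqI) (simp add: coeff_times plus_gr.rep_eq algebra_simps sum.distrib)
  show "a * (b + c) = a * b + a * c"
    by (rule gr_eqI) (simp add: coeff_times plus_gr.rep_eq algebra_simps sum.distrib)
  show "x *\<^sub>R a * b = x *\<^sub>R (a * b)"
    by (rule gr_eqI) (simp add: coeff_times scaleR_gr.rep_eq sum_distrib_left algebra_simps)
  show "a * x *\<^sub>R b = x *\<^sub>R (a * b)"
    by (rule gr_eqI) (simp add: coeff_times scaleR_gr.rep_eq sum_distrib_left algebra_simps)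
  show "1 * a = a"
  proof (rule gr_eqI)
    fix I :: "'a set" assume "finite I"
    have "coeff (1 * a) I = (\<Sum>J\<in>Pow I. if J = {} then coeff a I else 0)"
      unfolding coeff_times[OF \<open>finite I\<close>]
      by (rule sum.cong) (auto simp: coeff_one)
    then show "coeff (1 * a) I = coeff a I" using \<open>finite I\<close> by simp
  qed
  show "a * 1 = a"
  proof (rule gr_eqI)
    fix I :: "'a set" assume "finite I"
    have "coeff (a * 1) I = (\<Sum>J\<in>Pow I. if J = I then coeff a I else 0)"
      unfolding coeff_times[OF \<open>finite I\<close>]
      by (rule sum.cong) (auto simp: coeff_one)
    then show "coeff (a * 1) I = coeff a I" using \<open>finite I\<close> by simp
  qed
  show "a * b * c = a * (b * c)"
  proof (rule gr_eqI)
    fix I :: "'a set" assume I: "finite I"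
    let ?s = "\<lambda>(J, K). gsign J (I - J) * gsign K (J - K) * coeff a K * coeff b (J - K) * coeff c (I - J)"
    let ?t = "\<lambda>(K, M). gsign K (I - K) * gsign M (I - K - M) * coeff a K * coeff b M * coeff c (I - K - M)"
    have "coeff (a * b * c) I
        = (\<Sum>J\<in>Pow I. \<Sum>K\<in>Pow J. ?s (J, K))"
      unfolding coeff_times[OF I]
      by (rule sum.cong)
         (auto simp: coeff_times finite_subset[OF _ I] sum_distrib_left sum_distrib_right mult_ac
               intro!: sum.cong)
    also have "\<dots> = (\<Sum>x\<in>(SIGMA J:Pow I. Pow J). ?s x)"
      using I by (subst sum.Sigma) (auto intro: finite_subset)
    also have "\<dots> = (\<Sum>x\<in>(SIGMA K:Pow I. Pow (I - K)). ?t x)"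
    proof (rule sum.reindex_bij_witness[where i = "\<lambda>(K, M). (K \<union> M, K)" and j = "\<lambda>(J, K). (K, J - K)"])
      fix x assume "x \<in> (SIGMA J:Pow I. Pow J)"
      then obtain J K where x: "x = (J, K)" "J \<subseteq> I" "K \<subseteq> J" by auto
      have fin: "finite K" "finite J" "finite (J - K)" "finite (I - J)"
        using x I by (auto intro: finite_subset)
      have eq: "I - K = (J - K) \<union> (I - J)" "I - K - (J - K) = I - J" "J = K \<union> (J - K)"
        using x by auto
      have "inversions J (I - J) = inversions K (I - J) + inversions (J - K) (I - J)"
        using inversions_Un_left[of K "J - K" "I - J"] fin eq(3) by auto
      moreover have "inversions K (I - K) = inversions K (J - K) + inversions K (I - J)"
        unfolding eq(1) using fin by (intro inversions_Un_right) auto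
      ultimately have "gsign J (I - J) * gsign K (J - K) = gsign K (I - K) * gsign (J - K) (I - J)"
        by (simp add: gsign_def power_add)
      then show "?t (case x of (J, K) \<Rightarrow> (K, J - K)) = ?s x"
        unfolding x(1) by (simp add: eq(2))
    qed auto
    also have "\<dots> = (\<Sum>K\<in>Pow I. \<Sum>M\<in>Pow (I - K). ?t (K, M))"
      using I by (subst sum.Sigma) auto
    also have "\<dots> = coeff (a * (b * c)) I"
      unfolding coeff_times[OF I]
      by (rule sum.cong)
         (use I in \<open>auto simp: coeff_times sum_distrib_left mult_ac intro!: sum.cong\<close>)
    finally show "coeff (a * b * c) I = coeff (a * (b * c)) I" .
  qed
qed

end

definition gen :: "'g \<Rightarrow> 'g gr" where
  "gen g = gr_of (\<lambda>I. if I = {g} then 1 else 0)"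

definition body :: "'g gr \<Rightarrow> real" where
  "body a = coeff a {}"

definition soul :: "'g::linorder gr \<Rightarrow> 'g gr" where
  "soul a = a - of_real (body a)"

text \<open>Parities are natural numbers read modulo 2. Zero has both parities.\<close>
definition homog :: "nat \<Rightarrow> 'g gr \<Rightarrow> bool" where
  "homog e a \<longleftrightarrow> (\<forall>I. coeff a I \<noteq> 0 \<longrightarrow> even (card I + e))"

definition hpart :: "nat \<Rightarrow> 'g gr \<Rightarrow> 'g gr" where
  "hpart e a = gr_of (\<lambda>I. if even (card I + e) then coeff a I else 0)"

definition gens_in :: "'g set \<Rightarrow> 'g gr \<Rightarrow> bool" where
  "gens_in N a \<longleftrightarrow> (\<forall>I. coeff a I \<noteq> 0 \<longrightarrow> I \<subseteq> N)"

text \<open>Left partial derivative with respect to a generator.\<close>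
definition gderiv :: "'g::linorder \<Rightarrow> 'g gr \<Rightarrow> 'g gr" where
  "gderiv g a = gr_of (\<lambda>I. if g \<in> I then 0 else gsign {g} I * coeff a (insert g I))"


section \<open>Supermatrices and the Berezinian\<close>

text \<open>\<open>Ev i\<close> and \<open>Od i\<close> are the \<open>i\<close>-th even and odd index, counted from 0. So the additional last
  even index of \<open>(p+1)|q\<close> is \<open>Ev p\<close>.\<close>

datatype sindex = Ev nat | Od nat

fun par :: "sindex \<Rightarrow> nat" where
  "par (Ev _) = 0"
| "par (Od _) = 1"

definition indices :: "nat \<Rightarrow> nat \<Rightarrow> sindex set" where
  "indices n m = Ev ` {..<n} \<union> Od ` {..<m}"

fun shift :: "nat \<Rightarrow> nat \<Rightarrow> sindex \<Rightarrow> sindex" where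
  "shift p q (Ev i) = Ev (p + i)"
| "shift p q (Od j) = Od (q + j)"

type_synonym 'g smat = "sindex \<Rightarrow> sindex \<Rightarrow> 'g gr"

definition even_smat :: "sindex set \<Rightarrow> sindex set \<Rightarrow> 'g smat \<Rightarrow> bool" where
  "even_smat R C M \<longleftrightarrow> (\<forall>F\<in>R. \<forall>K\<in>C. homog (par F + par K) (M F K))"

definition smul :: "sindex set \<Rightarrow> 'g::linorder smat \<Rightarrow> 'g smat \<Rightarrow> 'g smat" where
  "smul I M N = (\<lambda>F K. \<Sum>L\<in>I. M F L * N L K)"

definition is_sinv :: "sindex set \<Rightarrow> 'g::linorder smat \<Rightarrow> 'g smat \<Rightarrow> bool" where
  "is_sinv I M N \<longleftrightarrow> (\<forall>F\<in>I. \<forall>K\<in>I. smul I M N F K = (if F = K then 1 else 0) \<and>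
                                 smul I N M F K = (if F = K then 1 else 0))"

definition sinvertible :: "sindex set \<Rightarrow> 'g::linorder smat \<Rightarrow> bool" where
  "sinvertible I M \<longleftrightarrow> (\<exists>N. is_sinv I M N)"

definition sinv :: "sindex set \<Rightarrow> 'g::linorder smat \<Rightarrow> 'g smat" where
  "sinv I M = (THE N. is_sinv I M N \<and> (\<forall>F K. F \<notin> I \<or> K \<notin> I \<longrightarrow> N F K = 0))"

definition GL :: "nat \<Rightarrow> nat \<Rightarrow> 'g::linorder smat set" where
  "GL p q = {h. even_smat (indices p q) (indices p q) h \<and> sinvertible (indices p q) h}"

text \<open>Determinant of the \<open>k \<times> k\<close> block with rows and columns \<open>ix 0, \<dots>, ix (k - 1)\<close>. It is only used
  for blocks of even, hence commuting, entries; the library determinants require the whole entry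
  type to be commutative.\<close>
definition block_det :: "(nat \<Rightarrow> sindex) \<Rightarrow> nat \<Rightarrow> 'g::linorder smat \<Rightarrow> 'g gr" where
  "block_det ix k M = (\<Sum>\<pi> | \<pi> permutes {..<k}.
     of_int (sign \<pi>) * prod_list (map (\<lambda>i. M (ix i) (ix (\<pi> i))) [0..<k]))"

text \<open>\<open>Ber M = det (M\<^sub>0\<^sub>0 - M\<^sub>0\<^sub>1 M\<^sub>1\<^sub>1\<inverse> M\<^sub>1\<^sub>0) det (M\<^sub>1\<^sub>1\<inverse>)\<close>; \<open>indices 0 q\<close> are the odd indices.\<close>
definition Ber :: "nat \<Rightarrow> nat \<Rightarrow> 'g::linorder smat \<Rightarrow> 'g gr" where
  "Ber p q M = (let N = sinv (indices 0 q) M in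
     block_det Ev p (\<lambda>F K. M F K - smul (indices 0 q) M (smul (indices 0 q) N M) F K) *
     block_det Od q N)"


section \<open>Superfunctions\<close>

text \<open>The variables \<open>x\<^sup>A\<close>, \<open>p\<^sub>A\<^sup>K\<close>, \<open>w\<^sub>F\<^sup>K\<close>.\<close>
datatype coord = Xc sindex | Pc sindex sindex | Wc sindex sindex

fun cpar :: "coord \<Rightarrow> nat" where
  "cpar (Xc A) = par A"
| "cpar (Pc A K) = par A + par K"
| "cpar (Wc F K) = par F + par K"

instance sindex :: countable by countable_datatype
instance coord :: countable by countable_datatype

text \<open>An arbitrary linear order, needed only to order the factors of Grassmann monomials.\<close>
instantiation coord :: linorder
begin
definition less_eq_coord :: "coord \<Rightarrow> coord \<Rightarrow> bool" where "(a::coord) \<le> b \<longleftrightarrow> to_nat a \<le> to_nat b"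
definition less_coord :: "coord \<Rightarrow> coord \<Rightarrow> bool" where "(a::coord) < b \<longleftrightarrow> to_nat a < to_nat b"
instance by standard (auto simp: less_eq_coord_def less_coord_def)
end

text \<open>A superfunction assigns to the values of the even variables an element of the Grassmann
  algebra generated by the odd variables, i.e. it is an element of \<open>C\<^sup>\<infinity> \<otimes> \<Lambda>\<close>. The argument has a slot
  for every variable, but a superfunction of the variables \<open>C\<close> depends only on the slots of the
  even variables in \<open>C\<close>. Accordingly its domain is a cylinder, so that a function of fewer
  variables is also a function of more variables.\<close>
type_synonym sfun = "(coord \<Rightarrow> real) \<Rightarrow> coord gr"

primrec pderivs :: "coord list \<Rightarrow> ((coord \<Rightarrow> real) \<Rightarrow> real) \<Rightarrow> (coord \<Rightarrow> real) \<Rightarrow> real" where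
  "pderivs [] f = f"
| "pderivs (c # cs) f = (\<lambda>v. deriv (\<lambda>t. pderivs cs f (v(c := t))) (v c))"

definition smooth_on :: "(coord \<Rightarrow> real) set \<Rightarrow> ((coord \<Rightarrow> real) \<Rightarrow> real) \<Rightarrow> bool" where
  "smooth_on D f \<longleftrightarrow> (\<forall>cs. continuous_on D (pderivs cs f) \<and>
     (\<forall>c. \<forall>v\<in>D. (\<lambda>t. pderivs cs f (v(c := t))) differentiable (at (v c))))"

definition superfun :: "coord set \<Rightarrow> (coord \<Rightarrow> real) set \<Rightarrow> sfun \<Rightarrow> bool" where
  "superfun C D f \<longleftrightarrow>
     (\<forall>v\<in>D. \<forall>v'. (\<forall>c\<in>C. even (cpar c) \<longrightarrow> v c = v' c) \<longrightarrow> f v = f v') \<and>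
     (\<forall>v\<in>D. gens_in {c \<in> C. odd (cpar c)} (f v)) \<and>
     (\<forall>I. smooth_on D (\<lambda>v. coeff (f v) I))"

definition var :: "coord \<Rightarrow> sfun" where
  "var c v = (if even (cpar c) then of_real (v c) else gen c)"

text \<open>Left partial derivative \<open>\<partial>/\<partial>c\<close>.\<close>
definition pd :: "coord \<Rightarrow> sfun \<Rightarrow> sfun" where
  "pd c f v = (if even (cpar c) then gr_of (\<lambda>I. deriv (\<lambda>t. coeff (f (v(c := t))) I) (v c))
               else gderiv c (f v))"

text \<open>Substitution of elements \<open>z c\<close> of a Grassmann algebra, of the parity of \<open>c\<close>, for the variables:
  the terminating Taylor expansion at the body of \<open>z\<close>. Summing over all lists of variables with
  weight \<open>1/k!\<close> is the sum over multi-indices \<open>\<alpha>\<close> with weight \<open>1/\<alpha>!\<close>.\<close>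
definition sfeval :: "sfun \<Rightarrow> (coord \<Rightarrow> 'g::linorder gr) \<Rightarrow> 'g gr" where
  "sfeval f z = Sum_any (\<lambda>I. Sum_any (\<lambda>cs.
       (pderivs cs (\<lambda>v. coeff (f v) I) (body \<circ> z) / fact (length cs)) *\<^sub>R
          prod_list (map (soul \<circ> z) cs)) *
     prod_list (map z (sorted_list_of_set I)))"

fun point :: "(sindex \<Rightarrow> 'g gr) \<Rightarrow> 'g smat \<Rightarrow> 'g smat \<Rightarrow> coord \<Rightarrow> 'g gr" where
  "point x P W (Xc A) = x A"
| "point x P W (Pc A K) = P A K"
| "point x P W (Wc F K) = W F K"

abbreviation xpoint :: "(sindex \<Rightarrow> 'g::linorder gr) \<Rightarrow> coord \<Rightarrow> 'g gr" where
  "xpoint x \<equiv> point x (\<lambda>_ _. 0) (\<lambda>_ _. 0)"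


section \<open>Supermanifolds\<close>

definition xcoords :: "nat \<Rightarrow> nat \<Rightarrow> coord set" where
  "xcoords n m = Xc ` indices n m"

definition xbody :: "nat \<Rightarrow> (coord \<Rightarrow> real) \<Rightarrow> nat \<Rightarrow> real" where
  "xbody n v = (\<lambda>a. if a < n then v (Xc (Ev a)) else 0)"

definition xdom :: "nat \<Rightarrow> (nat \<Rightarrow> real) set \<Rightarrow> (coord \<Rightarrow> real) set" where
  "xdom n U = {v. xbody n v \<in> U}"

text \<open>A supermanifold of dimension \<open>n|m\<close>, glued from superdomains: \<open>cdom i\<close> is the underlying open set
  of the chart \<open>i\<close>, \<open>cmap i\<close> its underlying coordinate map, and \<open>transition i j B\<close> expresses the
  coordinate \<open>x\<^sup>B\<close> of the chart \<open>j\<close> as a superfunction of the coordinates of the chart \<open>i\<close>.\<close>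
record ('a, 'i) atlas =
  base :: "'a topology"
  edim :: nat
  odim :: nat
  charts :: "'i set"
  cdom :: "'i \<Rightarrow> 'a set"
  cmap :: "'i \<Rightarrow> 'a \<Rightarrow> nat \<Rightarrow> real"
  transition :: "'i \<Rightarrow> 'i \<Rightarrow> sindex \<Rightarrow> sfun"

definition idx :: "('a, 'i) atlas \<Rightarrow> sindex set" where
  "idx M = indices (edim M) (odim M)"

definition overlap :: "('a, 'i) atlas \<Rightarrow> 'i \<Rightarrow> 'i \<Rightarrow> (nat \<Rightarrow> real) set" where
  "overlap M i j = cmap M i ` (cdom M i \<inter> cdom M j)"

definition supermanifold :: "('a, 'i) atlas \<Rightarrow> bool" where
  "supermanifold M \<longleftrightarrow>
     Hausdorff_space (base M) \<and> second_countable (base M) \<and>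
     (\<Union>i\<in>charts M. cdom M i) = topspace (base M) \<and>
     (\<forall>i\<in>charts M. openin (base M) (cdom M i) \<and>
        openin (Euclidean_space (edim M)) (cmap M i ` cdom M i) \<and>
        homeomorphic_map (subtopology (base M) (cdom M i))
          (subtopology (Euclidean_space (edim M)) (cmap M i ` cdom M i)) (cmap M i)) \<and>
     (\<forall>i\<in>charts M. \<forall>j\<in>charts M. \<forall>B\<in>idx M.
        superfun (xcoords (edim M) (odim M)) (xdom (edim M) (overlap M i j)) (transition M i j B) \<and>
        (\<forall>v\<in>xdom (edim M) (overlap M i j). homog (par B) (transition M i j B v))) \<and>
     (\<forall>i\<in>charts M. \<forall>j\<in>charts M. \<forall>y\<in>cdom M i \<inter> cdom M j. \<forall>v. xbody (edim M) v = cmap M i y \<longrightarrow>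
        (\<forall>b<edim M. body (transition M i j (Ev b) v) = cmap M j y b)) \<and>
     (\<forall>i\<in>charts M. \<forall>v\<in>xdom (edim M) (overlap M i i). \<forall>B\<in>idx M. transition M i i B v = var (Xc B) v) \<and>
     (\<forall>i\<in>charts M. \<forall>j\<in>charts M. \<forall>k\<in>charts M.
        \<forall>v\<in>xdom (edim M) (cmap M i ` (cdom M i \<inter> cdom M j \<inter> cdom M k)). \<forall>C\<in>idx M.
          transition M i k C v = sfeval (transition M j k C) (xpoint (\<lambda>B. transition M i j B v)))"

text \<open>The matrix \<open>\<partial>x'\<^sup>B/\<partial>x\<^sup>A\<close> (row \<open>A\<close>, column \<open>B\<close>) at the point \<open>v\<close>; \<open>x'\<close> are the coordinates of \<open>j\<close>.\<close>
definition jacobian :: "('a, 'i) atlas \<Rightarrow> 'i \<Rightarrow> 'i \<Rightarrow> (coord \<Rightarrow> real) \<Rightarrow> coord smat" where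
  "jacobian M i j v A B = pd (Xc A) (transition M i j B) v"

text \<open>\<open>X i A\<close> is the component \<open>X\<^sup>A\<close> in the chart \<open>i\<close>, where \<open>X = X\<^sup>A \<partial>/\<partial>x\<^sup>A\<close>. No parity is imposed.\<close>
definition vector_field :: "('a, 'i) atlas \<Rightarrow> ('i \<Rightarrow> sindex \<Rightarrow> sfun) \<Rightarrow> bool" where
  "vector_field M X \<longleftrightarrow>
     (\<forall>i\<in>charts M. \<forall>A\<in>idx M.
        superfun (xcoords (edim M) (odim M)) (xdom (edim M) (cmap M i ` cdom M i)) (X i A)) \<and>
     (\<forall>i\<in>charts M. \<forall>j\<in>charts M. \<forall>v\<in>xdom (edim M) (overlap M i j). \<forall>B\<in>idx M.
        sfeval (X j B) (xpoint (\<lambda>C. transition M i j C v)) =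
          (\<Sum>A\<in>idx M. X i A v * jacobian M i j v A B))"


section \<open>Mixed forms\<close>

definition mcoords :: "nat \<Rightarrow> nat \<Rightarrow> nat \<Rightarrow> nat \<Rightarrow> nat \<Rightarrow> nat \<Rightarrow> coord set" where
  "mcoords n m r s p q = xcoords n m \<union>
     {Pc A K | A K. A \<in> indices n m \<and> K \<in> indices p q} \<union>
     {Wc F K | F K. F \<in> indices r s \<and> K \<in> indices p q}"

text \<open>Admissible arguments over the superdomain with body \<open>U\<close>. Linear independence over a Grassmann
  algebra is linear independence of the bodies, and for odd covectors and odd rows of \<open>w\<close> only the
  entries with both indices odd have nonzero bodies.\<close>
definition mdom :: "nat \<Rightarrow> nat \<Rightarrow> nat \<Rightarrow> nat \<Rightarrow> (nat \<Rightarrow> real) set \<Rightarrow> (coord \<Rightarrow> real) set" where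
  "mdom n m s q U = {v. xbody n v \<in> U \<and>
     (\<forall>c. (\<forall>a<m. (\<Sum>k<q. v (Pc (Od a) (Od k)) * c k) = 0) \<and>
          (\<forall>f<s. (\<Sum>k<q. v (Wc (Od f) (Od k)) * c k) = 0) \<longrightarrow> (\<forall>k<q. c k = 0)) \<and>
     (\<forall>c. (\<forall>k<q. (\<Sum>f<s. c f * v (Wc (Od f) (Od k))) = 0) \<longrightarrow> (\<forall>f<s. c f = 0))}"

text \<open>The equation relating second derivatives with respect to the rows \<open>y\<close> and \<open>z\<close>
  (\<open>Pc A\<close> or \<open>Wc F\<close>), of parities \<open>a\<close> and \<open>b\<close>.\<close>
definition row_eq :: "nat \<Rightarrow> nat \<Rightarrow> (coord \<Rightarrow> real) set \<Rightarrow> sfun \<Rightarrow>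
    (sindex \<Rightarrow> coord) \<Rightarrow> nat \<Rightarrow> (sindex \<Rightarrow> coord) \<Rightarrow> nat \<Rightarrow> bool" where
  "row_eq p q D L y a z b \<longleftrightarrow> (\<forall>v\<in>D. \<forall>K\<in>indices p q. \<forall>N\<in>indices p q.
     pd (y K) (pd (z N) L) v + (-1) ^ (a * b + (a + b) * par N) * pd (z K) (pd (y N) L) v = 0)"

text \<open>The family of spaces \<open>\<Lambda>\<^bsup>r|s\<^esup>\<^bsub>p|q\<^esub>(T\<^sub>xM)\<close> over the superdomain with body \<open>U\<close>. The conditions
  involving matrices are identities between points with values in an arbitrary finitely generated
  Grassmann algebra; its generators \<open>N\<close> are taken from the natural numbers.\<close>
definition local_mixed_form :: "nat \<Rightarrow> nat \<Rightarrow> nat \<Rightarrow> nat \<Rightarrow> nat \<Rightarrow> nat \<Rightarrow> (nat \<Rightarrow> real) set \<Rightarrow> sfun \<Rightarrow> bool" where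
  "local_mixed_form n m r s p q U L \<longleftrightarrow>
     superfun (mcoords n m r s p q) (mdom n m s q U) L \<and>
     (\<forall>(N :: nat set) x P W. finite N \<and>
        (\<forall>c\<in>mcoords n m r s p q. homog (cpar c) (point x P W c) \<and> gens_in N (point x P W c)) \<and>
        body \<circ> point x P W \<in> mdom n m s q U \<longrightarrow>
          (\<forall>h\<in>GL p q. (\<forall>K\<in>indices p q. \<forall>K'\<in>indices p q. gens_in N (h K K')) \<longrightarrow>
             sfeval L (point x (smul (indices p q) P h) (smul (indices p q) W h)) =
               sfeval L (point x P W) * Ber p q h) \<and>
          (\<forall>g\<in>GL r s. \<forall>a. even_smat (indices n m) (indices r s) a \<and>
             (\<forall>F\<in>indices r s. \<forall>F'\<in>indices r s. gens_in N (g F F')) \<and>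
             (\<forall>A\<in>indices n m. \<forall>F\<in>indices r s. gens_in N (a A F)) \<longrightarrow>
             sfeval L (point x (\<lambda>A K. P A K + smul (indices r s) a W A K) (smul (indices r s) g W)) =
               sfeval L (point x P W) * Ber r s g)) \<and>
     (\<forall>A\<in>indices n m. \<forall>B\<in>indices n m.
        row_eq p q (mdom n m s q U) L (Pc A) (par A) (Pc B) (par B)) \<and>
     (\<forall>A\<in>indices n m. \<forall>F\<in>indices r s.
        row_eq p q (mdom n m s q U) L (Pc A) (par A) (Wc F) (par F)) \<and>
     (\<forall>F\<in>indices r s. \<forall>G\<in>indices r s.
        row_eq p q (mdom n m s q U) L (Wc F) (par F) (Wc G) (par G))"

text \<open>A section of the bundle, given by its local expressions \<open>L i\<close>, coefficients with respect to the
  coordinate bases. Under a change of coordinates covectors transform as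
  \<open>p\<^sub>A = (\<partial>x'\<^sup>B/\<partial>x\<^sup>A) p'\<^sub>B\<close> and volume forms as \<open>Dx' = Dx Ber (\<partial>x'/\<partial>x)\<close>. The law is stated with
  \<open>x, p', w\<close> as independent variables.\<close>
definition mixed_form ::
    "('a, 'i) atlas \<Rightarrow> nat \<Rightarrow> nat \<Rightarrow> nat \<Rightarrow> nat \<Rightarrow> ('i \<Rightarrow> sfun) \<Rightarrow> bool" where
  "mixed_form M r s p q L \<longleftrightarrow>
     (\<forall>i\<in>charts M. local_mixed_form (edim M) (odim M) r s p q (cmap M i ` cdom M i) (L i)) \<and>
     (\<forall>i\<in>charts M. \<forall>j\<in>charts M. \<forall>v\<in>mdom (edim M) (odim M) s q (overlap M i j).
        let P' = (\<lambda>B K. var (Pc B K) v); W = (\<lambda>F K. var (Wc F K) v); J = jacobian M i j v in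
        sfeval (L i) (point (\<lambda>A. var (Xc A) v) (smul (idx M) J P') W) =
          sfeval (L j) (point (\<lambda>B. transition M i j B v) P' W) * Ber (edim M) (odim M) J)"


section \<open>Operators on mixed forms\<close>

text \<open>The arguments \<open>r s p q\<close> of each operator describe the form it is applied to.\<close>

text \<open>\<open>\<sigma>\<^bsub>k|l\<^esub>\<close>: the smooth extension of the defining formula from the arguments with invertible
  \<open>w\<^sub>2\<^sub>2\<close>, normalized to vanish outside the domain.\<close>
definition stab :: "nat \<Rightarrow> nat \<Rightarrow> ('a, 'i) atlas \<Rightarrow> nat \<Rightarrow> nat \<Rightarrow> nat \<Rightarrow> nat \<Rightarrow> ('i \<Rightarrow> sfun) \<Rightarrow> 'i \<Rightarrow> sfun" where
  "stab k l M r s p q L i = (THE S.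
     let D = mdom (edim M) (odim M) (s + l) (q + l) (cmap M i ` cdom M i) in
     superfun (mcoords (edim M) (odim M) (r + k) (s + l) (p + k) (q + l)) D S \<and>
     (\<forall>v. v \<notin> D \<longrightarrow> S v = 0) \<and>
     (\<forall>v\<in>D.
        let P = (\<lambda>A K. var (Pc A K) v); W = (\<lambda>F K. var (Wc F K) v);
            I = indices k l;
            p2 = (\<lambda>A K. P A (shift p q K));
            w12 = (\<lambda>F K. W F (shift p q K));
            w21 = (\<lambda>F K. W (shift r s F) K);
            w22 = (\<lambda>F K. W (shift r s F) (shift p q K));
            u = smul I (sinv I w22) w21
        in sinvertible I w22 \<longrightarrow>
           S v = sfeval (L i) (point (\<lambda>A. var (Xc A) v)
                   (\<lambda>A K. P A K - smul I p2 u A K) (\<lambda>F K. W F K - smul I w12 u F K)) * Ber k l w22))"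

definition dbar :: "('a, 'i) atlas \<Rightarrow> nat \<Rightarrow> nat \<Rightarrow> nat \<Rightarrow> nat \<Rightarrow> ('i \<Rightarrow> sfun) \<Rightarrow> 'i \<Rightarrow> sfun" where
  "dbar M r s p q L i v = (-1) ^ r * (\<Sum>K\<in>indices p q. \<Sum>A\<in>idx M.
     var (Wc (Ev r) K) v * (-1) ^ (par A * par K) * pd (Xc A) (pd (Pc A K) (L i)) v)"

definition e_op :: "('a, 'i) atlas \<Rightarrow> ('i \<Rightarrow> sindex \<Rightarrow> sfun) \<Rightarrow>
    nat \<Rightarrow> nat \<Rightarrow> nat \<Rightarrow> nat \<Rightarrow> ('i \<Rightarrow> sfun) \<Rightarrow> 'i \<Rightarrow> sfun" where
  "e_op M X r s p q L i v = (-1) ^ r * (\<Sum>A\<in>idx M. X i A v *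
     (var (Pc A (Ev p)) v * L i v
      - (\<Sum>B\<in>idx M. \<Sum>K\<in>indices p q. (-1) ^ (par B * par K) *
           var (Pc A K) v * var (Pc B (Ev p)) v * pd (Pc B K) (L i) v)
      - (\<Sum>F\<in>indices r s. \<Sum>K\<in>indices p q. (-1) ^ (par F * par K) *
           var (Pc A K) v * var (Wc F (Ev p)) v * pd (Wc F K) (L i) v)))"

definition lie_homog :: "('a, 'i) atlas \<Rightarrow> nat \<Rightarrow> ('i \<Rightarrow> sindex \<Rightarrow> sfun) \<Rightarrow>
    nat \<Rightarrow> nat \<Rightarrow> nat \<Rightarrow> nat \<Rightarrow> ('i \<Rightarrow> sfun) \<Rightarrow> 'i \<Rightarrow> sfun" where
  "lie_homog M e X r s p q L i v =
     (\<Sum>A\<in>idx M. X i A v * pd (Xc A) (L i) v)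
     - (\<Sum>A\<in>idx M. \<Sum>B\<in>idx M. \<Sum>K\<in>indices p q. (-1) ^ (par A * e) *
          pd (Xc A) (X i B) v * var (Pc B K) v * pd (Pc A K) (L i) v)
     + (\<Sum>A\<in>idx M. (-1) ^ (par A * (e + 1)) * pd (Xc A) (X i A) v * L i v)"

text \<open>The component of parity \<open>e\<close> of a vector field; \<open>X\<^sup>A\<close> then has parity \<open>e\<close> plus that of \<open>A\<close>.\<close>
definition vpart :: "nat \<Rightarrow> ('i \<Rightarrow> sindex \<Rightarrow> sfun) \<Rightarrow> 'i \<Rightarrow> sindex \<Rightarrow> sfun" where
  "vpart e X i A v = hpart (e + par A) (X i A v)"

text \<open>\<open>lie_homog M e\<close> is the Lie derivative along a vector field of parity \<open>e\<close>; it is extended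
  additively to all vector fields.\<close>
definition lie :: "('a, 'i) atlas \<Rightarrow> ('i \<Rightarrow> sindex \<Rightarrow> sfun) \<Rightarrow>
    nat \<Rightarrow> nat \<Rightarrow> nat \<Rightarrow> nat \<Rightarrow> ('i \<Rightarrow> sfun) \<Rightarrow> 'i \<Rightarrow> sfun" where
  "lie M X r s p q L i v =
     lie_homog M 0 (vpart 0 X) r s p q L i v + lie_homog M 1 (vpart 1 X) r s p q L i v"

text \<open>Equality of mixed forms: of their local expressions on the domains of admissible arguments.\<close>
definition mform_eq :: "('a, 'i) atlas \<Rightarrow> nat \<Rightarrow> nat \<Rightarrow> nat \<Rightarrow> nat \<Rightarrow> ('i \<Rightarrow> sfun) \<Rightarrow> ('i \<Rightarrow> sfun) \<Rightarrow> bool" where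
  "mform_eq M r s p q L L' \<longleftrightarrow>
     (\<forall>i\<in>charts M. \<forall>v\<in>mdom (edim M) (odim M) s q (cmap M i ` cdom M i). L i v = L' i v)"

end

theory Submission
  imports Defs
begin

text \<open>By the row equations the second derivative of a mixed form \<open>L\<close> vanishes in every direction of the
  form column times row. Hence \<open>L\<close> is affine along the line from \<open>(p\<^sub>1, w\<^sub>1)\<close> to the argument in the
  definition of \<open>\<sigma>\<close>, and \<open>\<sigma> L\<close> is obtained from \<open>L\<close> by a first-order operator: it is \<open>e(X)\<close> with the
  row \<open>X\<^sup>A p\<^sub>A\<close> replaced by the new row of \<open>w\<close>. With this formula both sides of the identity are
  expanded by the Leibniz rule and agree term by term; the terms containing \<open>\<partial>X/\<partial>x\<close> and a second
  derivative of \<open>L\<close> agree by another use of the row equations.\<close>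


section \<open>Signs and parities in Grassmann algebras\<close>

text \<open>A mixed form carries no parity. Products are therefore arranged with the factors of
  known parity (variables, components of \<open>X\<close>) on the left and \<open>L\<close> or a
  derivative of it last: the Leibniz rule \<open>pd_mult\<close> asks for a parity of the left
  factor only. A field \<open>X\<close> without parity is split into its two parts at the very end.
  The map \<sigma> is given by a description, as a smooth extension across the zeros of the new
  corner entry of \<open>w\<close>. The first-order formula makes sense there as well, and
  continuity in that single entry makes the extension unique. Admissibility restricts only the body
  of \<open>x\<close> and entries with both indices odd, so a new even row and column leave it
  unchanged and one open set serves all forms involved. Substitution \<open>sfeval\<close> is a
  Taylor sum at the body of its argument. It is studied only along lines
  \<open>var c v - \<tau> *\<^sub>R n c\<close> of Grassmann-valued points: there the chain rule in
  the real parameter \<tau> takes the place of a Taylor theorem, and a vanishing second derivative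
  gives the value at \<tau> = 1 from the data at \<tau> = 0.\<close>

lemma minus_one_power_cong: "(even m \<longleftrightarrow> even n) \<Longrightarrow> (-1::'a::ring_1) ^ m = (-1) ^ n"
  by (cases "even m") auto

text \<open>Signs become real scalars, which pass through noncommutative products freely.\<close>

lemma minus_one_power_gr [simp]: "(-1::'g::linorder gr) ^ n * x = ((-1::real) ^ n) *\<^sub>R x"
  by (cases "even n") auto

lemma minus_one_power_gr_right [simp]: "x * (-1::'g::linorder gr) ^ n = ((-1::real) ^ n) *\<^sub>R x"
  by (cases "even n") auto

lemma coeff_simps [simp]:
  "coeff 0 I = 0"
  "coeff (a + b) I = coeff a I + coeff b I"
  "coeff (a - b) I = coeff a I - coeff b I"
  "coeff (- a) I = - coeff a I"
  "coeff (c *\<^sub>R a) I = c * coeff a I"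
  by (simp_all add: zero_gr.rep_eq plus_gr.rep_eq minus_gr.rep_eq uminus_gr.rep_eq scaleR_gr.rep_eq)

lemma coeff_sum: "coeff (sum f A) I = (\<Sum>a\<in>A. coeff (f a) I)"
  by (induction A rule: infinite_finite_induct) auto

lemma coeff_times_eq: "coeff (a * b) I =
    (if finite I then \<Sum>J\<in>Pow I. gsign J (I - J) * coeff a J * coeff b (I - J) else 0)"
  by (simp add: coeff_times coeff_infinite)

lemma coeff_of_real: "coeff (of_real c) I = (if I = {} then c else 0)"
  by (simp add: of_real_def coeff_one)

lemma coeff_gen: "coeff (gen g) I = (if I = {g} then 1 else 0)"
  by (simp add: gen_def coeff_gr_of)

abbreviation sg :: "nat \<Rightarrow> real" where "sg n \<equiv> (-1) ^ n"

lemma homog_cong: "(even a \<longleftrightarrow> even b) \<Longrightarrow> homog a x \<longleftrightarrow> homog b x"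
  by (simp add: homog_def)

lemma homog_iff: "homog a x \<longleftrightarrow> (\<forall>I. odd (card I + a) \<longrightarrow> coeff x I = 0)"
  unfolding homog_def by blast

lemma homog_zero [simp]: "homog a 0"
  and homog_add: "homog a x \<Longrightarrow> homog a y \<Longrightarrow> homog a (x + y)"
  and homog_diff: "homog a x \<Longrightarrow> homog a y \<Longrightarrow> homog a (x - y)"
  and homog_scaleR: "homog a x \<Longrightarrow> homog a (c *\<^sub>R x)"
  by (simp_all add: homog_iff)

lemma homog_sum: "(\<And>i. i \<in> A \<Longrightarrow> homog a (f i)) \<Longrightarrow> homog a (sum f A)"
  by (induction A rule: infinite_finite_induct) (auto intro: homog_add)

lemma homog_of_real [simp]: "homog 0 (of_real c)"
  by (auto simp: homog_def coeff_of_real)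

lemma homog_one [simp]: "homog 0 1"
  by (auto simp: homog_def coeff_one)

lemma homog_gen: "odd a \<Longrightarrow> homog a (gen g)"
  by (auto simp: homog_def coeff_gen)

lemma homog_times:
  assumes "homog a x" "homog b y"
  shows "homog (a + b) (x * y)"
  unfolding homog_def
proof (intro allI impI)
  fix I assume nz: "coeff (x * y) I \<noteq> 0"
  then have I: "finite I" by (metis coeff_infinite)
  from nz obtain J where J: "J \<in> Pow I" "gsign J (I - J) * coeff x J * coeff y (I - J) \<noteq> 0"
    unfolding coeff_times[OF I] by (rule sum.not_neutral_contains_not_neutral)
  then have "even (card J + a)" "even (card (I - J) + b)"
    using assms by (auto simp: homog_def)
  moreover have "card I = card J + card (I - J)"
    using I J(1) by (metis Pow_iff card_Diff_subset card_mono finite_subset le_add_diff_inverse)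
  ultimately show "even (card I + (a + b))" by simp
qed

lemma gsign_Un_left:
  "finite I \<Longrightarrow> finite J \<Longrightarrow> finite K \<Longrightarrow> I \<inter> J = {} \<Longrightarrow>
     gsign (I \<union> J) K = gsign I K * gsign J K"
  by (simp add: gsign_def inversions_Un_left power_add)

lemma gsign_Un_right:
  "finite I \<Longrightarrow> finite J \<Longrightarrow> finite K \<Longrightarrow> J \<inter> K = {} \<Longrightarrow>
     gsign I (J \<union> K) = gsign I J * gsign I K"
  by (simp add: gsign_def inversions_Un_right power_add)

lemma gsign_sq [simp]: "gsign I J * gsign I J = 1"
  by (simp add: gsign_def flip: power_mult_distrib)

text \<open>Each pair in I \<times> J is an inversion either of (I, J) or of (J, I), so the two
  inversion counts add up to the product of the cardinalities.\<close>

lemma gsign_swap: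
  assumes "finite I" "finite J" "I \<inter> J = {}"
  shows "gsign I J = (-1) ^ (card I * card J) * gsign J I"
proof -
  have "I \<times> J = {(i, j). i \<in> I \<and> j \<in> J \<and> j < i} \<union> {(i, j). i \<in> I \<and> j \<in> J \<and> i < j}"
    using assms(3) by (auto simp: disjoint_iff) (metis neqE)
  moreover have "finite {(i, j). i \<in> I \<and> j \<in> J \<and> j < i}" "finite {(i, j). i \<in> I \<and> j \<in> J \<and> i < j}"
    using assms by (auto intro: finite_subset[of _ "I \<times> J"])
  moreover have "{(i, j). i \<in> I \<and> j \<in> J \<and> j < i} \<inter> {(i, j). i \<in> I \<and> j \<in> J \<and> i < j} = {}" by auto
  ultimately have "card I * card J =
      inversions I J + card {(i, j). i \<in> I \<and> j \<in> J \<and> i < j}"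
    by (simp add: card_Un_disjoint inversions_def flip: card_cartesian_product)
  moreover have "card {(i, j). i \<in> I \<and> j \<in> J \<and> i < j} = inversions J I"
    unfolding inversions_def
    by (rule bij_betw_same_card[of prod.swap]) (auto simp: bij_betw_def inj_on_def image_def)
  ultimately have "card I * card J = inversions I J + inversions J I" by simp
  then show ?thesis by (simp add: gsign_def power_add)
qed

text \<open>Reindexing the product by \<open>J \<mapsto> I - J\<close> exchanges the factors. The
  sign from \<open>gsign_swap\<close> depends only on the parities of the two cardinalities, which
  homogeneity fixes wherever the coefficients are nonzero.\<close>

lemma supercommute:
  fixes x y :: "'g::linorder gr"
  assumes "homog a x" "homog b y"
  shows "x * y = sg (a * b) *\<^sub>R (y * x)"
proof (rule gr_eqI)
  fix I :: "'g set" assume I: "finite I"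
  have "coeff (x * y) I = (\<Sum>J\<in>Pow I. (-1) ^ (a * b) * (gsign (I - J) J * coeff y (I - J) * coeff x J))"
    unfolding coeff_times[OF I]
  proof (rule sum.cong)
    fix J assume J: "J \<in> Pow I"
    show "gsign J (I - J) * coeff x J * coeff y (I - J) =
        (-1) ^ (a * b) * (gsign (I - J) J * coeff y (I - J) * coeff x J)"
    proof (cases "coeff x J = 0 \<or> coeff y (I - J) = 0")
      case False
      then have "even (card J + a)" "even (card (I - J) + b)" using assms by (auto simp: homog_def)
      then have "(-1::real) ^ (card J * card (I - J)) = (-1) ^ (a * b)"
        by (intro minus_one_power_cong) auto
      then show ?thesis using gsign_swap[of J "I - J"] I J by (auto simp: finite_subset)
    qed auto
  qed auto
  also have "\<dots> = (\<Sum>J\<in>Pow I. (-1) ^ (a * b) * (gsign J (I - J) * coeff y J * coeff x (I - J)))"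
    by (rule sum.reindex_bij_witness[of _ "\<lambda>J. I - J" "\<lambda>J. I - J"]) (auto simp: double_diff)
  finally show "coeff (x * y) I = coeff (sg (a * b) *\<^sub>R (y * x)) I"
    by (simp add: coeff_times[OF I] sum_distrib_left)
qed

lemma supercommute_left:
  fixes x y z :: "'g::linorder gr"
  assumes "homog a x" "homog b y"
  shows "x * (y * z) = sg (a * b) *\<^sub>R (y * (x * z))"
  using supercommute[OF assms] by (metis mult.assoc mult_scaleR_left)

lemma even_commute: "homog 0 x \<Longrightarrow> homog b y \<Longrightarrow> x * y = y * (x :: 'g::linorder gr)"
  using supercommute[of 0 x b y] by simp

lemma coeff_hpart: "coeff (hpart e a) I = (if even (card I + e) then coeff a I else 0)"
  by (auto simp: hpart_def coeff_gr_of coeff_infinite)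

lemma homog_hpart: "homog e (hpart e a)"
  by (simp add: homog_def coeff_hpart)

lemma hpart_sum: "hpart e a + hpart (Suc e) a = a"
  by (rule gr_eqI) (simp add: coeff_hpart)

text \<open>The second factor may be inhomogeneous: it is the sum of its two homogeneous
  parts.\<close>

lemma even_central:
  fixes x y :: "'g::linorder gr"
  assumes "homog 0 x" shows "x * y = y * x"
proof -
  have "x * (hpart 0 y + hpart (Suc 0) y) = (hpart 0 y + hpart (Suc 0) y) * x"
    using even_commute[OF assms homog_hpart] by (simp add: distrib_left distrib_right)
  then show ?thesis by (simp add: hpart_sum)
qed


section \<open>Left derivatives in Grassmann algebras\<close>

lemma coeff_gderiv: "coeff (gderiv g a) I =
    (if g \<in> I then 0 else gsign {g} I * coeff a (insert g I))"
  by (auto simp: gderiv_def coeff_gr_of coeff_infinite)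

lemma gderiv_add: "gderiv g (a + b) = gderiv g a + gderiv g b"
  and gderiv_scaleR: "gderiv g (c *\<^sub>R a) = c *\<^sub>R gderiv g a"
  by (rule gr_eqI; simp add: coeff_gderiv algebra_simps)+

lemma gderiv_gen: "gderiv g (gen h) = (if g = h then 1 else 0)"
  by (rule gr_eqI) (auto simp: coeff_gderiv coeff_gen coeff_one)

lemma gderiv_of_real: "gderiv g (of_real c) = 0"
  by (rule gr_eqI) (auto simp: coeff_gderiv coeff_of_real)

lemma homog_gderiv: "homog a x \<Longrightarrow> homog (a + 1) (gderiv g x)"
  unfolding homog_def
proof (intro allI impI)
  fix I assume h: "\<forall>I. coeff x I \<noteq> 0 \<longrightarrow> even (card I + a)" and nz: "coeff (gderiv g x) I \<noteq> 0"
  then have "finite I" "g \<notin> I" "coeff x (insert g I) \<noteq> 0"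
    by (metis coeff_infinite, auto simp: coeff_gderiv split: if_splits)
  then show "even (card I + (a + 1))" using h by fastforce
qed

text \<open>The coefficient at \<open>I\<close> is a sum over splittings of the generators between
  \<open>x\<close> and \<open>y\<close>. If \<open>g\<close> is not in \<open>I\<close>, the
  splittings of \<open>insert g I\<close> with \<open>g\<close> on the side of \<open>x\<close> or
  of \<open>y\<close> give the two terms. If \<open>g\<close> is in \<open>I\<close>, the left-hand
  side has no such coefficient and the two terms on the right cancel splitting by splitting.\<close>

lemma gderiv_mult:
  fixes x y :: "'g::linorder gr"
  assumes "homog a x"
  shows "gderiv g (x * y) = gderiv g x * y + sg a *\<^sub>R (x * gderiv g y)"
proof (rule gr_eqI)
  fix I :: "'g set" assume I: "finite I"
  show "coeff (gderiv g (x * y)) I = coeff (gderiv g x * y + sg a *\<^sub>R (x * gderiv g y)) I"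
  proof (cases "g \<in> I")
    case True
    have "coeff (gderiv g x * y) I = (\<Sum>J\<in>Pow (I - {g}). gsign J (I - J) * (gsign {g} J * coeff x (insert g J)) * coeff y (I - J))"
      unfolding coeff_times[OF I]
      by (rule sum.mono_neutral_cong_right) (auto simp: I coeff_gderiv)
    moreover have "coeff (x * gderiv g y) I = (\<Sum>J\<in>insert g ` Pow (I - {g}). gsign J (I - J) * coeff x J * (gsign {g} (I - J) * coeff y (insert g (I - J))))"
      unfolding coeff_times[OF I]
    proof (rule sum.mono_neutral_cong_right)
      show "\<forall>J\<in>Pow I - insert g ` Pow (I - {g}). gsign J (I - J) * coeff x J * coeff (gderiv g y) (I - J) = 0"
      proof
        fix J assume J: "J \<in> Pow I - insert g ` Pow (I - {g})"
        have "g \<notin> J"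
        proof
          assume "g \<in> J"
          then have "J = insert g (J - {g})" "J - {g} \<in> Pow (I - {g})" using J by auto
          then show False using J by blast
        qed
        then show "gsign J (I - J) * coeff x J * coeff (gderiv g y) (I - J) = 0"
          using True by (simp add: coeff_gderiv)
      qed
    qed (use I True in \<open>auto simp: coeff_gderiv\<close>)
    moreover have "inj_on (insert g) (Pow (I - {g}))"
      by (auto simp: inj_on_def)
    ultimately have "coeff (gderiv g x * y + sg a *\<^sub>R (x * gderiv g y)) I =
      (\<Sum>J\<in>Pow (I - {g}). gsign J (I - J) * (gsign {g} J * coeff x (insert g J)) * coeff y (I - J)
         + (-1) ^ a * (gsign (insert g J) (I - insert g J) * coeff x (insert g J) *
           (gsign {g} (I - insert g J) * coeff y (insert g (I - insert g J)))))"
      by (simp add: sum.reindex sum.distrib sum_distrib_left)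
    also have "\<dots> = 0"
    proof (rule sum.neutral, rule ballI)
      fix J assume J: "J \<in> Pow (I - {g})"
      define K where "K = I - insert g J"
      have e: "I - J = insert g K" "I - insert g J = K" "insert g K = {g} \<union> K" "insert g J = {g} \<union> J" "g \<notin> J" "g \<notin> K"
        using J True by (auto simp: K_def)
      have f: "finite J" "finite K" using I J by (auto simp: K_def finite_subset)
      have 1: "gsign J (insert g K) = gsign J {g} * gsign J K"
        unfolding e(3) using f e(5,6) by (intro gsign_Un_right) auto
      have 2: "gsign (insert g J) K = gsign {g} K * gsign J K"
        unfolding e(4) using f e(5,6) by (intro gsign_Un_left) auto
      have 3: "gsign {g} J = (-1) ^ card J * gsign J {g}"
        using gsign_swap[of "{g}" J] f e(5,6) by auto
      show "gsign J (I - J) * (gsign {g} J * coeff x (insert g J)) * coeff y (I - J)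
         + (-1) ^ a * (gsign (insert g J) (I - insert g J) * coeff x (insert g J) *
           (gsign {g} (I - insert g J) * coeff y (insert g (I - insert g J)))) = 0"
      proof (cases "coeff x (insert g J) = 0")
        case False
        \<comment> \<open>The monomial of \<open>x\<close> has one generator more than
          \<open>J\<close>; this is the source of the minus sign that makes the two terms
          cancel.\<close>
        then have "even (Suc (card J) + a)" using assms f(1) e(5) card_insert_disjoint[of J g] unfolding homog_def by metis
        then have a: "(-1::real) ^ a = - ((-1) ^ card J)" by (cases "even a") auto
        have "gsign J (insert g K) * gsign {g} J = (-1) ^ card J * gsign J K"
          unfolding 1 3 using gsign_sq[of J "{g}"] by (simp add: algebra_simps)
        moreover have "gsign (insert g J) K * gsign {g} K = gsign J K"
          unfolding 2 using gsign_sq[of "{g}" K] by (simp add: algebra_simps)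
        ultimately have "gsign J (insert g K) * gsign {g} J
            - (-1) ^ card J * (gsign (insert g J) K * gsign {g} K) = 0" by simp
        then have "(gsign J (insert g K) * gsign {g} J
            - (-1) ^ card J * (gsign (insert g J) K * gsign {g} K))
            * (coeff x (insert g J) * coeff y (insert g K)) = 0" by simp
        then show ?thesis unfolding e(1,2) a by (simp only: algebra_simps)
      qed auto
    qed
    finally show ?thesis using True by (simp add: coeff_gderiv)
  next
    case False
    have Pow: "Pow (insert g I) = Pow I \<union> insert g ` Pow I" by (rule Pow_insert)
    have inj: "inj_on (insert g) (Pow I)"
      by (rule inj_onI) (metis False PowD insert_ident subsetD)
    have "coeff (gderiv g (x * y)) I = gsign {g} I *
       ((\<Sum>J\<in>Pow I. gsign J (insert g I - J) * coeff x J * coeff y (insert g I - J)) +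
        (\<Sum>J\<in>insert g ` Pow I. gsign J (insert g I - J) * coeff x J * coeff y (insert g I - J)))"
      using False I unfolding coeff_gderiv
      by (subst coeff_times) (auto simp: Pow intro!: sum.union_disjoint)
    also have "\<dots> = (\<Sum>J\<in>Pow I. gsign {g} I * (gsign J (insert g I - J) * coeff x J * coeff y (insert g I - J)))
       + (\<Sum>J\<in>Pow I. gsign {g} I * (gsign (insert g J) (insert g I - insert g J) * coeff x (insert g J) * coeff y (insert g I - insert g J)))"
      by (simp add: sum.reindex[OF inj] distrib_left sum_distrib_left)
    also have "(\<Sum>J\<in>Pow I. gsign {g} I * (gsign J (insert g I - J) * coeff x J * coeff y (insert g I - J)))
       = coeff (sg a *\<^sub>R (x * gderiv g y)) I"
      unfolding coeff_simps coeff_times[OF I] sum_distrib_left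
    proof (rule sum.cong)
      fix J assume J: "J \<in> Pow I"
      define K where "K = I - J"
      have e: "I - J = K" "I = J \<union> K" "insert g I - J = {g} \<union> K" "J \<inter> K = {}" "g \<notin> J" "g \<notin> K"
        using J False by (auto simp: K_def)
      have f: "finite J" "finite K" using I J by (auto simp: K_def finite_subset)
      have 1: "gsign J ({g} \<union> K) = gsign J {g} * gsign J K"
        using f e(4,5,6) by (intro gsign_Un_right) auto
      have 2: "gsign {g} I = gsign {g} J * gsign {g} K"
        unfolding e(2) using f e(4,5,6) by (intro gsign_Un_right) auto
      have 3: "gsign {g} J = (-1) ^ card J * gsign J {g}"
        using gsign_swap[of "{g}" J] f e(5,6) by auto
      show "gsign {g} I * (gsign J (insert g I - J) * coeff x J * coeff y (insert g I - J)) =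
          (-1) ^ a * (gsign J (I - J) * coeff x J * coeff (gderiv g y) (I - J))"
      proof (cases "coeff x J = 0")
        case nz: False
        then have "even (card J + a)" using assms by (auto simp: homog_def)
        then have a: "(-1::real) ^ a = (-1) ^ card J" by (intro minus_one_power_cong) auto
        have "gsign {g} I * gsign J ({g} \<union> K) = (-1) ^ card J * (gsign J K * gsign {g} K)"
          unfolding 1 2 3 using gsign_sq[of J "{g}"] by (simp add: algebra_simps)
        then show ?thesis unfolding e(1,3) a using e(5,6) by (simp add: coeff_gderiv)
      qed auto
    qed auto
    also have "(\<Sum>J\<in>Pow I. gsign {g} I * (gsign (insert g J) (insert g I - insert g J) * coeff x (insert g J) * coeff y (insert g I - insert g J)))
        = coeff (gderiv g x * y) I"
      unfolding coeff_times[OF I]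
    proof (rule sum.cong)
      fix J assume J: "J \<in> Pow I"
      define K where "K = I - J"
      have e: "I - J = K" "I = J \<union> K" "insert g I - insert g J = K" "insert g J = {g} \<union> J" "J \<inter> K = {}" "g \<notin> J" "g \<notin> K"
        using J False by (auto simp: K_def)
      have f: "finite J" "finite K" using I J by (auto simp: K_def finite_subset)
      have 1: "gsign ({g} \<union> J) K = gsign {g} K * gsign J K"
        using f e(5,6,7) by (intro gsign_Un_left) auto
      have 2: "gsign {g} I = gsign {g} J * gsign {g} K"
        unfolding e(2) using f e(5,6,7) by (intro gsign_Un_right) auto
      have "gsign {g} I * gsign ({g} \<union> J) K = gsign J K * gsign {g} J"
        unfolding 1 2 using gsign_sq[of "{g}" K] by (simp add: algebra_simps)
      then show "gsign {g} I * (gsign (insert g J) (insert g I - insert g J) * coeff x (insert g J) * coeff y (insert g I - insert g J)) =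
          gsign J (I - J) * coeff (gderiv g x) J * coeff y (I - J)"
        unfolding e(1,3) using e(6,7) by (simp add: coeff_gderiv)
    qed auto
    finally show ?thesis by simp
  qed
qed

text \<open>Inserting \<open>g\<close> and \<open>h\<close> in the two possible orders differs by
  the one inversion between them; for \<open>g = h\<close> both sides vanish.\<close>

lemma gderiv_anticommute:
  fixes x :: "'a::linorder gr"
  shows "gderiv g (gderiv h x) = - gderiv h (gderiv g x)"
proof (rule gr_eqI)
  fix I :: "'a set" assume I: "finite I"
  show "coeff (gderiv g (gderiv h x)) I = coeff (- gderiv h (gderiv g x)) I"
  proof (cases "g \<in> I \<or> h \<in> I \<or> g = h")
    case False
    then have "gsign {h} ({g} \<union> I) = gsign {h} {g} * gsign {h} I"
        "gsign {g} ({h} \<union> I) = gsign {g} {h} * gsign {g} I"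
      using I gsign_Un_right[of "{h}" "{g}" I] gsign_Un_right[of "{g}" "{h}" I] by auto
    moreover have "gsign {g} {h} = - gsign {h} {g}"
      using gsign_swap[of "{g}" "{h}"] False by auto
    ultimately show ?thesis using False by (auto simp: coeff_gderiv insert_commute)
  qed (auto simp: coeff_gderiv)
qed

section \<open>Generators occurring in an element, body, soul and nilpotency\<close>

lemma gderiv_gens_in: "gens_in N x \<Longrightarrow> g \<notin> N \<Longrightarrow> gderiv g x = 0"
  by (rule gr_eqI) (auto simp: coeff_gderiv gens_in_def)

lemma gens_in_gderiv: "gens_in N x \<Longrightarrow> gens_in N (gderiv g x)"
  by (auto simp: gens_in_def coeff_gderiv split: if_splits)

lemma gens_in_zero [simp]: "gens_in N 0"
  by (simp add: gens_in_def)

lemma gens_in_iff: "gens_in N x \<longleftrightarrow> (\<forall>I. \<not> I \<subseteq> N \<longrightarrow> coeff x I = 0)"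
  unfolding gens_in_def by blast

lemma gens_in_add: "gens_in N x \<Longrightarrow> gens_in N y \<Longrightarrow> gens_in N (x + y)"
  and gens_in_diff: "gens_in N x \<Longrightarrow> gens_in N y \<Longrightarrow> gens_in N (x - y)"
  and gens_in_scaleR: "gens_in N x \<Longrightarrow> gens_in N (c *\<^sub>R x)"
  by (simp_all add: gens_in_iff)

lemma gens_in_of_real [simp]: "gens_in N (of_real c)"
  by (simp add: gens_in_def coeff_of_real)

lemma gens_in_gen: "g \<in> N \<Longrightarrow> gens_in N (gen g)"
  by (simp add: gens_in_def coeff_gen)

lemma gens_in_mono: "gens_in N x \<Longrightarrow> N \<subseteq> N' \<Longrightarrow> gens_in N' x"
  by (auto simp: gens_in_def)

lemma gens_in_times:
  assumes "gens_in N x" "gens_in N y" shows "gens_in N (x * y)"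
  unfolding gens_in_def
proof (intro allI impI)
  fix I assume nz: "coeff (x * y) I \<noteq> 0"
  then have I: "finite I" by (metis coeff_infinite)
  from nz obtain J where J: "J \<in> Pow I" "gsign J (I - J) * coeff x J * coeff y (I - J) \<noteq> 0"
    unfolding coeff_times[OF I] by (rule sum.not_neutral_contains_not_neutral)
  then show "I \<subseteq> N" using assms unfolding gens_in_def
    by (metis Diff_partition Pow_iff le_sup_iff mult_eq_0_iff)
qed

lemma body_diff: "body (a - b) = body a - body b" by (simp add: body_def)
lemma body_scaleR: "body (c *\<^sub>R a) = c * body a" by (simp add: body_def)
lemma body_of_real [simp]: "body (of_real c) = c" by (simp add: body_def coeff_of_real)
lemma body_gen [simp]: "body (gen g) = 0" by (simp add: body_def coeff_gen)
lemma body_soul: "body (soul a) = 0" by (simp add: soul_def body_diff)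
lemma body_times: "body (a * b) = body a * body b" by (simp add: body_def coeff_times)
lemma body_homog: "homog a x \<Longrightarrow> odd a \<Longrightarrow> body x = 0" by (force simp: body_def homog_def)
lemma homog_soul: "homog 0 x \<Longrightarrow> homog 0 (soul x)"
  by (simp add: soul_def homog_diff)
lemma gens_in_soul: "gens_in N x \<Longrightarrow> gens_in N (soul x)"
  by (simp add: soul_def gens_in_diff)

text \<open>Every factor without body contributes at least one generator to each monomial, and only
  \<open>card N\<close> of them are available. This is what truncates Taylor sums.\<close>

lemma nilpotent_prod:
  fixes xs :: "'g::linorder gr list"
  assumes "finite N" "\<And>x. x \<in> set xs \<Longrightarrow> gens_in N x \<and> body x = 0" "length xs > card N"
  shows "prod_list xs = 0"
proof -
  \<comment> \<open>The induction counts generators: each monomial of the product has at least as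
    many as there are factors.\<close>
  have *: "(coeff (prod_list xs) I \<noteq> 0 \<longrightarrow> length xs \<le> card I) \<and> gens_in N (prod_list xs)"
    if "\<And>x. x \<in> set xs \<Longrightarrow> gens_in N x \<and> body x = 0" for xs :: "'g gr list" and I
    using that
  proof (induction xs arbitrary: I)
    case Nil
    then show ?case using gens_in_of_real[of N 1] by simp
  next
    case (Cons x xs)
    have g: "gens_in N (prod_list (x # xs))" using Cons by (auto intro!: gens_in_times)
    have "length (x # xs) \<le> card I" if nz: "coeff (prod_list (x # xs)) I \<noteq> 0"
    proof -
      have I: "finite I" using nz by (metis coeff_infinite)
      from nz obtain J where J: "J \<in> Pow I" "gsign J (I - J) * coeff x J * coeff (prod_list xs) (I - J) \<noteq> 0"
        unfolding prod_list.Cons coeff_times[OF I] by (rule sum.not_neutral_contains_not_neutral)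
      then have "length xs \<le> card (I - J)" using Cons by auto
      moreover have "J \<noteq> {}" using J Cons.prems[of x] by (auto simp: body_def)
      moreover have "card I = card J + card (I - J)"
        using I J(1) by (metis Pow_iff card_Diff_subset card_mono finite_subset le_add_diff_inverse)
      moreover have "finite J" using I J finite_subset by auto
      ultimately show ?thesis using card_gt_0_iff[of J] by simp
    qed
    with g show ?case by blast
  qed
  show ?thesis
  proof (rule gr_eqI)
    fix I :: "'g set" assume "finite I"
    have "\<not> (coeff (prod_list xs) I \<noteq> 0)"
    proof
      assume nz: "coeff (prod_list xs) I \<noteq> 0"
      then have "length xs \<le> card I" "I \<subseteq> N" using *[of xs I] assms(2) by (auto simp: gens_in_def)
      then show False using assms(1,3) card_mono[of N I] by linarith
    qed
    then show "coeff (prod_list xs) I = coeff 0 I" by simp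
  qed
qed

section \<open>Smooth functions of countably many variables\<close>

lemma pderivs_append: "pderivs (cs @ ds) f = pderivs cs (pderivs ds f)"
  by (induction cs) auto

lemma continuous_fun_upd:
  fixes v :: "'c \<Rightarrow> real"
  shows "continuous_on UNIV (\<lambda>t. v(c := t))"
proof (rule continuous_on_coordinatewise_then_product)
  fix i
  show "continuous_on UNIV (\<lambda>t. (v(c := t)) i)"
    by (cases "i = c") (auto intro!: continuous_intros)
qed

lemma continuous_fun_upd2:
  fixes v :: "'c \<Rightarrow> real"
  shows "continuous_on UNIV (\<lambda>x. v(c := fst x, d := snd x))"
proof (rule continuous_on_coordinatewise_then_product)
  fix i
  show "continuous_on UNIV (\<lambda>x. (v(c := fst x, d := snd x)) i)"
    by (cases "i = d"; cases "i = c") (auto intro!: continuous_intros)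
qed

lemma open_fun_upd:
  fixes v :: "'c \<Rightarrow> real"
  assumes "open D" shows "open {t. v(c := t) \<in> D}"
  using open_vimage[OF assms continuous_fun_upd[of v c]] by (simp add: vimage_def)

lemma eventually_fun_upd:
  fixes v :: "'c \<Rightarrow> real"
  assumes "open D" "v \<in> D" shows "\<forall>\<^sub>F t in nhds (v c). v(c := t) \<in> D"
  using open_fun_upd[OF assms(1), of v c] assms(2) unfolding eventually_nhds by force

lemma pderivs_cong:
  assumes "open D" "\<And>v. v \<in> D \<Longrightarrow> f v = g v" "v \<in> D"
  shows "pderivs cs f v = pderivs cs g v"
  using assms(3)
proof (induction cs arbitrary: v)
  case (Cons c cs)
  have "\<forall>\<^sub>F t in nhds (v c). pderivs cs f (v(c := t)) = pderivs cs g (v(c := t))"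
    using eventually_fun_upd[OF assms(1) Cons.prems, of c] by eventually_elim (rule Cons.IH)
  then show ?case by (simp add: deriv_cong_ev)
qed (use assms in simp)

lemma pderivs_has_derivative:
  "(\<lambda>t. f (v(c := t))) differentiable (at (v c)) \<Longrightarrow> pderivs [c] f v = d \<Longrightarrow>
     ((\<lambda>t. f (v(c := t))) has_real_derivative d) (at (v c))"
  using DERIV_deriv_iff_real_differentiable by auto

lemma smooth_onD:
  assumes "smooth_on D f"
  shows "continuous_on D f" "v \<in> D \<Longrightarrow> (\<lambda>t. f (v(c := t))) differentiable (at (v c))"
    "smooth_on D (pderivs cs f)"
proof -
  show "continuous_on D f" "v \<in> D \<Longrightarrow> (\<lambda>t. f (v(c := t))) differentiable (at (v c))"
    using assms unfolding smooth_on_def by (metis pderivs.simps(1))+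
  show "smooth_on D (pderivs cs f)"
    using assms unfolding smooth_on_def by (metis pderivs_append)
qed

lemma smooth_on_subset: "smooth_on D f \<Longrightarrow> E \<subseteq> D \<Longrightarrow> smooth_on E f"
  unfolding smooth_on_def by (blast intro: continuous_on_subset)

text \<open>A coinduction principle: \<open>smooth_on\<close> speaks of all iterated derivatives,
  and a class of continuous, partially differentiable functions that is stable under one partial
  derivative contains them all. Stability is needed only up to equality on \<open>D\<close>, since
  derivatives on an open set are local. No formula for iterated derivatives is required.\<close>

lemma smooth_on_coinduct:
  assumes D: "open D" and "P f"
    and step: "\<And>f. P f \<Longrightarrow> continuous_on D f \<and>
      (\<forall>c. \<forall>v\<in>D. (\<lambda>t. f (v(c := t))) differentiable (at (v c))) \<and>
      (\<forall>c. \<exists>g. P g \<and> (\<forall>v\<in>D. pderivs [c] f v = g v))"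
  shows "smooth_on D f"
  unfolding smooth_on_def
proof
  fix cs
  have "\<exists>g. P g \<and> (\<forall>v\<in>D. pderivs cs f v = g v)"
  proof (induction cs)
    case Nil
    then show ?case using \<open>P f\<close> by auto
  next
    case (Cons c cs)
    then obtain g where g: "P g" "\<And>v. v \<in> D \<Longrightarrow> pderivs cs f v = g v" by blast
    from step[OF g(1)] obtain h where h: "P h" "\<And>v. v \<in> D \<Longrightarrow> pderivs [c] g v = h v" by blast
    have "pderivs (c # cs) f v = h v" if "v \<in> D" for v
    proof -
      have "pderivs [c] (pderivs cs f) v = pderivs [c] g v"
        by (rule pderivs_cong[OF D _ that]) (rule g(2))
      with h(2)[OF that] show ?thesis by simp
    qed
    with h(1) show ?case by blast
  qed
  then obtain g where g: "P g" "\<And>v. v \<in> D \<Longrightarrow> pderivs cs f v = g v" by blast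
  have "(\<lambda>t. pderivs cs f (v(c := t))) differentiable (at (v c))" if v: "v \<in> D" for c v
  proof -
    have "(\<lambda>t. g (v(c := t))) differentiable (at (v c))" using step[OF g(1)] v by blast
    then obtain d where d: "((\<lambda>t. g (v(c := t))) has_field_derivative d) (at (v c))"
      unfolding real_differentiable_def by blast
    have "\<forall>\<^sub>F t in nhds (v c). g (v(c := t)) = pderivs cs f (v(c := t))"
      using eventually_fun_upd[OF D v, of c] by eventually_elim (simp add: g(2))
    from DERIV_cong_ev[OF refl this refl] d show ?thesis
      unfolding real_differentiable_def by blast
  qed
  moreover have "continuous_on D (pderivs cs f)"
    using step[OF g(1)] g(2) continuous_on_cong[of D D "pderivs cs f" g] by blast
  ultimately show "continuous_on D (pderivs cs f) \<and>
      (\<forall>c. \<forall>v\<in>D. (\<lambda>t. pderivs cs f (v(c := t))) differentiable (at (v c)))" by blast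
qed

lemma smooth_on_cong:
  assumes "open D" "smooth_on D f" "\<And>v. v \<in> D \<Longrightarrow> g v = f v"
  shows "smooth_on D g"
proof (rule smooth_on_coinduct[where P = "\<lambda>g. \<exists>f. smooth_on D f \<and> (\<forall>v\<in>D. g v = f v)", OF assms(1)])
  show "\<exists>f. smooth_on D f \<and> (\<forall>v\<in>D. g v = f v)" using assms by blast
next
  fix g :: "(coord \<Rightarrow> real) \<Rightarrow> real" assume "\<exists>f. smooth_on D f \<and> (\<forall>v\<in>D. g v = f v)"
  then obtain f where f: "smooth_on D f" "\<And>v. v \<in> D \<Longrightarrow> g v = f v" by blast
  have "(\<lambda>t. g (v(c := t))) differentiable (at (v c))" if v: "v \<in> D" for c v
  proof -
    obtain d where d: "((\<lambda>t. f (v(c := t))) has_field_derivative d) (at (v c))"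
      using smooth_onD(2)[OF f(1) v] unfolding real_differentiable_def by blast
    have "\<forall>\<^sub>F t in nhds (v c). f (v(c := t)) = g (v(c := t))"
      using eventually_fun_upd[OF assms(1) v, of c] by eventually_elim (simp add: f(2))
    from DERIV_cong_ev[OF refl this refl] d show ?thesis
      unfolding real_differentiable_def by blast
  qed
  moreover have "continuous_on D g"
    using smooth_onD(1)[OF f(1)] f(2) continuous_on_cong[of D D g f] by blast
  moreover have "\<exists>h. (\<exists>f. smooth_on D f \<and> (\<forall>v\<in>D. h v = f v)) \<and> (\<forall>v\<in>D. pderivs [c] g v = h v)" for c
  proof -
    have "\<forall>v\<in>D. pderivs [c] g v = pderivs [c] f v"
      by (intro ballI pderivs_cong[OF assms(1)]) (simp_all add: f(2))
    then show ?thesis using smooth_onD(3)[OF f(1), of "[c]"] by blast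
  qed
  ultimately show "continuous_on D g \<and>
      (\<forall>c. \<forall>v\<in>D. (\<lambda>t. g (v(c := t))) differentiable (at (v c))) \<and>
      (\<forall>c. \<exists>h. (\<exists>f. smooth_on D f \<and> (\<forall>v\<in>D. h v = f v)) \<and> (\<forall>v\<in>D. pderivs [c] g v = h v))"
    by blast
qed

lemma smooth_on_has_derivative:
  assumes "smooth_on D f" "v(c := t) \<in> D"
  shows "((\<lambda>s. f (v(c := s))) has_real_derivative pderivs [c] f (v(c := t))) (at t)"
  using smooth_onD(2)[OF assms, of c] DERIV_deriv_iff_real_differentiable by auto

lemma smooth_on_has_derivative':
  assumes "smooth_on D f" "v \<in> D"
  shows "((\<lambda>s. f (v(c := s))) has_real_derivative pderivs [c] f v) (at (v c))"
  using smooth_on_has_derivative[OF assms(1), of v c "v c"] assms(2) by simp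

lemma smooth_on_const: "open D \<Longrightarrow> smooth_on D (\<lambda>v. k)"
  by (rule smooth_on_coinduct[where P = "\<lambda>f. \<exists>k. f = (\<lambda>v. k)"]) auto

lemma smooth_on_coord: "open D \<Longrightarrow> smooth_on D (\<lambda>v. v d)"
proof (rule smooth_on_coinduct[where P = "\<lambda>f. f = (\<lambda>v. v d) \<or> (\<exists>k. f = (\<lambda>v. k))"])
  fix f :: "(coord \<Rightarrow> real) \<Rightarrow> real" assume f: "f = (\<lambda>v. v d) \<or> (\<exists>k. f = (\<lambda>v. k))"
  have *: "(\<lambda>t. (v(c := t)) d) differentiable (at (v c))" for v :: "coord \<Rightarrow> real" and c
    by (cases "c = d") auto
  have **: "pderivs [c] (\<lambda>v. v d) = (\<lambda>v. if c = d then 1 else 0)" for c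
    by (cases "c = d") auto
  have "continuous_on D f"
    using f by (auto intro: continuous_on_subset[OF continuous_on_product_coordinates])
  moreover have "\<exists>g. (g = (\<lambda>v. v d) \<or> (\<exists>k. g = (\<lambda>v. k))) \<and> (\<forall>v\<in>D. pderivs [c] f v = g v)" for c
    using f
  proof
    assume "f = (\<lambda>v. v d)"
    then show ?thesis using **[of c] by auto
  qed auto
  ultimately show "continuous_on D f \<and>
      (\<forall>c. \<forall>v\<in>D. (\<lambda>t. f (v(c := t))) differentiable (at (v c))) \<and>
      (\<forall>c. \<exists>g. (g = (\<lambda>v. v d) \<or> (\<exists>k. g = (\<lambda>v. k))) \<and> (\<forall>v\<in>D. pderivs [c] f v = g v))"
    using f * by auto
qed auto

text \<open>The invariant class for coinduction: the derivative of a product is a sum of products,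
  so sums and products have to be closed up together.\<close>

inductive smooth_closure :: "(coord \<Rightarrow> real) set \<Rightarrow> ((coord \<Rightarrow> real) \<Rightarrow> real) \<Rightarrow> bool" for D where
  base: "smooth_on D f \<Longrightarrow> smooth_closure D f"
| add: "smooth_closure D f \<Longrightarrow> smooth_closure D g \<Longrightarrow> smooth_closure D (\<lambda>v. f v + g v)"
| mult: "smooth_closure D f \<Longrightarrow> smooth_closure D g \<Longrightarrow> smooth_closure D (\<lambda>v. f v * g v)"

lemma smooth_closure_smooth:
  assumes "open D" "smooth_closure D f"
  shows "smooth_on D f"
proof (rule smooth_on_coinduct[where P = "smooth_closure D", OF assms])
  fix f assume "smooth_closure D f"
  then show "continuous_on D f \<and>
      (\<forall>c. \<forall>v\<in>D. (\<lambda>t. f (v(c := t))) differentiable (at (v c))) \<and>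
      (\<forall>c. \<exists>g. smooth_closure D g \<and> (\<forall>v\<in>D. pderivs [c] f v = g v))"
  proof induction
    case (base f)
    then show ?case
      using smooth_onD[OF base] smooth_closure.base by blast
  next
    case (add f g)
    have "\<exists>h. smooth_closure D h \<and> (\<forall>v\<in>D. pderivs [c] (\<lambda>v. f v + g v) v = h v)" for c
    proof -
      obtain f' g' where h: "smooth_closure D f'" "\<forall>v\<in>D. pderivs [c] f v = f' v"
        "smooth_closure D g'" "\<forall>v\<in>D. pderivs [c] g v = g' v" using add.IH by blast
      have "pderivs [c] (\<lambda>v. f v + g v) v = f' v + g' v" if v: "v \<in> D" for v
      proof -
        have "((\<lambda>t. f (v(c := t))) has_real_derivative f' v) (at (v c))"
          "((\<lambda>t. g (v(c := t))) has_real_derivative g' v) (at (v c))"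
          using h v add.IH by (blast intro: pderivs_has_derivative)+
        from DERIV_add[OF this] show ?thesis by (simp add: DERIV_imp_deriv)
      qed
      then show ?thesis using smooth_closure.add[OF h(1,3)] by blast
    qed
    then show ?case using add.IH by (auto intro: continuous_on_add)
  next
    case (mult f g)
    have "\<exists>h. smooth_closure D h \<and> (\<forall>v\<in>D. pderivs [c] (\<lambda>v. f v * g v) v = h v)" for c
    proof -
      obtain f' g' where h: "smooth_closure D f'" "\<forall>v\<in>D. pderivs [c] f v = f' v"
        "smooth_closure D g'" "\<forall>v\<in>D. pderivs [c] g v = g' v" using mult.IH by blast
      have "pderivs [c] (\<lambda>v. f v * g v) v = f' v * g v + f v * g' v" if v: "v \<in> D" for v
      proof -
        have "((\<lambda>t. f (v(c := t))) has_real_derivative f' v) (at (v c))"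
          "((\<lambda>t. g (v(c := t))) has_real_derivative g' v) (at (v c))"
          using h v mult.IH by (blast intro: pderivs_has_derivative)+
        from DERIV_mult[OF this] show ?thesis by (simp add: DERIV_imp_deriv algebra_simps)
      qed
      moreover have "smooth_closure D (\<lambda>v. f' v * g v + f v * g' v)"
        using mult.hyps h by (intro smooth_closure.intros(2,3)) auto
      ultimately show ?thesis by blast
    qed
    then show ?case using mult.IH by (auto intro: continuous_on_mult)
  qed
qed

lemma smooth_on_add: "open D \<Longrightarrow> smooth_on D f \<Longrightarrow> smooth_on D g \<Longrightarrow> smooth_on D (\<lambda>v. f v + g v)"
  by (intro smooth_closure_smooth smooth_closure.intros(2)) (auto intro: smooth_closure.base)

lemma smooth_on_mult: "open D \<Longrightarrow> smooth_on D f \<Longrightarrow> smooth_on D g \<Longrightarrow> smooth_on D (\<lambda>v. f v * g v)"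
  by (intro smooth_closure_smooth smooth_closure.intros(3)) (auto intro: smooth_closure.base)

lemma smooth_on_cmult: "open D \<Longrightarrow> smooth_on D f \<Longrightarrow> smooth_on D (\<lambda>v. k * f v)"
  by (intro smooth_on_mult smooth_on_const)

lemma smooth_on_sum:
  "open D \<Longrightarrow> (\<And>i. i \<in> A \<Longrightarrow> smooth_on D (f i)) \<Longrightarrow> smooth_on D (\<lambda>v. \<Sum>i\<in>A. f i v)"
  by (induction A rule: infinite_finite_induct) (auto intro: smooth_on_const smooth_on_add)

section \<open>Symmetry of second derivatives and the derivative along a line\<close>

lemma midpoint_contradiction:
  fixes x a b :: real
  shows "\<bar>x - a\<bar> < \<bar>a - b\<bar> / 2 \<Longrightarrow> \<bar>x - b\<bar> < \<bar>a - b\<bar> / 2 \<Longrightarrow> False"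
  by (auto simp: abs_if field_simps split: if_splits)

text \<open>The theorem of Schwarz. The second difference of \<open>f\<close> over a small square
  is, by the mean value theorem applied twice in either order, the area of the square times either
  mixed derivative at some point of it. Continuity of both derivatives at \<open>v\<close> excludes
  different values.\<close>

lemma pderivs_swap:
  assumes D: "open D" and f: "smooth_on D f" and v: "v \<in> D"
  shows "pderivs [c, d] f v = pderivs [d, c] f v"
proof (rule ccontr)
  assume neq: "pderivs [c, d] f v \<noteq> pderivs [d, c] f v"
  then have cd: "c \<noteq> d" by auto
  \<comment> \<open>Half the gap: the balls of radius \<open>e\<close> around the two supposed
    values are disjoint.\<close>
  define e where "e = \<bar>pderivs [c, d] f v - pderivs [d, c] f v\<bar> / 2"
  have e: "e > 0" using neq by (simp add: e_def)
  define W where "W = {u \<in> D. dist (pderivs [c, d] f u) (pderivs [c, d] f v) < e} \<inter>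
                      {u \<in> D. dist (pderivs [d, c] f u) (pderivs [d, c] f v) < e}"
  have op: "open {u \<in> D. dist (pderivs cs f u) k < e}" for cs k
  proof -
    have "open (D \<inter> pderivs cs f -` ball k e)"
      using continuous_on_open_vimage[OF D] smooth_onD(1)[OF smooth_onD(3)[OF f]]
      by (metis Int_commute open_ball)
    moreover have "D \<inter> pderivs cs f -` ball k e = {u \<in> D. dist (pderivs cs f u) k < e}"
      by (auto simp: dist_commute)
    ultimately show ?thesis by simp
  qed
  have W: "open W" "v \<in> W" "W \<subseteq> D"
    unfolding W_def by (rule open_Int[OF op op]) (use v e in auto)
  define P where "P = (\<lambda>s t. v(c := s, d := t))"
  have "open ((\<lambda>x. P (fst x) (snd x)) -` W)"
    unfolding P_def by (rule open_vimage[OF W(1) continuous_fun_upd2])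
  moreover have "(v c, v d) \<in> (\<lambda>x. P (fst x) (snd x)) -` W"
    using W cd by (simp add: P_def)
  ultimately obtain A B where AB: "open A" "open B" "v c \<in> A" "v d \<in> B"
      "A \<times> B \<subseteq> (\<lambda>x. P (fst x) (snd x)) -` W"
    by (elim open_prod_elim) auto
  obtain r1 r2 where r: "r1 > 0" "ball (v c) r1 \<subseteq> A" "r2 > 0" "ball (v d) r2 \<subseteq> B"
    using AB by (metis openE)
  \<comment> \<open>Half the smaller radius, so that the closed square of side \<open>h\<close> at
    \<open>v\<close> lies in the open neighbourhood \<open>W\<close>.\<close>
  define h where "h = min r1 r2 / 2"
  have h: "h > 0" using r by (simp add: h_def)
  have P: "P s t \<in> W" if "v c \<le> s" "s \<le> v c + h" "v d \<le> t" "t \<le> v d + h" for s t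
  proof -
    have "s \<in> ball (v c) r1" "t \<in> ball (v d) r2"
      using that r(1,3) by (auto simp: h_def dist_real_def min_def split: if_splits)
    then show ?thesis using AB(5) r by (auto simp: subset_iff)
  qed
  have Pc: "((\<lambda>s. g (P s t)) has_real_derivative pderivs [c] g (P s t)) (at s)"
    if "smooth_on D g" "P s t \<in> W" for g s t
  proof -
    have "P s' t = (P s t)(c := s')" for s' using cd by (auto simp: P_def fun_upd_twist)
    moreover have "(P s t)(c := s) \<in> D" using that W cd by (auto simp: P_def fun_upd_twist)
    ultimately show ?thesis using smooth_on_has_derivative[OF that(1), of "P s t" c s]
      using cd by (auto simp: P_def fun_upd_twist)
  qed
  have Pd: "((\<lambda>t. g (P s t)) has_real_derivative pderivs [d] g (P s t)) (at t)"
    if "smooth_on D g" "P s t \<in> W" for g s t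
    using smooth_on_has_derivative[OF that(1), of "v(c := s)" d t] that W by (auto simp: P_def)
  let ?a = "v c" and ?b = "v d"
  obtain y where y: "?b < y" "y < ?b + h"
    "(f (P (?a + h) (?b + h)) - f (P ?a (?b + h))) - (f (P (?a + h) ?b) - f (P ?a ?b))
       = (?b + h - ?b) * (pderivs [d] f (P (?a + h) y) - pderivs [d] f (P ?a y))"
    using MVT2[of ?b "?b + h" "\<lambda>t. f (P (?a + h) t) - f (P ?a t)"
        "\<lambda>t. pderivs [d] f (P (?a + h) t) - pderivs [d] f (P ?a t)"] h
      DERIV_diff[OF Pd[OF f P] Pd[OF f P]] by auto
  obtain x where x: "?a < x" "x < ?a + h"
    "pderivs [d] f (P (?a + h) y) - pderivs [d] f (P ?a y) = (?a + h - ?a) * pderivs [c, d] f (P x y)"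
    using MVT2[of ?a "?a + h" "\<lambda>s. pderivs [d] f (P s y)" "\<lambda>s. pderivs [c, d] f (P s y)"] h y(1,2)
      Pc[OF smooth_onD(3)[OF f, of "[d]"] P] by auto
  \<comment> \<open>The same second difference, grouped the other way round.\<close>
  obtain x' where x': "?a < x'" "x' < ?a + h"
    "(f (P (?a + h) (?b + h)) - f (P (?a + h) ?b)) - (f (P ?a (?b + h)) - f (P ?a ?b))
       = (?a + h - ?a) * (pderivs [c] f (P x' (?b + h)) - pderivs [c] f (P x' ?b))"
    using MVT2[of ?a "?a + h" "\<lambda>s. f (P s (?b + h)) - f (P s ?b)"
        "\<lambda>s. pderivs [c] f (P s (?b + h)) - pderivs [c] f (P s ?b)"] h
      DERIV_diff[OF Pc[OF f P] Pc[OF f P]] by auto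
  obtain y' where y': "?b < y'" "y' < ?b + h"
    "pderivs [c] f (P x' (?b + h)) - pderivs [c] f (P x' ?b) = (?b + h - ?b) * pderivs [d, c] f (P x' y')"
    using MVT2[of ?b "?b + h" "\<lambda>t. pderivs [c] f (P x' t)" "\<lambda>t. pderivs [d, c] f (P x' t)"] h x'(1,2)
      Pd[OF smooth_onD(3)[OF f, of "[c]"] P] by auto
  have "h * (h * pderivs [c, d] f (P x y)) = h * (h * pderivs [d, c] f (P x' y'))"
    using y(3)[unfolded x(3)] x'(3)[unfolded y'(3)]
    by (simp only: add_diff_cancel_left')
  then have eq: "pderivs [c, d] f (P x y) = pderivs [d, c] f (P x' y')"
    using h by (simp del: pderivs.simps)
  have "P x y \<in> W" "P x' y' \<in> W" using x y x' y' by (auto intro!: P)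
  then have "dist (pderivs [c, d] f (P x y)) (pderivs [c, d] f v) < e"
    "dist (pderivs [d, c] f (P x' y')) (pderivs [d, c] f v) < e" by (auto simp: W_def)
  then show False unfolding eq unfolding e_def dist_real_def by (rule midpoint_contradiction)
qed

text \<open>In \<open>pderivs\<close> the head of the list is the derivative taken last. Here it is
  moved innermost, which turns a derivative of order k + 1 of \<open>f\<close> into one of order k
  of its first derivative; the Taylor recursion below has this form.\<close>

lemma pderivs_Cons_last:
  assumes D: "open D" and f: "smooth_on D f" and v: "v \<in> D"
  shows "pderivs (c # cs) f v = pderivs cs (pderivs [c] f) v"
  using v
proof (induction cs arbitrary: v)
  case (Cons d cs)
  have "pderivs (c # d # cs) f v = pderivs [c, d] (pderivs cs f) v" by simp
  also have "\<dots> = pderivs [d, c] (pderivs cs f) v"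
    by (rule pderivs_swap[OF D smooth_onD(3)[OF f] Cons.prems])
  also have "\<dots> = pderivs [d] (pderivs (c # cs) f) v" by simp
  also have "\<dots> = pderivs [d] (pderivs cs (pderivs [c] f)) v"
    by (rule pderivs_cong[OF D Cons.IH Cons.prems])
  finally show ?case by simp
qed simp

text \<open>Moving coordinates are added one at a time. With separate parameters for the old ones
  and the new one, continuity of the partial derivative in the new parameter gives a total
  derivative, which is then restricted to the diagonal.\<close>

lemma smooth_on_line_derivative:
  assumes D: "open D" and f: "smooth_on D f" and u: "u \<in> D" and C: "finite C"
  shows "((\<lambda>t. f (\<lambda>c. if c \<in> C then u c + t * h c else u c))
           has_real_derivative (\<Sum>c\<in>C. h c * pderivs [c] f u)) (at 0)"
  using C
proof (induction C rule: finite_induct)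
  case (insert d C)
  \<comment> \<open>The parameter \<open>s\<close> moves the coordinates in \<open>C\<close>, the
    parameter \<open>t\<close> only \<open>d\<close>.\<close>
  define w where "w = (\<lambda>s t c. if c \<in> C then u c + s * h c else if c = d then u d + t * h d else u c)"
  have w: "w s t = (w s 0)(d := u d + t * h d)" for s t
    using insert.hyps by (auto simp: w_def)
  have "continuous_on UNIV (\<lambda>x. w (fst x) (snd x) c)" for c
    by (cases "c \<in> C"; cases "c = d") (auto simp: w_def intro!: continuous_intros)
  then have cont: "continuous_on UNIV (\<lambda>x. w (fst x) (snd x))"
    by (rule continuous_on_coordinatewise_then_product)
  have "open ((\<lambda>x. w (fst x) (snd x)) -` D)" by (rule open_vimage[OF D cont])
  moreover have w0: "w 0 0 = u" by (auto simp: w_def)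
  then have "(0, 0) \<in> (\<lambda>x. w (fst x) (snd x)) -` D" using u by simp
  ultimately obtain A B where AB: "open A" "open B" "0 \<in> A" "0 \<in> B"
      "A \<times> B \<subseteq> (\<lambda>x. w (fst x) (snd x)) -` D"
    by (elim open_prod_elim) auto
  \<comment> \<open>A ball, because \<open>has_derivative_partialsI\<close> needs a convex set for
    the second parameter.\<close>
  obtain r where r: "r > 0" "ball 0 r \<subseteq> B" using AB by (metis openE)
  let ?Y = "ball (0::real) r"
  have AY: "A \<times> ?Y \<subseteq> (\<lambda>x. w (fst x) (snd x)) -` D" using AB(5) r(2) by blast
  have "((\<lambda>(s, t). f (w s t)) has_derivative
      (\<lambda>(ts, tt). (\<lambda>x. x * (\<Sum>c\<in>C. h c * pderivs [c] f u)) ts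
         + (\<lambda>s t. blinfun_scaleR_left (h d * pderivs [d] f (w s t))) 0 0 tt)) (at (0, 0) within A \<times> ?Y)"
  proof (rule has_derivative_partialsI
      [where fy = "\<lambda>s t. blinfun_scaleR_left (h d * pderivs [d] f (w s t))"])
    have "(\<lambda>s. f (w s 0)) = (\<lambda>t. f (\<lambda>c. if c \<in> C then u c + t * h c else u c))"
      by (rule ext, rule arg_cong[of _ _ f]) (auto simp: w_def)
    with insert.IH have "((\<lambda>s. f (w s 0)) has_real_derivative (\<Sum>c\<in>C. h c * pderivs [c] f u)) (at 0 within A)"
      by (simp add: has_field_derivative_at_within)
    then show "((\<lambda>s. f (w s 0)) has_derivative (\<lambda>x. x * (\<Sum>c\<in>C. h c * pderivs [c] f u))) (at 0 within A)"
      unfolding has_field_derivative_def by (simp add: mult_commute_abs)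
  next
    fix s t assume st: "s \<in> A" "t \<in> ?Y"
    then have "(s, t) \<in> (\<lambda>x. w (fst x) (snd x)) -` D" using AY by blast
    then have wD: "w s t \<in> D" by simp
    have "((\<lambda>t. f ((w s 0)(d := u d + t * h d))) has_real_derivative
        pderivs [d] f ((w s 0)(d := u d + t * h d)) * h d) (at t)"
    proof (rule DERIV_chain2[where g = "\<lambda>t. u d + t * h d"])
      show "((\<lambda>x. f ((w s 0)(d := x))) has_real_derivative pderivs [d] f ((w s 0)(d := u d + t * h d)))
          (at (u d + t * h d))"
        using wD w by (intro smooth_on_has_derivative[OF f]) metis
    qed (auto intro!: derivative_eq_intros)
    moreover have "(\<lambda>t. f (w s t)) = (\<lambda>t. f ((w s 0)(d := u d + t * h d)))"
      by (rule ext) (rule arg_cong[OF w])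
    moreover have "pderivs [d] f (w s t) = pderivs [d] f ((w s 0)(d := u d + t * h d))"
      by (rule arg_cong[OF w])
    ultimately have "((\<lambda>t. f (w s t)) has_real_derivative h d * pderivs [d] f (w s t)) (at t within ?Y)"
      by (simp only: mult.commute[of "h d"] has_field_derivative_at_within)
    then show "((\<lambda>t. f (w s t)) has_derivative
        blinfun_apply (blinfun_scaleR_left (h d * pderivs [d] f (w s t)))) (at t within ?Y)"
      unfolding has_field_derivative_def by (simp add: mult_commute_abs)
  next
    have "continuous_on (A \<times> ?Y) (\<lambda>x. pderivs [d] f (w (fst x) (snd x)))"
      using AY by (intro continuous_on_compose2[OF smooth_onD(1)[OF smooth_onD(3)[OF f]]]
          continuous_on_subset[OF cont]) auto
    then have "continuous_on (A \<times> ?Y) (\<lambda>x. blinfun_scaleR_left (h d * pderivs [d] f (w (fst x) (snd x))))"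
      by (intro bounded_linear.continuous_on[OF bounded_linear_blinfun_scaleR_left] continuous_intros)
    then show "continuous (at (0, 0) within A \<times> ?Y)
        (\<lambda>(s, t). blinfun_scaleR_left (h d * pderivs [d] f (w s t)))"
      using AB r(1) unfolding continuous_on_eq_continuous_within by (auto simp: case_prod_unfold)
  qed (use r in auto)
  then have "((\<lambda>(s, t). f (w s t)) has_derivative
      (\<lambda>(ts, tt). ts * (\<Sum>c\<in>C. h c * pderivs [c] f u) + tt * (h d * pderivs [d] f u))) (at (0, 0))"
    using at_within_open[of "(0::real, 0::real)" "A \<times> ?Y"] AB r(1) by (simp add: w0 open_Times)
  moreover have "((\<lambda>t::real. (t, t)) has_derivative (\<lambda>t. (t, t))) (at 0)"
    by (intro has_derivative_Pair has_derivative_ident)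
  ultimately have "((\<lambda>t. (\<lambda>(s, t). f (w s t)) (t, t)) has_derivative
      (\<lambda>x. (\<lambda>(ts, tt). ts * (\<Sum>c\<in>C. h c * pderivs [c] f u) + tt * (h d * pderivs [d] f u)) (x, x))) (at 0)"
    using has_derivative_compose[of "\<lambda>t. (t, t)" "\<lambda>t. (t, t)" 0 UNIV] by blast
  then have "((\<lambda>t. f (w t t)) has_real_derivative (\<Sum>c\<in>C. h c * pderivs [c] f u) + h d * pderivs [d] f u) (at 0)"
    unfolding has_field_derivative_def by (simp add: distrib_left[symmetric] mult_commute_abs)
  moreover have "w t t = (\<lambda>c. if c \<in> insert d C then u c + t * h c else u c)" for t
    by (auto simp: w_def)
  ultimately show ?case using insert.hyps by (simp add: add.commute)
qed auto

section \<open>Calculus of superfunctions\<close>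

text \<open>The smoothness clause of \<open>superfun\<close> on its own. It is insensitive to which
  variables occur, so it also covers expressions in the entries of a new row or column.\<close>

definition smooth_sfun :: "(coord \<Rightarrow> real) set \<Rightarrow> sfun \<Rightarrow> bool" where
  "smooth_sfun D F \<longleftrightarrow> (\<forall>I. smooth_on D (\<lambda>v. coeff (F v) I))"

lemma smooth_on_if: "(P \<Longrightarrow> smooth_on D f) \<Longrightarrow> (\<not> P \<Longrightarrow> smooth_on D g) \<Longrightarrow>
    smooth_on D (\<lambda>v. if P then f v else g v)"
  by (cases P) simp_all

lemma coeff_pd: "coeff (pd c F v) I =
    (if even (cpar c) then pderivs [c] (\<lambda>v. coeff (F v) I) v
     else if c \<in> I then 0 else gsign {c} I * coeff (F v) (insert c I))"
  by (auto simp: pd_def coeff_gr_of coeff_gderiv coeff_infinite)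

lemma smooth_sfun_cong:
  "open D \<Longrightarrow> smooth_sfun D F \<Longrightarrow> (\<And>v. v \<in> D \<Longrightarrow> G v = F v) \<Longrightarrow> smooth_sfun D G"
  unfolding smooth_sfun_def by (auto intro: smooth_on_cong)

lemma smooth_sfun_subset: "smooth_sfun D F \<Longrightarrow> E \<subseteq> D \<Longrightarrow> smooth_sfun E F"
  unfolding smooth_sfun_def by (auto intro: smooth_on_subset)

lemma smooth_sfun_add: "open D \<Longrightarrow> smooth_sfun D F \<Longrightarrow> smooth_sfun D G \<Longrightarrow> smooth_sfun D (\<lambda>v. F v + G v)"
  by (simp add: smooth_sfun_def smooth_on_add)

lemma smooth_sfun_scaleR: "open D \<Longrightarrow> smooth_sfun D F \<Longrightarrow> smooth_sfun D (\<lambda>v. k *\<^sub>R F v)"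
  by (simp add: smooth_sfun_def smooth_on_cmult)

lemma smooth_sfun_diff: "open D \<Longrightarrow> smooth_sfun D F \<Longrightarrow> smooth_sfun D G \<Longrightarrow> smooth_sfun D (\<lambda>v. F v - G v)"
  using smooth_sfun_add[of D F "\<lambda>v. (-1) *\<^sub>R G v"] smooth_sfun_scaleR[of D G "-1"] by simp

lemma smooth_sfun_sum:
  "open D \<Longrightarrow> (\<And>i. i \<in> A \<Longrightarrow> smooth_sfun D (F i)) \<Longrightarrow> smooth_sfun D (\<lambda>v. \<Sum>i\<in>A. F i v)"
  by (simp add: smooth_sfun_def coeff_sum smooth_on_sum)

lemma smooth_sfun_mult:
  "open D \<Longrightarrow> smooth_sfun D F \<Longrightarrow> smooth_sfun D G \<Longrightarrow> smooth_sfun D (\<lambda>v. F v * G v)"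
  by (auto simp: smooth_sfun_def coeff_times_eq
      intro!: smooth_on_sum smooth_on_mult smooth_on_if smooth_on_const)

lemma smooth_sfun_var: "open D \<Longrightarrow> smooth_sfun D (var c)"
  by (cases "even (cpar c)")
     (auto simp: smooth_sfun_def var_def coeff_of_real coeff_gen
        intro!: smooth_on_if smooth_on_const smooth_on_coord)

lemma smooth_sfun_pd: "open D \<Longrightarrow> smooth_sfun D F \<Longrightarrow> smooth_sfun D (pd c F)"
  unfolding smooth_sfun_def coeff_pd
  by (intro allI smooth_on_if smooth_on_const smooth_on_cmult) (blast intro: smooth_onD(3))+

lemma smooth_sfun_hpart: "open D \<Longrightarrow> smooth_sfun D F \<Longrightarrow> smooth_sfun D (\<lambda>v. hpart e (F v))"
  unfolding smooth_sfun_def coeff_hpart by (intro allI smooth_on_if smooth_on_const) blast+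

lemma pd_cong:
  assumes D: "open D" and eq: "\<And>v. v \<in> D \<Longrightarrow> F v = G v" and v: "v \<in> D"
  shows "pd c F v = pd c G v"
proof (rule gr_eqI)
  fix I
  have "pderivs [c] (\<lambda>v. coeff (F v) I) v = pderivs [c] (\<lambda>v. coeff (G v) I) v"
    by (rule pderivs_cong[OF D _ v]) (simp add: eq)
  then show "coeff (pd c F v) I = coeff (pd c G v) I"
    unfolding coeff_pd using eq[OF v] by simp
qed

lemma coeff_has_derivative:
  assumes "smooth_sfun D F" "v \<in> D" "even (cpar c)"
  shows "((\<lambda>t. coeff (F (v(c := t))) I) has_real_derivative coeff (pd c F v) I) (at (v c))"
  using smooth_on_has_derivative'[of D "\<lambda>v. coeff (F v) I" v c] assms
  by (simp add: smooth_sfun_def coeff_pd)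

lemma pd_eqI:
  assumes "even (cpar c)"
    and "\<And>I. finite I \<Longrightarrow> ((\<lambda>t. coeff (F (v(c := t))) I) has_real_derivative coeff a I) (at (v c))"
  shows "pd c F v = a"
proof (rule gr_eqI)
  fix I :: "coord set" assume "finite I"
  from assms(2)[OF this] show "coeff (pd c F v) I = coeff a I"
    using assms(1) by (simp add: coeff_pd DERIV_imp_deriv)
qed

lemma pd_add:
  assumes "smooth_sfun D F" "smooth_sfun D G" "v \<in> D"
  shows "pd c (\<lambda>v. F v + G v) v = pd c F v + pd c G v"
proof (cases "even (cpar c)")
  case True
  then show ?thesis
    using DERIV_add[OF coeff_has_derivative[OF assms(1,3) True] coeff_has_derivative[OF assms(2,3) True]]
    by (intro pd_eqI) auto
qed (simp add: pd_def gderiv_add)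

lemma pd_scaleR:
  assumes "smooth_sfun D F" "v \<in> D"
  shows "pd c (\<lambda>v. k *\<^sub>R F v) v = k *\<^sub>R pd c F v"
proof (cases "even (cpar c)")
  case True
  then show ?thesis
    using DERIV_cmult[OF coeff_has_derivative[OF assms True]] by (intro pd_eqI) auto
qed (simp add: pd_def gderiv_scaleR)

lemma pd_diff:
  assumes "open D" "smooth_sfun D F" "smooth_sfun D G" "v \<in> D"
  shows "pd c (\<lambda>v. F v - G v) v = pd c F v - pd c G v"
  using pd_add[OF assms(2) smooth_sfun_scaleR[OF assms(1,3)] assms(4), of c "-1"]
    pd_scaleR[OF assms(3,4), of c "-1"] by simp

lemma pd_zero: "pd c (\<lambda>v. 0) v = 0"
proof (cases "even (cpar c)")
  case True
  then show ?thesis by (rule pd_eqI) simp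
qed (use gderiv_of_real[of c 0] in \<open>simp add: pd_def\<close>)

lemma pd_sum:
  assumes "open D" "\<And>i. i \<in> A \<Longrightarrow> smooth_sfun D (F i)" "v \<in> D"
  shows "pd c (\<lambda>v. \<Sum>i\<in>A. F i v) v = (\<Sum>i\<in>A. pd c (F i) v)"
  using assms(2)
proof (induction A rule: infinite_finite_induct)
  case (insert i A)
  then show ?case
    using pd_add[of D "F i" "\<lambda>v. \<Sum>i\<in>A. F i v" v c] assms(1,3) smooth_sfun_sum[of D A F] by simp
qed (auto simp: pd_zero)

text \<open>Only the left factor needs a parity, and only at the point \<open>v\<close>, since the
  derivative acts from the left and has to pass that factor alone.\<close>

lemma pd_mult:
  assumes "smooth_sfun D F" "smooth_sfun D G" "v \<in> D" "homog a (F v)"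
  shows "pd c (\<lambda>v. F v * G v) v = pd c F v * G v + sg (cpar c * a) *\<^sub>R (F v * pd c G v)"
proof (cases "even (cpar c)")
  case True
  have "pd c (\<lambda>v. F v * G v) v = pd c F v * G v + F v * pd c G v"
  proof (rule pd_eqI[OF True])
    fix I :: "coord set" assume I: "finite I"
    show "((\<lambda>t. coeff (F (v(c := t)) * G (v(c := t))) I) has_real_derivative
         coeff (pd c F v * G v + F v * pd c G v) I) (at (v c))"
      unfolding coeff_simps coeff_times[OF I] sum.distrib[symmetric]
      by (rule DERIV_sum)
         (auto intro!: derivative_eq_intros coeff_has_derivative[OF assms(1,3) True]
            coeff_has_derivative[OF assms(2,3) True])
  qed
  with True show ?thesis by simp
next
  case False
  then have "(-1::real) ^ (cpar c * a) = (-1) ^ a" by (intro minus_one_power_cong) auto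
  with False show ?thesis using gderiv_mult[OF assms(4)] by (simp add: pd_def)
qed

lemma pd_var: "pd c (var d) v = (if c = d then 1 else 0)"
proof (cases "even (cpar c)")
  case True
  show ?thesis
  proof (rule pd_eqI[OF True])
    fix I :: "coord set"
    show "((\<lambda>t. coeff (var d (v(c := t))) I) has_real_derivative coeff (if c = d then 1 else 0) I) (at (v c))"
    proof (cases "c = d \<and> I = {}")
      case False
      then have "(\<lambda>t. coeff (var d (v(c := t))) I) = (\<lambda>t. coeff (var d v) I)"
        using True by (auto simp: var_def coeff_of_real)
      then show ?thesis using False by (auto simp: coeff_one)
    qed (use True in \<open>auto simp: var_def coeff_of_real coeff_one\<close>)
  qed
next
  case False
  then show ?thesis by (auto simp: pd_def var_def gderiv_gen gderiv_of_real)
qed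

lemma homog_var: "homog (cpar c) (var c v)"
proof (cases "even (cpar c)")
  case True
  then show ?thesis
    using homog_cong[of "cpar c" 0 "var c v"] by (simp add: var_def)
qed (simp add: var_def homog_gen)

lemma homog_pd:
  assumes D: "open D" and "\<And>v. v \<in> D \<Longrightarrow> homog a (F v)" and v: "v \<in> D"
  shows "homog (cpar c + a) (pd c F v)"
proof (cases "even (cpar c)")
  case True
  show ?thesis unfolding homog_iff
  proof (intro allI impI)
    fix I :: "coord set" assume "odd (card I + (cpar c + a))"
    then have "coeff (F u) I = 0" if "u \<in> D" for u
      using True assms(2)[OF that] by (simp add: homog_iff)
    then have "pderivs [c] (\<lambda>v. coeff (F v) I) v = pderivs [c] (\<lambda>v. 0) v"
      by (intro pderivs_cong[OF D _ v])
    then show "coeff (pd c F v) I = 0" using True by (simp add: coeff_pd)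
  qed
next
  case False
  then have "homog (cpar c + a) (pd c F v) \<longleftrightarrow> homog (a + 1) (pd c F v)"
    by (intro homog_cong) auto
  then show ?thesis using homog_gderiv[OF assms(2)[OF v], of c] False by (simp add: pd_def)
qed

text \<open>Three mechanisms: symmetry of second derivatives for two even variables, anticommuting
  generator derivatives for two odd ones, and for a mixed pair the fact that the odd derivative
  merely selects a coefficient up to a constant sign.\<close>

lemma pd_commute:
  assumes D: "open D" and F: "smooth_sfun D F" and v: "v \<in> D"
  shows "pd c (pd d F) v = sg (cpar c * cpar d) *\<^sub>R pd d (pd c F) v"
proof (cases "odd (cpar c) \<and> odd (cpar d)")
  case True
  then show ?thesis using gderiv_anticommute[of c d "F v"] by (simp add: pd_def)
next
  case False
  have mixed: "pd c (pd d F) v = pd d (pd c F) v" if "even (cpar c)" "odd (cpar d)" for c d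
  proof (rule gr_eqI)
    fix I :: "coord set" assume I: "finite I"
    show "coeff (pd c (pd d F) v) I = coeff (pd d (pd c F) v) I"
    proof (cases "d \<in> I")
      case True
      then show ?thesis using that by (simp add: coeff_pd)
    next
      case False
      have "((\<lambda>t. gsign {d} I * coeff (F (v(c := t))) (insert d I)) has_real_derivative
          gsign {d} I * coeff (pd c F v) (insert d I)) (at (v c))"
        by (rule DERIV_cmult[OF coeff_has_derivative[OF F v that(1)]])
      then show ?thesis using that False by (simp add: coeff_pd DERIV_imp_deriv)
    qed
  qed
  have "pd c (pd d F) v = pd d (pd c F) v"
  proof (cases "even (cpar c) \<and> even (cpar d)")
    case True
    show ?thesis
    proof (rule gr_eqI)
      fix I
      show "coeff (pd c (pd d F) v) I = coeff (pd d (pd c F) v) I"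
        using pderivs_swap[OF D _ v, of "\<lambda>v. coeff (F v) I" c d] F True
        by (simp add: coeff_pd smooth_sfun_def)
    qed
  next
    case nb: False
    then show ?thesis using mixed[of c d] mixed[of d c] False by auto
  qed
  moreover have "(-1::real) ^ (cpar c * cpar d) = 1" using False by auto
  ultimately show ?thesis by simp
qed

section \<open>Superfunctions of a given set of variables and their derivatives\<close>

lemma superfun_smooth: "superfun C D F \<Longrightarrow> smooth_sfun D F"
  by (simp add: superfun_def smooth_sfun_def)

lemma superfun_eq:
  "superfun C D F \<Longrightarrow> v \<in> D \<Longrightarrow> (\<And>c. c \<in> C \<Longrightarrow> even (cpar c) \<Longrightarrow> v c = v' c) \<Longrightarrow> F v = F v'"
  unfolding superfun_def by blast

lemma superfun_pd_eq_0:
  assumes D: "open D" and F: "superfun C D F" and c: "c \<notin> C" and v: "v \<in> D"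
  shows "pd c F v = 0"
proof (cases "even (cpar c)")
  case True
  show ?thesis
  proof (rule pd_eqI[OF True])
    fix I :: "coord set"
    have "F v = F (v(c := t))" for t
      using c by (intro superfun_eq[OF F v]) auto
    then show "((\<lambda>t. coeff (F (v(c := t))) I) has_real_derivative coeff 0 I) (at (v c))"
      by (simp flip: \<open>\<And>t. F v = F (v(c := t))\<close>)
  qed
next
  case False
  then show ?thesis
    using F v c gderiv_gens_in[of "{c \<in> C. odd (cpar c)}" "F v" c] by (simp add: pd_def superfun_def)
qed

lemma superfun_pd:
  assumes D: "open D" and F: "superfun C D F"
  shows "superfun C D (pd c F)"
proof (cases "c \<in> C \<and> even (cpar c)")
  case True
  have "pd c F v = pd c F v'" if v: "v \<in> D" and eq: "\<forall>c\<in>C. even (cpar c) \<longrightarrow> v c = v' c" for v v'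
  proof (rule gr_eqI)
    fix I
    have "\<forall>\<^sub>F t in nhds (v c). coeff (F (v(c := t))) I = coeff (F (v'(c := t))) I"
      using eventually_fun_upd[OF D v, of c]
    proof eventually_elim
      case (elim t)
      have "F (v(c := t)) = F (v'(c := t))" using eq by (intro superfun_eq[OF F elim]) auto
      then show ?case by simp
    qed
    then show "coeff (pd c F v) I = coeff (pd c F v') I"
      using True eq by (simp add: coeff_pd deriv_cong_ev)
  qed
  moreover have "gens_in {c \<in> C. odd (cpar c)} (pd c F v)" if v: "v \<in> D" for v
    unfolding gens_in_iff
  proof (intro allI impI)
    fix I assume I: "\<not> I \<subseteq> {c \<in> C. odd (cpar c)}"
    have "pderivs [c] (\<lambda>v. coeff (F v) I) v = pderivs [c] (\<lambda>v. 0) v"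
    proof (rule pderivs_cong[OF D _ v])
      fix u assume "u \<in> D"
      then show "coeff (F u) I = 0" using F I by (auto simp: superfun_def gens_in_iff)
    qed
    then show "coeff (pd c F v) I = 0" using True by (simp add: coeff_pd)
  qed
  ultimately show ?thesis
    using smooth_sfun_pd[OF D superfun_smooth[OF F], of c]
    unfolding superfun_def smooth_sfun_def by blast
next
  case False
  have "pd c F v = pd c F v' \<and> gens_in {c \<in> C. odd (cpar c)} (pd c F v)"
    if v: "v \<in> D" and eq: "\<forall>c\<in>C. even (cpar c) \<longrightarrow> v c = v' c" for v v'
  proof (cases "even (cpar c)")
    case True
    then have c: "c \<notin> C" using False by auto
    \<comment> \<open>The point \<open>v'\<close> is not assumed to lie in \<open>D\<close>, so
      \<open>superfun_pd_eq_0\<close> does not apply to it; but \<open>F\<close> is constant along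
      the whole coordinate line through \<open>v'\<close>, with value \<open>F v\<close>.\<close>
    have "pd c F v' = 0"
    proof (rule pd_eqI[OF True])
      fix I :: "coord set"
      have "F v = F (v'(c := t))" for t
        using c eq by (intro superfun_eq[OF F v]) auto
      then show "((\<lambda>t. coeff (F (v'(c := t))) I) has_real_derivative coeff 0 I) (at (v' c))"
        by (simp flip: \<open>\<And>t. F v = F (v'(c := t))\<close>)
    qed
    then show ?thesis using superfun_pd_eq_0[OF D F c v] by simp
  next
    case False
    have "F v = F v'" using eq by (intro superfun_eq[OF F v]) auto
    moreover have "gens_in {c \<in> C. odd (cpar c)} (F v)" using F v by (simp add: superfun_def)
    ultimately show ?thesis using False by (simp add: pd_def gens_in_gderiv)
  qed
  then show ?thesis
    using smooth_sfun_pd[OF D superfun_smooth[OF F], of c]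
    unfolding superfun_def smooth_sfun_def by blast
qed

section \<open>Substitution along an affine line\<close>

definition has_gr_deriv :: "(real \<Rightarrow> 'g gr) \<Rightarrow> 'g gr \<Rightarrow> real \<Rightarrow> bool" where
  "has_gr_deriv \<phi> a \<tau> \<longleftrightarrow> (\<forall>J. ((\<lambda>t. coeff (\<phi> t) J) has_real_derivative coeff a J) (at \<tau>))"

lemma has_gr_deriv_const: "has_gr_deriv (\<lambda>t. a) 0 \<tau>"
  by (simp add: has_gr_deriv_def)

lemma has_gr_deriv_add:
  "has_gr_deriv \<phi> a \<tau> \<Longrightarrow> has_gr_deriv \<psi> b \<tau> \<Longrightarrow> has_gr_deriv (\<lambda>t. \<phi> t + \<psi> t) (a + b) \<tau>"
  by (simp add: has_gr_deriv_def DERIV_add)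

lemma has_gr_deriv_sum:
  "(\<And>i. i \<in> A \<Longrightarrow> has_gr_deriv (\<phi> i) (a i) \<tau>) \<Longrightarrow>
     has_gr_deriv (\<lambda>t. \<Sum>i\<in>A. \<phi> i t) (\<Sum>i\<in>A. a i) \<tau>"
  by (induction A rule: infinite_finite_induct)
     (auto intro: has_gr_deriv_const has_gr_deriv_add)

lemma has_gr_deriv_scaleR:
  assumes "(f has_real_derivative f') (at \<tau>)" "has_gr_deriv \<phi> a \<tau>"
  shows "has_gr_deriv (\<lambda>t. f t *\<^sub>R \<phi> t) (f' *\<^sub>R \<phi> \<tau> + f \<tau> *\<^sub>R a) \<tau>"
  using assms unfolding has_gr_deriv_def coeff_simps
  by (auto intro!: derivative_eq_intros)

lemma has_gr_deriv_scaleR_const: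
  "(f has_real_derivative f') (at \<tau>) \<Longrightarrow> has_gr_deriv (\<lambda>t. f t *\<^sub>R a) (f' *\<^sub>R a) \<tau>"
  using has_gr_deriv_scaleR[OF _ has_gr_deriv_const[of a \<tau>]] by simp

lemma has_gr_deriv_mult:
  assumes "has_gr_deriv \<phi> a \<tau>" "has_gr_deriv \<psi> b \<tau>"
  shows "has_gr_deriv (\<lambda>t. \<phi> t * \<psi> t) (a * \<psi> \<tau> + \<phi> \<tau> * b) \<tau>"
  unfolding has_gr_deriv_def
proof
  fix I
  show "((\<lambda>t. coeff (\<phi> t * \<psi> t) I) has_real_derivative coeff (a * \<psi> \<tau> + \<phi> \<tau> * b) I) (at \<tau>)"
  proof (cases "finite I")
    case True
    have d: "((\<lambda>t. coeff (\<phi> t) J) has_real_derivative coeff a J) (at \<tau>)"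
      "((\<lambda>t. coeff (\<psi> t) J) has_real_derivative coeff b J) (at \<tau>)" for J
      using assms by (auto simp: has_gr_deriv_def)
    show ?thesis
      unfolding coeff_simps coeff_times[OF True] sum.distrib[symmetric]
      by (rule DERIV_sum) (auto intro!: derivative_eq_intros d)
  qed (simp add: coeff_infinite)
qed

lemma has_gr_deriv_cong:
  "has_gr_deriv \<phi> a \<tau> \<Longrightarrow> (\<And>t. \<psi> t = \<phi> t) \<Longrightarrow> b = a \<Longrightarrow> has_gr_deriv \<psi> b \<tau>"
  by (simp add: has_gr_deriv_def)

text \<open>Coefficientwise, \<open>\<psi>\<close> is constant and hence
  \<open>\<phi> t + t *\<^sub>R \<psi> 0\<close> is constant.\<close>

lemma gr_affine:
  assumes \<phi>: "\<And>t. has_gr_deriv \<phi> (- \<psi> t) t" and \<psi>: "\<And>t. has_gr_deriv \<psi> 0 t"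
  shows "\<phi> 1 = \<phi> 0 - \<psi> 0"
proof (rule gr_eqI)
  fix J
  have c: "coeff (\<psi> t) J = coeff (\<psi> 0) J" for t
    by (rule DERIV_isconst_all) (use \<psi> in \<open>auto simp: has_gr_deriv_def\<close>)
  have d: "((\<lambda>t. coeff (\<phi> t) J) has_real_derivative - coeff (\<psi> 0) J) (at t)" for t
  proof -
    have "((\<lambda>t. coeff (\<phi> t) J) has_real_derivative coeff (- \<psi> t) J) (at t)"
      using \<phi>[of t] unfolding has_gr_deriv_def by blast
    then show ?thesis by (simp only: coeff_simps c[of t])
  qed
  have "((\<lambda>t. coeff (\<phi> t) J + t * coeff (\<psi> 0) J) has_real_derivative 0) (at t)" for t
    using d[of t] by (auto intro!: derivative_eq_intros)
  from DERIV_isconst_all[rule_format, of "\<lambda>t. coeff (\<phi> t) J + t * coeff (\<psi> 0) J" 1 0] this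
  have "coeff (\<phi> 1) J + 1 * coeff (\<psi> 0) J = coeff (\<phi> 0) J + 0 * coeff (\<psi> 0) J" by blast
  then show "coeff (\<phi> 1) J = coeff (\<phi> 0 - \<psi> 0) J" by simp
qed

section \<open>Ordered monomials in the generators\<close>

lemma sorted_list_of_set_insert_min:
  assumes "finite A" "\<forall>a\<in>A. b < (a::'a::linorder)"
  shows "sorted_list_of_set (insert b A) = b # sorted_list_of_set A"
proof -
  have "b \<notin> A" using assms(2) by auto
  then have "sorted_list_of_set (insert b A) = insort b (sorted_list_of_set A)"
    using assms(1) by simp
  also have "\<dots> = b # sorted_list_of_set A"
    using assms by (intro insort_is_Cons) (auto intro: less_imp_le)
  finally show ?thesis .
qed

lemma gsign_min:
  assumes "\<forall>a\<in>A. b < a" shows "gsign {b} A = 1"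
proof -
  have e: "{(i, j). i \<in> {b} \<and> j \<in> A \<and> j < i} = {}" using assms by force
  show ?thesis unfolding gsign_def inversions_def e by simp
qed

text \<open>Multiplying by a generator smaller than all others creates no inversion, so the
  increasing product is the basis monomial with sign 1.\<close>

lemma prod_gen_coeff:
  fixes I :: "'g::linorder set"
  assumes "finite I" "finite J"
  shows "coeff (prod_list (map gen (sorted_list_of_set I))) J = (if J = I then 1 else 0)"
  using assms
proof (induction I arbitrary: J rule: finite_linorder_min_induct)
  case empty
  then show ?case by (simp add: coeff_one)
next
  case (insert b A)
  have b: "b \<notin> A" using insert by auto
  have "coeff (prod_list (map gen (sorted_list_of_set (insert b A)))) J
      = (\<Sum>K\<in>Pow J. if K = {b} \<and> J - K = A then gsign K (J - K) else 0)"
    unfolding sorted_list_of_set_insert_min[OF insert(1,2)] list.map prod_list.Cons coeff_times[OF insert.prems]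
  proof (rule sum.cong)
    fix K assume "K \<in> Pow J"
    then have "finite (J - K)" using insert.prems by auto
    from insert.IH[OF this]
    show "gsign K (J - K) * coeff (gen b) K * coeff (prod_list (map gen (sorted_list_of_set A))) (J - K)
        = (if K = {b} \<and> J - K = A then gsign K (J - K) else 0)"
      by (simp add: coeff_gen)
  qed simp
  also have "\<dots> = (if J = insert b A then 1 else 0)"
  proof (cases "J = insert b A")
    case True
    then have "(\<Sum>K\<in>Pow J. if K = {b} \<and> J - K = A then gsign K (J - K) else 0)
        = (\<Sum>K\<in>Pow J. if K = {b} then gsign {b} A else 0)"
      using b by (intro sum.cong) auto
    also have "\<dots> = gsign {b} A" using True insert.hyps by simp
    also have "\<dots> = 1" using insert.hyps(2) by (rule gsign_min)
    finally show ?thesis using True by simp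
  next
    case False
    have "(if K = {b} \<and> J - K = A then gsign K (J - K) else 0) = 0" if "K \<in> Pow J" for K
      using that False by auto
    then show ?thesis using False by (simp add: sum.neutral)
  qed
  finally show ?case .
qed

section \<open>Functions of a subset of the variables and Taylor sums along a line\<close>

definition depends_on :: "coord set \<Rightarrow> (coord \<Rightarrow> real) set \<Rightarrow> ((coord \<Rightarrow> real) \<Rightarrow> real) \<Rightarrow> bool" where
  "depends_on E D f \<longleftrightarrow> (\<forall>v\<in>D. \<forall>v'. (\<forall>c\<in>E. v c = v' c) \<longrightarrow> f v = f v')"

lemma depends_on_pderiv_eq_0:
  assumes "depends_on E D f" "v \<in> D" "c \<notin> E"
  shows "pderivs [c] f v = 0"
proof -
  have "f (v(c := t)) = f v" for t
    using assms unfolding depends_on_def by (metis fun_upd_other)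
  then show ?thesis by simp
qed

lemma depends_on_pderiv:
  assumes D: "open D" and f: "depends_on E D f"
  shows "depends_on E D (pderivs [c] f)"
  unfolding depends_on_def
proof (intro ballI allI impI)
  fix v v' assume v: "v \<in> D" and eq: "\<forall>c\<in>E. v c = v' c"
  show "pderivs [c] f v = pderivs [c] f v'"
  proof (cases "c \<in> E")
    case True
    have "\<forall>\<^sub>F t in nhds (v c). f (v(c := t)) = f (v'(c := t))"
      using eventually_fun_upd[OF D v, of c]
    proof eventually_elim
      case (elim t)
      have "\<forall>d\<in>E. (v(c := t)) d = (v'(c := t)) d" using eq by auto
      then show ?case using elim f unfolding depends_on_def by blast
    qed
    then show ?thesis using True eq by (simp add: deriv_cong_ev)
  next
    case False
    have "\<forall>d\<in>E. v d = (v'(c := t)) d" for t using eq False by auto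
    then have "f (v'(c := t)) = f v" for t using f v unfolding depends_on_def by metis
    then have "pderivs [c] f v' = 0" by simp
    then show ?thesis using depends_on_pderiv_eq_0[OF f v False] by simp
  qed
qed

lemma depends_on_pderivs: "open D \<Longrightarrow> depends_on E D f \<Longrightarrow> depends_on E D (pderivs cs f)"
proof (induction cs)
  case (Cons c cs)
  then show ?case using depends_on_pderiv[of D E "pderivs cs f" c] by simp
qed simp

lemma pderivs_eq_0:
  assumes D: "open D" and f: "depends_on E D f" and "v \<in> D" "\<not> set cs \<subseteq> E"
  shows "pderivs cs f v = 0"
  using assms(3,4)
proof (induction cs arbitrary: v)
  case (Cons c cs)
  show ?case
  proof (cases "set cs \<subseteq> E")
    case True
    then show ?thesis
      using Cons.prems depends_on_pderiv_eq_0[OF depends_on_pderivs[OF D f] Cons.prems(1), of c cs] by simp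
  next
    case False
    have "pderivs [c] (pderivs cs f) v = pderivs [c] (\<lambda>v. 0) v"
      by (rule pderivs_cong[OF D _ Cons.prems(1)]) (rule Cons.IH[OF _ False])
    then show ?thesis by simp
  qed
qed simp

text \<open>A line of Grassmann-valued points with direction \<open>- n\<close>, the sign being that
  of the subtraction in the definition of \<sigma>. The finite set \<open>N\<close> bounds the order
  of nilpotency, and the bodies stay in \<open>D\<close> for every real parameter, so that
  differential equations in the parameter hold on the whole real line.\<close>

locale superline =
  fixes C :: "coord set" and D :: "(coord \<Rightarrow> real) set" and v :: "coord \<Rightarrow> real"
    and n :: "coord \<Rightarrow> coord gr" and N :: "coord set"
  assumes D: "open D" and C: "finite C" and N: "finite N"
    and homog_n: "\<And>c. c \<in> C \<Longrightarrow> homog (cpar c) (n c)"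
    and gens_n: "\<And>c. c \<in> C \<Longrightarrow> gens_in N (n c)"
    and line_in: "\<And>\<tau>. (\<lambda>c. body (var c v - \<tau> *\<^sub>R n c)) \<in> D"
begin

definition evens where "evens = {c \<in> C. even (cpar c)}"
definition odds where "odds = {c \<in> C. odd (cpar c)}"
definition z where "z \<tau> c = var c v - \<tau> *\<^sub>R n c"
definition b where "b \<tau> = body \<circ> z \<tau>"
definition even_lists where "even_lists k = {cs. set cs \<subseteq> evens \<and> length cs = k}"

text \<open>The even variables in \<open>sfeval F (z \<tau>)\<close> contribute \<open>taylor\<close>: \<open>var c v\<close> has no soul for even \<open>c\<close>, so a
  list of length \<open>k\<close> yields \<open>(-\<tau>)\<^sup>k\<close> times a product of souls of \<open>n\<close>, which vanishes for \<open>k > card N\<close>.\<close>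
definition jet :: "nat \<Rightarrow> real \<Rightarrow> ((coord \<Rightarrow> real) \<Rightarrow> real) \<Rightarrow> coord gr" where
  "jet k \<tau> f = (\<Sum>cs\<in>even_lists k. pderivs cs f (b \<tau>) *\<^sub>R prod_list (map (soul \<circ> n) cs))"

definition taylor :: "real \<Rightarrow> ((coord \<Rightarrow> real) \<Rightarrow> real) \<Rightarrow> coord gr" where
  "taylor \<tau> f = (\<Sum>k\<le>card N. ((-\<tau>) ^ k / fact k) *\<^sub>R jet k \<tau> f)"

definition monomial :: "real \<Rightarrow> coord set \<Rightarrow> coord gr" where
  "monomial \<tau> I = prod_list (map (z \<tau>) (sorted_list_of_set I))"

lemma fin: "finite evens" "finite odds" "finite (even_lists k)"
  using C by (auto simp: evens_def odds_def even_lists_def intro: finite_lists_length_eq)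

lemma C_split: "C = evens \<union> odds" "evens \<inter> odds = {}"
  by (auto simp: evens_def odds_def)

lemma b_in: "b \<tau> \<in> D"
  using line_in[of \<tau>] by (simp add: b_def z_def comp_def)

lemma b_E: "c \<in> evens \<Longrightarrow> b \<tau> c = v c - \<tau> * body (n c)"
  by (simp add: b_def z_def evens_def var_def body_diff body_scaleR)

lemma n_E: "c \<in> evens \<Longrightarrow> homog 0 (n c)"
  using homog_n[of c] homog_cong[of "cpar c" 0] by (auto simp: evens_def)

lemma soul_n_E: "c \<in> evens \<Longrightarrow> homog 0 (soul (n c))" "c \<in> evens \<Longrightarrow> gens_in N (soul (n c))"
  using n_E gens_n by (auto simp: evens_def intro: homog_soul gens_in_soul)

lemma even_lists_Suc: "even_lists (Suc k) = (\<lambda>(c, cs). c # cs) ` (evens \<times> even_lists k)"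
  by (auto simp: even_lists_def image_def length_Suc_conv)

lemma b_derivative:
  assumes f: "smooth_on D f" "depends_on evens D f"
  shows "((\<lambda>t. f (b t)) has_real_derivative - (\<Sum>c\<in>evens. body (n c) * pderivs [c] f (b \<tau>))) (at \<tau>)"
proof -
  let ?g = "\<lambda>s. f (\<lambda>c. if c \<in> evens then b \<tau> c + s * (- body (n c)) else b \<tau> c)"
  have "(?g has_real_derivative (\<Sum>c\<in>evens. - body (n c) * pderivs [c] f (b \<tau>))) (at 0)"
    by (rule smooth_on_line_derivative[OF D f(1) b_in fin(1)])
  then have g: "(?g has_real_derivative (\<Sum>c\<in>evens. - body (n c) * pderivs [c] f (b \<tau>))) (at (\<tau> - \<tau>))"
    by (simp only: diff_self)
  have sh: "((\<lambda>t. t - \<tau>) has_real_derivative 1) (at \<tau>)" by (auto intro!: derivative_eq_intros)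
  have *: "((\<lambda>t. ?g (t - \<tau>)) has_real_derivative (\<Sum>c\<in>evens. - body (n c) * pderivs [c] f (b \<tau>))) (at \<tau>)"
    using DERIV_chain2[OF g sh] by (simp only: mult_1_right)
  \<comment> \<open>Outside \<open>C\<close> the direction is arbitrary and \<open>b t\<close> may
    move infinitely many coordinates; \<open>f\<close> sees only those in
    \<open>evens\<close>.\<close>
  have "f (b t) = ?g (t - \<tau>)" for t
    by (rule f(2)[unfolded depends_on_def, rule_format, OF b_in]) (simp add: b_E algebra_simps)
  then have "(\<lambda>t. f (b t)) = (\<lambda>t. ?g (t - \<tau>))" by blast
  with * show ?thesis by (simp add: sum_negf)
qed

lemma jet_derivative:
  assumes f: "smooth_on D f" "depends_on evens D f"
  shows "has_gr_deriv (\<lambda>t. jet k t f) (- (\<Sum>c\<in>evens. body (n c) *\<^sub>R jet k \<tau> (pderivs [c] f))) \<tau>"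
proof (rule has_gr_deriv_cong)
  show "has_gr_deriv (\<lambda>t. jet k t f) (\<Sum>cs\<in>even_lists k.
      (- (\<Sum>c\<in>evens. body (n c) * pderivs [c] (pderivs cs f) (b \<tau>))) *\<^sub>R prod_list (map (soul \<circ> n) cs)) \<tau>"
    unfolding jet_def
    by (intro has_gr_deriv_sum has_gr_deriv_scaleR_const b_derivative
        smooth_onD(3)[OF f(1)] depends_on_pderivs[OF D f(2)])
  have "pderivs [c] (pderivs cs f) (b \<tau>) = pderivs cs (pderivs [c] f) (b \<tau>)" for c cs
    using pderivs_Cons_last[OF D f(1) b_in, of c cs] by simp
  then show "- (\<Sum>c\<in>evens. body (n c) *\<^sub>R jet k \<tau> (pderivs [c] f)) = (\<Sum>cs\<in>even_lists k.
      (- (\<Sum>c\<in>evens. body (n c) * pderivs [c] (pderivs cs f) (b \<tau>))) *\<^sub>R prod_list (map (soul \<circ> n) cs))"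
    unfolding jet_def
    by (simp add: scaleR_sum_left scaleR_sum_right sum_negf sum.swap[of _ evens] del: pderivs.simps)
qed simp

text \<open>Lists of length k + 1 are split into head and tail, and the derivative by the head is
  moved innermost.\<close>

lemma jet_Suc:
  assumes f: "smooth_on D f"
  shows "jet (Suc k) \<tau> f = (\<Sum>c\<in>evens. soul (n c) * jet k \<tau> (pderivs [c] f))"
proof -
  have inj: "inj_on (\<lambda>(c, cs). c # cs) (evens \<times> even_lists k)" by (auto simp: inj_on_def)
  have "jet (Suc k) \<tau> f = (\<Sum>(c, cs)\<in>evens \<times> even_lists k.
      pderivs (c # cs) f (b \<tau>) *\<^sub>R prod_list (map (soul \<circ> n) (c # cs)))"
    unfolding jet_def even_lists_Suc sum.reindex[OF inj] by (simp add: case_prod_unfold)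
  also have "\<dots> = (\<Sum>c\<in>evens. \<Sum>cs\<in>even_lists k.
      pderivs (c # cs) f (b \<tau>) *\<^sub>R prod_list (map (soul \<circ> n) (c # cs)))"
    by (simp only: sum.cartesian_product)
  also have "\<dots> = (\<Sum>c\<in>evens. \<Sum>cs\<in>even_lists k.
      soul (n c) * (pderivs cs (pderivs [c] f) (b \<tau>) *\<^sub>R prod_list (map (soul \<circ> n) cs)))"
    by (simp only: pderivs_Cons_last[OF D f b_in] list.map prod_list.Cons comp_def mult_scaleR_right)
  finally show ?thesis unfolding jet_def sum_distrib_left .
qed

lemma jet_top:
  assumes "c \<in> evens" shows "soul (n c) * jet (card N) \<tau> f = 0"
  unfolding jet_def sum_distrib_left
proof (rule sum.neutral, rule ballI)
  fix cs assume cs: "cs \<in> even_lists (card N)"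
  have "prod_list (map (soul \<circ> n) (c # cs)) = 0"
    by (rule nilpotent_prod[OF N])
       (use cs assms in \<open>auto simp: even_lists_def subset_iff intro!: soul_n_E body_soul\<close>)
  then show "soul (n c) * (pderivs cs f (b \<tau>) *\<^sub>R prod_list (map (soul \<circ> n) cs)) = 0" by simp
qed

text \<open>The chain rule for even variables. The parameter enters through the weights and through
  the base point: the weights lower the order by one and release a factor \<open>soul (n c)\<close>,
  the base point contributes \<open>body (n c)\<close>, and together these are
  \<open>n c\<close>.\<close>

lemma taylor_derivative:
  assumes f: "smooth_on D f" "depends_on evens D f"
  shows "has_gr_deriv (\<lambda>t. taylor t f) (- (\<Sum>c\<in>evens. n c * taylor \<tau> (pderivs [c] f))) \<tau>"
proof (rule has_gr_deriv_cong)
  \<comment> \<open>The derivative of a weight is minus the preceding weight, and zero for the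
    constant one.\<close>
  define a where "a k t = (-t) ^ k / fact k" for k and t :: real
  define a' where "a' k t = (case k of 0 \<Rightarrow> 0 | Suc j \<Rightarrow> - a j t)" for k t
  have a: "(a k has_real_derivative a' k t) (at t)" for k t
  proof (cases k)
    case (Suc j)
    have "((\<lambda>t. (-t) ^ Suc j) has_real_derivative (1 + real j) * ((-1) * (-t) ^ j)) (at t)"
      by (rule DERIV_power_Suc) (auto intro!: derivative_eq_intros)
    from DERIV_cdivide[OF this, of "fact (Suc j)"]
    have "((\<lambda>t. (-t) ^ Suc j / fact (Suc j)) has_real_derivative
        (1 + real j) * ((-1) * (-t) ^ j) / fact (Suc j)) (at t)" .
    moreover have "(1 + real j) * ((-1) * (-t) ^ j) / fact (Suc j) = - ((-t) ^ j / fact j)"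
    proof -
      have "(fact (Suc j) :: real) = (1 + real j) * fact j" by (simp add: algebra_simps)
      moreover have "1 + real j \<noteq> 0" by linarith
      ultimately show ?thesis by (simp only: mult_divide_mult_cancel_left) simp
    qed
    ultimately show ?thesis unfolding a'_def a_def[abs_def] Suc by simp
  qed (simp add: a_def[abs_def] a'_def)
  let ?J = "\<lambda>k c. jet k \<tau> (pderivs [c] f)"
  show "has_gr_deriv (\<lambda>t. taylor t f) (\<Sum>k\<le>card N. a' k \<tau> *\<^sub>R jet k \<tau> f
      + a k \<tau> *\<^sub>R (- (\<Sum>c\<in>evens. body (n c) *\<^sub>R ?J k c))) \<tau>"
    unfolding taylor_def a_def[symmetric]
    by (intro has_gr_deriv_sum has_gr_deriv_scaleR a jet_derivative f)
  have 1: "(\<Sum>k\<le>card N. a' k \<tau> *\<^sub>R jet k \<tau> f) = - (\<Sum>c\<in>evens. soul (n c) * taylor \<tau> (pderivs [c] f))"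
  proof -
    have "(\<Sum>k\<le>card N. a' k \<tau> *\<^sub>R jet k \<tau> f) = (\<Sum>k<card N. a' (Suc k) \<tau> *\<^sub>R jet (Suc k) \<tau> f)"
      by (subst sum.atMost_shift) (simp add: a'_def)
    also have "\<dots> = - (\<Sum>c\<in>evens. \<Sum>k<card N. soul (n c) * (a k \<tau> *\<^sub>R ?J k c))"
      by (simp add: a'_def jet_Suc[OF f(1)] scaleR_sum_right sum_negf sum.swap[of _ evens] del: pderivs.simps)
    \<comment> \<open>Lowering the order leaves the top one uncovered; its term may be added since
      it vanishes by \<open>jet_top\<close>.\<close>
    also have "\<dots> = - (\<Sum>c\<in>evens. \<Sum>k\<le>card N. soul (n c) * (a k \<tau> *\<^sub>R ?J k c))"
      by (simp add: jet_top lessThan_Suc_atMost[symmetric] del: pderivs.simps)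
    finally show ?thesis unfolding taylor_def a_def[symmetric] sum_distrib_left .
  qed
  have 2: "(\<Sum>k\<le>card N. a k \<tau> *\<^sub>R (- (\<Sum>c\<in>evens. body (n c) *\<^sub>R ?J k c)))
      = - (\<Sum>c\<in>evens. body (n c) *\<^sub>R taylor \<tau> (pderivs [c] f))"
    unfolding taylor_def a_def[symmetric]
    by (simp add: scaleR_sum_right sum_negf sum.swap[of _ evens] mult.commute del: pderivs.simps)
  have 3: "n c * x = soul (n c) * x + body (n c) *\<^sub>R x" for c x
    by (simp add: soul_def algebra_simps of_real_def)
  show "- (\<Sum>c\<in>evens. n c * taylor \<tau> (pderivs [c] f)) = (\<Sum>k\<le>card N. a' k \<tau> *\<^sub>R jet k \<tau> f
      + a k \<tau> *\<^sub>R (- (\<Sum>c\<in>evens. body (n c) *\<^sub>R ?J k c)))"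
    unfolding sum.distrib 1 2 by (simp add: 3 sum.distrib del: pderivs.simps)
qed simp

lemma homog_prod_even: "(\<And>x. x \<in> set xs \<Longrightarrow> homog 0 x) \<Longrightarrow> homog 0 (prod_list xs)"
proof (induction xs)
  case (Cons x xs)
  then show ?case using homog_times[of 0 x 0 "prod_list xs"] by simp
qed simp

lemma homog_taylor: "homog 0 (taylor \<tau> f)"
  unfolding taylor_def jet_def
  by (intro homog_sum homog_scaleR homog_prod_even) (auto simp: even_lists_def intro: soul_n_E)

text \<open>The base point lies in the open set \<open>D\<close>, so values on \<open>D\<close>
  determine all derivatives involved. The case \<open>k = 0\<close> makes Taylor sums of functions
  vanishing on \<open>D\<close> vanish.\<close>

lemma taylor_cong_scaleR:
  assumes "\<And>u. u \<in> D \<Longrightarrow> g u = k * f u" "smooth_on D f"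
  shows "taylor \<tau> g = k *\<^sub>R taylor \<tau> f"
proof -
  have "pderivs cs g u = k * pderivs cs f u" if "u \<in> D" for cs u
    using that
  proof (induction cs arbitrary: u)
    case (Cons c cs)
    have "pderivs [c] (pderivs cs g) u = pderivs [c] (\<lambda>u. k * pderivs cs f u) u"
      by (rule pderivs_cong[OF D _ Cons.prems]) (rule Cons.IH)
    moreover have "((\<lambda>t. k * pderivs cs f (u(c := t))) has_real_derivative k * pderivs [c] (pderivs cs f) u) (at (u c))"
      by (intro DERIV_cmult smooth_on_has_derivative'[OF smooth_onD(3)[OF assms(2)] Cons.prems])
    ultimately show ?case by (simp add: DERIV_imp_deriv)
  qed (simp add: assms)
  then show ?thesis
    by (simp add: taylor_def jet_def b_in scaleR_sum_right mult.left_commute mult.assoc)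
qed

lemma superfun_coeff:
  assumes "superfun C D F"
  shows "smooth_on D (\<lambda>u. coeff (F u) I)" "depends_on evens D (\<lambda>u. coeff (F u) I)"
    "u \<in> D \<Longrightarrow> \<not> I \<subseteq> odds \<Longrightarrow> coeff (F u) I = 0"
  using assms unfolding superfun_def depends_on_def evens_def odds_def
  by (auto simp: gens_in_iff) metis

lemma soul_z_E: "c \<in> evens \<Longrightarrow> soul (z \<tau> c) = (-\<tau>) *\<^sub>R soul (n c)"
proof -
  assume c: "c \<in> evens"
  then have "body (z \<tau> c) = v c - \<tau> * body (n c)"
    by (simp add: z_def evens_def var_def body_diff body_scaleR)
  then show ?thesis
    using c by (simp add: soul_def) (simp add: z_def evens_def var_def scaleR_conv_of_real algebra_simps)
qed

text \<open>Both infinite sums have finite support: a list containing a variable outside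
  \<open>evens\<close> has derivative zero, a list longer than \<open>card N\<close> has a zero
  product of souls, and a monomial with generators outside \<open>odds\<close> has coefficient
  zero.\<close>

lemma sfeval_eq:
  assumes F: "superfun C D F"
  shows "sfeval F (z \<tau>) = (\<Sum>I\<in>Pow odds. taylor \<tau> (\<lambda>u. coeff (F u) I) * monomial \<tau> I)"
proof -
  define T where "T I cs = (pderivs cs (\<lambda>u. coeff (F u) I) (b \<tau>) / fact (length cs)) *\<^sub>R
     prod_list (map (soul \<circ> z \<tau>) cs)" for I cs
  have inner: "Sum_any (T I) = taylor \<tau> (\<lambda>u. coeff (F u) I)" for I
  proof -
    have prod: "prod_list (map (soul \<circ> z \<tau>) cs) = (-\<tau>) ^ length cs *\<^sub>R prod_list (map (soul \<circ> n) cs)"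
      if "set cs \<subseteq> evens" for cs
      using that by (induction cs) (simp_all add: soul_z_E)
    have sub: "{cs. T I cs \<noteq> 0} \<subseteq> (\<Union>k\<in>{..card N}. even_lists k)"
    proof
      fix cs assume "cs \<in> {cs. T I cs \<noteq> 0}"
      then have nz: "T I cs \<noteq> 0" by simp
      then have E: "set cs \<subseteq> evens"
        using pderivs_eq_0[OF D superfun_coeff(2)[OF F] b_in] unfolding T_def by fastforce
      have "length cs \<le> card N"
      proof (rule ccontr)
        assume "\<not> length cs \<le> card N"
        then have "prod_list (map (soul \<circ> n) cs) = 0"
          by (intro nilpotent_prod[OF N]) (use E in \<open>auto intro!: soul_n_E body_soul\<close>)
        then show False using nz prod[OF E] by (simp add: T_def)
      qed
      then show "cs \<in> (\<Union>k\<in>{..card N}. even_lists k)" using E by (auto simp: even_lists_def)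
    qed
    have "Sum_any (T I) = (\<Sum>cs\<in>(\<Union>k\<in>{..card N}. even_lists k). T I cs)"
      by (rule Sum_any.expand_superset[OF _ sub]) (simp add: fin)
    also have "\<dots> = (\<Sum>k\<le>card N. \<Sum>cs\<in>even_lists k. T I cs)"
      by (rule sum.UNION_disjoint) (auto simp: fin, auto simp: even_lists_def)
    also have "\<dots> = taylor \<tau> (\<lambda>u. coeff (F u) I)"
      unfolding taylor_def jet_def scaleR_sum_right
      by (intro sum.cong refl) (auto simp: T_def prod even_lists_def mult.commute)
    finally show ?thesis .
  qed
  have zero: "taylor \<tau> (\<lambda>u. coeff (F u) I) = 0" if "\<not> I \<subseteq> odds" for I
    using taylor_cong_scaleR[of "\<lambda>u. coeff (F u) I" 0 "\<lambda>u. 0" \<tau>] superfun_coeff(3)[OF F _ that]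
      smooth_on_const[OF D] by simp
  have "sfeval F (z \<tau>) = Sum_any (\<lambda>I. taylor \<tau> (\<lambda>u. coeff (F u) I) * monomial \<tau> I)"
    unfolding sfeval_def monomial_def inner[symmetric] T_def b_def ..
  also have "\<dots> = (\<Sum>I\<in>Pow odds. taylor \<tau> (\<lambda>u. coeff (F u) I) * monomial \<tau> I)"
  proof (rule Sum_any.expand_superset)
    show "{I. taylor \<tau> (\<lambda>u. coeff (F u) I) * monomial \<tau> I \<noteq> 0} \<subseteq> Pow odds"
      by (rule subsetI, rule PowI, rule ccontr) (simp add: zero)
  qed (simp add: fin)
  finally show ?thesis .
qed

text \<open>Carries pointwise identities on \<open>D\<close>, in particular the row equations, over
  to substituted values.\<close>

lemma sfeval_scaleR:
  assumes "superfun C D F" "superfun C D G" "\<And>u. u \<in> D \<Longrightarrow> G u = k *\<^sub>R F u"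
  shows "sfeval G (z \<tau>) = k *\<^sub>R sfeval F (z \<tau>)"
  unfolding sfeval_eq[OF assms(1)] sfeval_eq[OF assms(2)] scaleR_sum_right
proof (rule sum.cong)
  fix I
  have "taylor \<tau> (\<lambda>u. coeff (G u) I) = k *\<^sub>R taylor \<tau> (\<lambda>u. coeff (F u) I)"
    by (rule taylor_cong_scaleR) (use assms superfun_coeff(1) in auto)
  then show "taylor \<tau> (\<lambda>u. coeff (G u) I) * monomial \<tau> I = k *\<^sub>R (taylor \<tau> (\<lambda>u. coeff (F u) I) * monomial \<tau> I)"
    by simp
qed simp

lemma monomial_insert_min:
  "finite A \<Longrightarrow> \<forall>a\<in>A. c < a \<Longrightarrow> monomial \<tau> (insert c A) = z \<tau> c * monomial \<tau> A"
  unfolding monomial_def by (subst sorted_list_of_set_insert_min) auto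

lemma z_O: "c \<in> odds \<Longrightarrow> homog 1 (z \<tau> c)" "c \<in> odds \<Longrightarrow> homog 1 (n c)"
  using homog_n[of c] homog_var[of c v] homog_cong[of "cpar c" 1]
  by (auto simp: odds_def z_def intro: homog_diff homog_scaleR)

text \<open>Bringing the differentiated factor \<open>n c\<close> to the front costs one sign for
  each smaller index in \<open>I\<close>, which is \<open>gsign {c} (I - {c})\<close>.\<close>

lemma monomial_derivative:
  assumes "finite I" "I \<subseteq> odds"
  shows "has_gr_deriv (\<lambda>t. monomial t I)
     (- (\<Sum>c\<in>I. gsign {c} (I - {c}) *\<^sub>R (n c * monomial \<tau> (I - {c})))) \<tau>"
  using assms
proof (induction I rule: finite_linorder_min_induct)
  case empty
  then show ?case using has_gr_deriv_const[of 1] by (simp add: monomial_def)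
next
  case (insert a A)
  have a: "a \<notin> A" using insert by auto
  have za: "has_gr_deriv (\<lambda>t. z t a) (- n a) \<tau>"
    unfolding z_def has_gr_deriv_def coeff_simps by (auto intro!: derivative_eq_intros)
  have "has_gr_deriv (\<lambda>t. z t a * monomial t A)
      ((- n a) * monomial \<tau> A + z \<tau> a * (- (\<Sum>c\<in>A. gsign {c} (A - {c}) *\<^sub>R (n c * monomial \<tau> (A - {c}))))) \<tau>"
    by (rule has_gr_deriv_mult[OF za insert.IH]) (use insert.prems in auto)
  moreover have "(- n a) * monomial \<tau> A + z \<tau> a * (- (\<Sum>c\<in>A. gsign {c} (A - {c}) *\<^sub>R (n c * monomial \<tau> (A - {c}))))
     = - (\<Sum>c\<in>insert a A. gsign {c} (insert a A - {c}) *\<^sub>R (n c * monomial \<tau> (insert a A - {c})))"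
  proof -
    have g1: "gsign {a} A = 1" using insert.hyps(2) by (rule gsign_min)
    \<comment> \<open>The new first factor \<open>z \<tau> a\<close> is odd and precedes
      \<open>c\<close>: it adds one inversion to the sign, and moving \<open>n c\<close> in front of
      it costs exactly that sign.\<close>
    have g2: "gsign {c} (insert a A - {c}) *\<^sub>R (n c * monomial \<tau> (insert a A - {c}))
        = z \<tau> a * (gsign {c} (A - {c}) *\<^sub>R (n c * monomial \<tau> (A - {c})))" if c: "c \<in> A" for c
    proof -
      have ac: "a < c" using insert.hyps c by auto
      have e: "insert a A - {c} = {a} \<union> (A - {c})" using ac by auto
      have "{(i, j). i \<in> {c} \<and> j \<in> {a} \<and> j < i} = {(c, a)}" using ac by auto
      then have "gsign {c} {a} = - 1" unfolding gsign_def inversions_def by simp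
      then have 1: "gsign {c} (insert a A - {c}) = - gsign {c} (A - {c})"
        unfolding e using gsign_Un_right[of "{c}" "{a}" "A - {c}"] insert.hyps(1) a by auto
      have "monomial \<tau> (insert a A - {c}) = z \<tau> a * monomial \<tau> (A - {c})"
        unfolding e using monomial_insert_min[of "A - {c}" a] insert.hyps by auto
      moreover have "z \<tau> a * (n c * x) = - (n c * (z \<tau> a * x))" for x
        using supercommute_left[OF z_O(1)[of a] z_O(2)[of c], of \<tau> x] insert.prems c by auto
      ultimately show ?thesis by (simp add: 1)
    qed
    have "(\<Sum>c\<in>A. gsign {c} (insert a A - {c}) *\<^sub>R (n c * monomial \<tau> (insert a A - {c})))
        = z \<tau> a * (\<Sum>c\<in>A. gsign {c} (A - {c}) *\<^sub>R (n c * monomial \<tau> (A - {c})))"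
      unfolding sum_distrib_left by (rule sum.cong[OF refl g2])
    then show ?thesis using insert.hyps(1) a g1 by simp
  qed
  ultimately show ?case
    unfolding monomial_insert_min[OF insert.hyps(1,2)] by simp
qed

text \<open>The chain rule for substitution: even variables act through the Taylor factor, odd ones
  through the monomials. The direction stands to the left of the derivative because derivatives act
  from the left.\<close>

lemma sfeval_derivative:
  assumes F: "superfun C D F"
  shows "has_gr_deriv (\<lambda>t. sfeval F (z t)) (- (\<Sum>c\<in>C. n c * sfeval (pd c F) (z \<tau>))) \<tau>"
proof (rule has_gr_deriv_cong)
  let ?f = "\<lambda>I u. coeff (F u) I"
  let ?A = "\<lambda>I. (\<Sum>c\<in>evens. n c * taylor \<tau> (pderivs [c] (?f I))) * monomial \<tau> I"
  let ?G = "\<lambda>c J. gsign {c} J *\<^sub>R (n c * (taylor \<tau> (?f (insert c J)) * monomial \<tau> J))"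
  show "has_gr_deriv (\<lambda>t. \<Sum>I\<in>Pow odds. taylor t (?f I) * monomial t I)
     (\<Sum>I\<in>Pow odds. (- (\<Sum>c\<in>evens. n c * taylor \<tau> (pderivs [c] (?f I)))) * monomial \<tau> I
        + taylor \<tau> (?f I) * (- (\<Sum>c\<in>I. gsign {c} (I - {c}) *\<^sub>R (n c * monomial \<tau> (I - {c}))))) \<tau>"
    by (intro has_gr_deriv_sum has_gr_deriv_mult taylor_derivative monomial_derivative
        superfun_coeff[OF F]) (auto intro: finite_subset[OF _ fin(2)])
  have E: "(\<Sum>I\<in>Pow odds. ?A I) = (\<Sum>c\<in>evens. n c * sfeval (pd c F) (z \<tau>))"
  proof -
    have "(\<lambda>u. coeff (pd c F u) I) = pderivs [c] (?f I)" if "c \<in> evens" for c I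
      using that by (simp add: coeff_pd evens_def)
    then have "n c * sfeval (pd c F) (z \<tau>) = (\<Sum>I\<in>Pow odds. n c * (taylor \<tau> (pderivs [c] (?f I)) * monomial \<tau> I))"
      if "c \<in> evens" for c
      using that by (simp add: sfeval_eq[OF superfun_pd[OF D F]] sum_distrib_left del: pderivs.simps)
    then show ?thesis
      by (simp add: sum_distrib_right mult.assoc sum.swap[of _ evens] del: pderivs.simps)
  qed
  have O: "(\<Sum>I\<in>Pow odds. taylor \<tau> (?f I) * (\<Sum>c\<in>I. gsign {c} (I - {c}) *\<^sub>R (n c * monomial \<tau> (I - {c}))))
      = (\<Sum>c\<in>odds. n c * sfeval (pd c F) (z \<tau>))"
  proof -
    have "(\<Sum>I\<in>Pow odds. taylor \<tau> (?f I) * (\<Sum>c\<in>I. gsign {c} (I - {c}) *\<^sub>R (n c * monomial \<tau> (I - {c}))))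
        = (\<Sum>I\<in>Pow odds. \<Sum>c\<in>I. ?G c (I - {c}))"
    proof (rule sum.cong[OF refl])
      fix I
      \<comment> \<open>The Taylor factor is even, so the odd \<open>n c\<close> passes it without a
        sign.\<close>
      have "taylor \<tau> (?f I) * (n c * x) = n c * (taylor \<tau> (?f I) * x)" for c x
        by (simp only: mult.assoc[symmetric] even_central[OF homog_taylor, of \<tau> "?f I" "n c"])
      then show "taylor \<tau> (?f I) * (\<Sum>c\<in>I. gsign {c} (I - {c}) *\<^sub>R (n c * monomial \<tau> (I - {c})))
          = (\<Sum>c\<in>I. ?G c (I - {c}))"
        by (simp add: sum_distrib_left insert_absorb)
    qed
    also have "\<dots> = (\<Sum>(I, c)\<in>(SIGMA I:Pow odds. I). ?G c (I - {c}))"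
      by (rule sum.Sigma) (auto simp: fin intro: finite_subset[OF _ fin(2)])
    \<comment> \<open>Removing \<open>c\<close> from \<open>I\<close> sets up a bijection with the
      pairs of \<open>c\<close> and a set \<open>J\<close> avoiding it; these index the monomials of
      the odd derivative of \<open>F\<close>.\<close>
    also have "\<dots> = (\<Sum>(c, J)\<in>(SIGMA c:odds. {J \<in> Pow odds. c \<notin> J}). ?G c J)"
      by (rule sum.reindex_bij_witness[where i = "\<lambda>(c, J). (insert c J, c)" and j = "\<lambda>(I, c). (c, I - {c})"])
         (auto simp: insert_absorb)
    also have "\<dots> = (\<Sum>c\<in>odds. \<Sum>J\<in>{J \<in> Pow odds. c \<notin> J}. ?G c J)"
      by (rule sum.Sigma[symmetric]) (auto simp: fin)
    also have "\<dots> = (\<Sum>c\<in>odds. n c * sfeval (pd c F) (z \<tau>))"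
    proof (rule sum.cong[OF refl])
      fix c assume c: "c \<in> odds"
      have t: "taylor \<tau> (\<lambda>u. coeff (pd c F u) J)
          = (if c \<in> J then 0 else gsign {c} J *\<^sub>R taylor \<tau> (?f (insert c J)))" for J
      proof -
        have "taylor \<tau> (\<lambda>u. coeff (pd c F u) J)
            = (if c \<in> J then 0 else gsign {c} J) *\<^sub>R taylor \<tau> (?f (insert c J))"
          by (rule taylor_cong_scaleR) (use c superfun_coeff(1)[OF F] in \<open>auto simp: coeff_pd odds_def\<close>)
        then show ?thesis by simp
      qed
      have "n c * sfeval (pd c F) (z \<tau>) = (\<Sum>J\<in>Pow odds. if c \<in> J then 0 else ?G c J)"
        unfolding sfeval_eq[OF superfun_pd[OF D F]] sum_distrib_left
        by (rule sum.cong) (auto simp: t)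
      also have "\<dots> = (\<Sum>J\<in>{J \<in> Pow odds. c \<notin> J}. ?G c J)"
        using fin by (intro sum.mono_neutral_cong_right) auto
      finally show "(\<Sum>J\<in>{J \<in> Pow odds. c \<notin> J}. ?G c J) = n c * sfeval (pd c F) (z \<tau>)" ..
    qed
    finally show ?thesis .
  qed
  have "(\<Sum>c\<in>C. n c * sfeval (pd c F) (z \<tau>))
      = (\<Sum>c\<in>evens. n c * sfeval (pd c F) (z \<tau>)) + (\<Sum>c\<in>odds. n c * sfeval (pd c F) (z \<tau>))"
    using sum.union_disjoint[OF fin(1,2) C_split(2), of "\<lambda>c. n c * sfeval (pd c F) (z \<tau>)"]
    by (simp only: C_split(1)[symmetric])
  then show "- (\<Sum>c\<in>C. n c * sfeval (pd c F) (z \<tau>)) =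
     (\<Sum>I\<in>Pow odds. (- (\<Sum>c\<in>evens. n c * taylor \<tau> (pderivs [c] (?f I)))) * monomial \<tau> I
        + taylor \<tau> (?f I) * (- (\<Sum>c\<in>I. gsign {c} (I - {c}) *\<^sub>R (n c * monomial \<tau> (I - {c})))))"
    using E O by (simp only: mult_minus_left mult_minus_right sum.distrib sum_negf minus_add_distrib)
qed (simp add: sfeval_eq[OF F])

lemma sfeval_0:
  assumes F: "superfun C D F" and v: "v \<in> D"
  shows "sfeval F (z 0) = F v"
proof (rule gr_eqI)
  fix J :: "coord set" assume J: "finite J"
  have t: "taylor 0 f = of_real (f (b 0))" for f
  proof -
    have "even_lists 0 = {[]}" by (auto simp: even_lists_def)
    then have "jet 0 0 f = of_real (f (b 0))" by (simp add: jet_def of_real_def)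
    then show ?thesis unfolding taylor_def by (subst sum.atMost_shift) simp
  qed
  have m: "monomial 0 I = prod_list (map gen (sorted_list_of_set I))" if "I \<subseteq> odds" for I
  proof -
    have "finite I" using that fin(2) finite_subset by blast
    then have "\<forall>c\<in>set (sorted_list_of_set I). z 0 c = gen c"
      using that by (auto simp: z_def var_def odds_def)
    then show ?thesis unfolding monomial_def by (metis map_eq_conv)
  qed
  \<comment> \<open>The points \<open>v\<close> and \<open>b 0\<close> need agree only in the even
    variables, since odd slots of \<open>b 0\<close> are zero.\<close>
  have "F v = F (b 0)"
    by (rule superfun_eq[OF F v]) (simp add: b_E evens_def)
  then have "coeff (sfeval F (z 0)) J = (\<Sum>I\<in>Pow odds. coeff (F v) I * coeff (monomial 0 I) J)"
    unfolding sfeval_eq[OF F] t coeff_sum by (simp add: of_real_def)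
  also have "\<dots> = (\<Sum>I\<in>Pow odds. if I = J then coeff (F v) J else 0)"
    using J by (intro sum.cong) (auto simp: m prod_gen_coeff finite_subset[OF _ fin(2)])
  also have "\<dots> = coeff (F v) J"
    using superfun_coeff(3)[OF F v, of J] fin by auto
  finally show "coeff (sfeval F (z 0)) J = coeff (F v) J" .
qed

text \<open>The assumption \<open>second\<close> is the vanishing of the second derivative in
  \<tau>, at every point of the line. The substituted value is then affine in \<tau>.\<close>

lemma sfeval_affine:
  assumes F: "superfun C D F" and v: "v \<in> D"
    and second: "\<And>\<tau>. (\<Sum>c\<in>C. \<Sum>d\<in>C. n c * (n d * sfeval (pd d (pd c F)) (z \<tau>))) = 0"
  shows "sfeval F (z 1) = F v - (\<Sum>c\<in>C. n c * pd c F v)"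
proof -
  let ?\<psi> = "\<lambda>t. \<Sum>c\<in>C. n c * sfeval (pd c F) (z t)"
  have \<psi>: "has_gr_deriv ?\<psi> 0 t" for t
  proof -
    let ?d = "\<lambda>c. - (\<Sum>d\<in>C. n d * sfeval (pd d (pd c F)) (z t))"
    have "has_gr_deriv (\<lambda>t. n c * sfeval (pd c F) (z t)) (n c * ?d c) t" for c
      using has_gr_deriv_mult[OF has_gr_deriv_const[of "n c"]
          sfeval_derivative[OF superfun_pd[OF D F], of c t]] by simp
    then have "has_gr_deriv ?\<psi> (\<Sum>c\<in>C. n c * ?d c) t"
      by (intro has_gr_deriv_sum)
    moreover have "(\<Sum>c\<in>C. n c * ?d c) = 0"
      using second[of t] by (simp only: mult_minus_right sum_negf sum_distrib_left minus_zero)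
    ultimately show ?thesis by simp
  qed
  have "sfeval F (z 1) = sfeval F (z 0) - ?\<psi> 0"
    by (rule gr_affine[OF sfeval_derivative[OF F] \<psi>])
  then show ?thesis using sfeval_0[OF F v] sfeval_0[OF superfun_pd[OF D F] v] by simp
qed

end

section \<open>The domain of admissible arguments\<close>

text \<open>The unit sphere of the maximum norm in dimension \<open>q\<close>, embedded in sequences
  that vanish from \<open>q\<close> on; compactness is inherited from a product of compact
  intervals.\<close>

lemma compact_max_norm_sphere:
  "compact {c :: nat \<Rightarrow> real. (\<forall>k. c k \<in> (if k < q then {-1..1} else {0})) \<and> (\<exists>k<q. \<bar>c k\<bar> = 1)}"
proof -
  have "compactin (product_topology (\<lambda>k. euclidean) UNIV)
      (\<Pi>\<^sub>E k\<in>UNIV. (if k < q then {-1..1::real} else {0}))"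
    by (subst compactin_PiE) auto
  then have "compact (\<Pi>\<^sub>E k\<in>UNIV. (if k < q then {-1..1::real} else {0}))"
    by (simp add: euclidean_product_topology)
  moreover have "closed {c :: nat \<Rightarrow> real. \<exists>k<q. \<bar>c k\<bar> = 1}"
  proof -
    have "closed {c :: nat \<Rightarrow> real. \<bar>c k\<bar> = 1}" for k
      by (intro closed_Collect_eq continuous_intros) (rule continuous_on_product_coordinates)
    then have "closed (\<Union>k\<in>{..<q}. {c :: nat \<Rightarrow> real. \<bar>c k\<bar> = 1})" by blast
    moreover have "(\<Union>k\<in>{..<q}. {c :: nat \<Rightarrow> real. \<bar>c k\<bar> = 1}) = {c. \<exists>k<q. \<bar>c k\<bar> = 1}" by auto
    ultimately show ?thesis by simp
  qed
  ultimately have "compact ((\<Pi>\<^sub>E k\<in>UNIV. (if k < q then {-1..1::real} else {0})) \<inter> {c. \<exists>k<q. \<bar>c k\<bar> = 1})"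
    by (rule compact_Int_closed)
  moreover have "(\<Pi>\<^sub>E k\<in>UNIV. (if k < q then {-1..1::real} else {0})) \<inter> {c. \<exists>k<q. \<bar>c k\<bar> = 1}
     = {c. (\<forall>k. c k \<in> (if k < q then {-1..1} else {0})) \<and> (\<exists>k<q. \<bar>c k\<bar> = 1)}"
    by (auto simp: PiE_def Pi_def)
  ultimately show ?thesis by simp
qed

text \<open>By homogeneity, independence means that a continuous sum of squares has no zero on the
  compact unit sphere. The tube lemma makes this an open condition on the parameter.\<close>

lemma open_independent:
  fixes g :: "'i \<Rightarrow> nat \<Rightarrow> 'a::topological_space \<Rightarrow> real"
  assumes I: "finite I" and g: "\<And>i k. continuous_on UNIV (g i k)"
  shows "open {v. \<forall>c. (\<forall>i\<in>I. (\<Sum>k<q. g i k v * c k) = 0) \<longrightarrow> (\<forall>k<q. c k = 0)}"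
    (is "open ?S")
proof -
  define S where "S = {c :: nat \<Rightarrow> real. (\<forall>k. c k \<in> (if k < q then {-1..1} else {0})) \<and> (\<exists>k<q. \<bar>c k\<bar> = 1)}"
  define \<phi> where "\<phi> x = (\<Sum>i\<in>I. (\<Sum>k<q. g i k (fst x) * snd x k)\<^sup>2)" for x :: "'a \<times> (nat \<Rightarrow> real)"
  have coord: "continuous_on UNIV (\<lambda>x :: 'a \<times> (nat \<Rightarrow> real). snd x k)" for k
    by (rule continuous_on_product_then_coordinatewise) (intro continuous_intros)
  have "continuous_on UNIV (\<lambda>x :: 'a \<times> (nat \<Rightarrow> real). g i k (fst x))" for i k
    by (rule continuous_on_compose2[OF g]) (auto intro: continuous_intros)
  then have "continuous_on UNIV \<phi>" unfolding \<phi>_def by (intro continuous_intros coord)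
  then have W: "open {x. \<phi> x \<noteq> 0}" by (intro open_Collect_neq continuous_intros)
  have \<phi>0: "\<phi> (v, c) = 0 \<longleftrightarrow> (\<forall>i\<in>I. (\<Sum>k<q. g i k v * c k) = 0)" for v c
    unfolding \<phi>_def using I by (simp add: sum_nonneg_eq_0_iff)
  have eq: "?S = {v. \<forall>c\<in>S. \<phi> (v, c) \<noteq> 0}"
  proof (intro subset_antisym subsetI)
    fix v assume "v \<in> ?S"
    then have *: "\<And>c. (\<forall>i\<in>I. (\<Sum>k<q. g i k v * c k) = 0) \<Longrightarrow> \<forall>k<q. c k = 0" by blast
    have "\<phi> (v, c) \<noteq> 0" if "c \<in> S" for c
      using *[of c] that unfolding \<phi>0 S_def by force
    then show "v \<in> {v. \<forall>c\<in>S. \<phi> (v, c) \<noteq> 0}" by blast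
  next
    fix v assume v: "v \<in> {v. \<forall>c\<in>S. \<phi> (v, c) \<noteq> 0}"
    have "\<forall>k<q. c k = 0" if c: "\<forall>i\<in>I. (\<Sum>k<q. g i k v * c k) = 0" for c
    proof (rule ccontr)
      assume "\<not> (\<forall>k<q. c k = 0)"
      then obtain k0 where k0: "k0 < q" "c k0 \<noteq> 0" by blast
      \<comment> \<open>A nontrivial relation is divided by its maximum norm to land on the
        sphere.\<close>
      define m where "m = Max ((\<lambda>k. \<bar>c k\<bar>) ` {..<q})"
      have le: "\<bar>c k\<bar> \<le> m" if "k < q" for k unfolding m_def using that by (intro Max_ge) auto
      have "m \<in> (\<lambda>k. \<bar>c k\<bar>) ` {..<q}" unfolding m_def using k0 by (intro Max_in) auto
      then obtain k1 where k1: "k1 < q" "\<bar>c k1\<bar> = m" by auto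
      have m: "m > 0" using le[OF k0(1)] k0(2) by linarith
      define d where "d k = (if k < q then c k / m else 0)" for k
      have "-1 \<le> c k / m \<and> c k / m \<le> 1" if "k < q" for k
        using le[OF that] m by (auto simp: field_simps abs_le_iff)
      moreover have "\<bar>d k1\<bar> = 1" using k1 m by (simp add: d_def)
      ultimately have "d \<in> S" using k1 unfolding S_def by (auto simp: d_def)
      moreover have "(\<Sum>k<q. g i k v * d k) = (\<Sum>k<q. g i k v * c k) / m" for i
        unfolding sum_divide_distrib by (rule sum.cong) (auto simp: d_def)
      then have "\<phi> (v, d) = 0" unfolding \<phi>0 using c by simp
      ultimately show False using v by blast
    qed
    then show "v \<in> ?S" by blast
  qed
  show ?thesis
    unfolding eq
  proof (subst open_subopen, rule ballI)
    fix v assume v: "v \<in> {v. \<forall>c\<in>S. \<phi> (v, c) \<noteq> 0}"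
    then have "{v} \<times> S \<subseteq> {x. \<phi> x \<noteq> 0}" by auto
    from Elementary_Topology.tube_lemma[OF compact_max_norm_sphere[of q, folded S_def] W this]
    obtain X where "v \<in> X" "open X" "X \<times> S \<subseteq> {x. \<phi> x \<noteq> 0}" by blast
    then show "\<exists>T. open T \<and> v \<in> T \<and> T \<subseteq> {v. \<forall>c\<in>S. \<phi> (v, c) \<noteq> 0}" by (intro exI[of _ X]) auto
  qed
qed

lemma open_xdom:
  assumes "openin (Euclidean_space n) U" shows "open (xdom n U)"
proof -
  obtain T where T: "open T" "U = T \<inter> {x. \<forall>i\<ge>n. x i = 0}"
    using assms unfolding Euclidean_space_def openin_subtopology
    by (auto simp: euclidean_product_topology)
  have "continuous_on UNIV (\<lambda>v. xbody n v a)" for a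
    by (cases "a < n") (simp_all add: xbody_def)
  then have "continuous_on UNIV (xbody n)" by (rule continuous_on_coordinatewise_then_product)
  then have "open (xbody n -` T)" using T(1) open_vimage by blast
  moreover have "xdom n U = xbody n -` T" unfolding T(2) by (auto simp: xdom_def xbody_def)
  ultimately show ?thesis by simp
qed

lemma open_mdom:
  assumes U: "openin (Euclidean_space n) U" shows "open (mdom n m s q U)"
proof -
  \<comment> \<open>The odd rows of \<open>p\<close> and of \<open>w\<close> are stacked over a sum
    type, so that independence of the odd columns is one linear system.\<close>
  define g :: "nat + nat \<Rightarrow> nat \<Rightarrow> (coord \<Rightarrow> real) \<Rightarrow> real" where
    "g i k v = (case i of Inl a \<Rightarrow> v (Pc (Od a) (Od k)) | Inr f \<Rightarrow> v (Wc (Od f) (Od k)))" for i k v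
  have g: "continuous_on UNIV (g i k)" for i k
    by (cases i) (simp_all add: g_def[abs_def])
  let ?C = "\<lambda>v. \<forall>c. (\<forall>i\<in>{..<m} <+> {..<s}. (\<Sum>k<q. g i k v * c k) = 0) \<longrightarrow> (\<forall>k<q. c k = 0)"
  let ?R = "\<lambda>v::coord \<Rightarrow> real. \<forall>c. (\<forall>k\<in>{..<q}. (\<Sum>f<s. v (Wc (Od f) (Od k)) * c f) = 0) \<longrightarrow> (\<forall>f<s. c f = 0)"
  have "open {v. ?C v}" by (rule open_independent[OF _ g]) simp
  moreover have "open {v. ?R v}" by (rule open_independent) simp_all
  moreover have "mdom n m s q U = xdom n U \<inter> {v. ?C v} \<inter> {v. ?R v}"
  proof -
    have "(\<forall>i\<in>{..<m} <+> {..<s}. (\<Sum>k<q. g i k v * c k) = 0) \<longleftrightarrow>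
        (\<forall>a<m. (\<Sum>k<q. v (Pc (Od a) (Od k)) * c k) = 0) \<and> (\<forall>f<s. (\<Sum>k<q. v (Wc (Od f) (Od k)) * c k) = 0)"
      for v c unfolding Plus_def ball_Un ball_simps g_def sum.case by auto
    then show ?thesis unfolding mdom_def xdom_def by (auto simp: mult.commute)
  qed
  ultimately show ?thesis using open_xdom[OF U] by auto
qed

text \<open>Used both for moving along the line defining \<sigma> and for varying entries of the new
  even row and column: neither touches the entries listed here.\<close>

lemma mdom_cong:
  assumes "\<And>a. a < n \<Longrightarrow> v (Xc (Ev a)) = v' (Xc (Ev a))"
    "\<And>a k. a < m \<Longrightarrow> k < q \<Longrightarrow> v (Pc (Od a) (Od k)) = v' (Pc (Od a) (Od k))"
    "\<And>f k. f < s \<Longrightarrow> k < q \<Longrightarrow> v (Wc (Od f) (Od k)) = v' (Wc (Od f) (Od k))"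
    and v: "v \<in> mdom n m s q U"
  shows "v' \<in> mdom n m s q U"
proof -
  have "xbody n v = xbody n v'" unfolding xbody_def using assms(1) by auto
  then show ?thesis using v assms(2,3) unfolding mdom_def by auto
qed

lemma mdom_subset_xdom: "mdom n m s q U \<subseteq> xdom n U"
  by (auto simp: mdom_def xdom_def)


section \<open>Rows of the argument of a mixed form\<close>

text \<open>The rows of \<open>p\<close> placed over \<open>w\<close>: \<open>Inl A\<close> is the row \<open>A\<close> of \<open>p\<close> and \<open>Inr F\<close> the row \<open>F\<close> of \<open>w\<close>.\<close>
fun rowc :: "sindex + sindex \<Rightarrow> sindex \<Rightarrow> coord" where
  "rowc (Inl A) K = Pc A K"
| "rowc (Inr F) K = Wc F K"

fun rpar :: "sindex + sindex \<Rightarrow> nat" where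
  "rpar (Inl A) = par A"
| "rpar (Inr F) = par F"

lemma cpar_rowc [simp]: "cpar (rowc R K) = rpar R + par K"
  by (cases R) auto

lemma rowc_eq [simp]: "rowc R K = rowc Q N \<longleftrightarrow> R = Q \<and> K = N"
  by (cases R; cases Q) auto

lemma rowc_neq_Xc [simp]: "rowc R K \<noteq> Xc A" "Xc A \<noteq> rowc R K"
  by (cases R; simp)+

abbreviation arg_rows :: "nat \<Rightarrow> nat \<Rightarrow> nat \<Rightarrow> nat \<Rightarrow> (sindex + sindex) set" where
  "arg_rows n m r s \<equiv> indices n m <+> indices r s"

lemma finite_indices [simp]: "finite (indices n m)"
  by (simp add: indices_def)

lemma indices_Suc: "indices (n + 1) m = insert (Ev n) (indices n m)"
  by (auto simp: indices_def lessThan_Suc)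

lemma Ev_notin_indices [simp]: "Ev n \<notin> indices n m"
  by (auto simp: indices_def)

lemma mcoords_eq: "mcoords n m r s p q = xcoords n m \<union> (\<lambda>(R, K). rowc R K) ` (arg_rows n m r s \<times> indices p q)"
  unfolding mcoords_def by (force simp: image_def)

lemma rowc_in_mcoords: "R \<in> arg_rows n m r s \<Longrightarrow> K \<in> indices p q \<Longrightarrow> rowc R K \<in> mcoords n m r s p q"
  unfolding mcoords_eq by auto

lemma finite_mcoords: "finite (mcoords n m r s p q)"
  unfolding mcoords_eq xcoords_def by (intro finite_UnI finite_imageI finite_cartesian_product finite_Plus) simp_all

lemma mcoords_mono: "mcoords n m r s p q \<subseteq> mcoords n m (r + 1) s (p + 1) q"
  unfolding mcoords_def indices_Suc by blast

lemma sum_mcoords: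
  fixes f :: "coord \<Rightarrow> 'b::comm_monoid_add"
  assumes "\<And>A. f (Xc A) = 0"
  shows "(\<Sum>c\<in>mcoords n m r s p q. f c) = (\<Sum>R\<in>arg_rows n m r s. \<Sum>K\<in>indices p q. f (rowc R K))"
proof -
  have inj: "inj_on (\<lambda>(R, K). rowc R K) (arg_rows n m r s \<times> indices p q)" by (auto simp: inj_on_def)
  have "(\<Sum>c\<in>mcoords n m r s p q. f c) = (\<Sum>c\<in>(\<lambda>(R, K). rowc R K) ` (arg_rows n m r s \<times> indices p q). f c)"
    by (rule sum.mono_neutral_right[OF finite_mcoords])
       (auto simp: mcoords_eq xcoords_def assms)
  also have "\<dots> = (\<Sum>R\<in>arg_rows n m r s. \<Sum>K\<in>indices p q. f (rowc R K))"
    unfolding sum.reindex[OF inj] by (simp add: sum.cartesian_product case_prod_unfold comp_def)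
  finally show ?thesis .
qed

lemma local_mixed_form_superfun:
  "local_mixed_form n m r s p q U L \<Longrightarrow> superfun (mcoords n m r s p q) (mdom n m s q U) L"
  by (simp add: local_mixed_form_def)

text \<open>Merges the row equations into one statement about arbitrary rows of \<open>p\<close>
  over \<open>w\<close>.\<close>

lemma row_exchange:
  assumes L: "local_mixed_form n m r s p q U L" and U: "openin (Euclidean_space n) U"
    and v: "v \<in> mdom n m s q U"
    and R: "R \<in> arg_rows n m r s" "Q \<in> arg_rows n m r s" and K: "K \<in> indices p q" "N \<in> indices p q"
  shows "pd (rowc R K) (pd (rowc Q N) L) v =
     - sg (rpar R * rpar Q + (rpar R + rpar Q) * par N) *\<^sub>R pd (rowc Q K) (pd (rowc R N) L) v"
proof -
  let ?D = "mdom n m s q U"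
  have sm: "smooth_sfun ?D L" by (rule superfun_smooth[OF local_mixed_form_superfun[OF L]])
  have D: "open ?D" by (rule open_mdom[OF U])
  have P: "pd (Pc A K) (pd (Pc B N) L) v = - sg (par A * par B + (par A + par B) * par N) *\<^sub>R pd (Pc B K) (pd (Pc A N) L) v"
    if "A \<in> indices n m" "B \<in> indices n m" "K \<in> indices p q" "N \<in> indices p q" for A B K N
  proof -
    have "row_eq p q ?D L (Pc A) (par A) (Pc B) (par B)"
      using L that(1,2) unfolding local_mixed_form_def by blast
    then have "pd (Pc A K) (pd (Pc B N) L) v
        + (-1) ^ (par A * par B + (par A + par B) * par N) * pd (Pc B K) (pd (Pc A N) L) v = 0"
      using v that(3,4) unfolding row_eq_def by blast
    then show ?thesis by (simp add: add_eq_0_iff2)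
  qed
  have PW: "pd (Pc A K) (pd (Wc F N) L) v = - sg (par A * par F + (par A + par F) * par N) *\<^sub>R pd (Wc F K) (pd (Pc A N) L) v"
    if "A \<in> indices n m" "F \<in> indices r s" "K \<in> indices p q" "N \<in> indices p q" for A F K N
  proof -
    have "row_eq p q ?D L (Pc A) (par A) (Wc F) (par F)"
      using L that(1,2) unfolding local_mixed_form_def by blast
    then have "pd (Pc A K) (pd (Wc F N) L) v
        + (-1) ^ (par A * par F + (par A + par F) * par N) * pd (Wc F K) (pd (Pc A N) L) v = 0"
      using v that(3,4) unfolding row_eq_def by blast
    then show ?thesis by (simp add: add_eq_0_iff2)
  qed
  have W: "pd (Wc F K) (pd (Wc G N) L) v = - sg (par F * par G + (par F + par G) * par N) *\<^sub>R pd (Wc G K) (pd (Wc F N) L) v"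
    if "F \<in> indices r s" "G \<in> indices r s" "K \<in> indices p q" "N \<in> indices p q" for F G K N
  proof -
    have "row_eq p q ?D L (Wc F) (par F) (Wc G) (par G)"
      using L that(1,2) unfolding local_mixed_form_def by blast
    then have "pd (Wc F K) (pd (Wc G N) L) v
        + (-1) ^ (par F * par G + (par F + par G) * par N) * pd (Wc G K) (pd (Wc F N) L) v = 0"
      using v that(3,4) unfolding row_eq_def by blast
    then show ?thesis by (simp add: add_eq_0_iff2)
  qed
  \<comment> \<open>This order of the rows is not among the defining equations. It follows from the
    opposite order by commuting the derivatives before and after.\<close>
  have WP: "pd (Wc F K) (pd (Pc A N) L) v = - sg (par F * par A + (par F + par A) * par N) *\<^sub>R pd (Pc A K) (pd (Wc F N) L) v"
    if "A \<in> indices n m" "F \<in> indices r s" for A F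
  proof -
    let ?x = "pd (Wc F K) (pd (Pc A N) L) v" and ?y = "pd (Pc A K) (pd (Wc F N) L) v"
    have "?x = sg ((par F + par K) * (par A + par N)) *\<^sub>R pd (Pc A N) (pd (Wc F K) L) v"
      using pd_commute[OF D sm v, of "Wc F K" "Pc A N"] by simp
    also have "pd (Pc A N) (pd (Wc F K) L) v = - sg (par A * par F + (par A + par F) * par K) *\<^sub>R pd (Wc F N) (pd (Pc A K) L) v"
      by (rule PW[OF that K(2,1)])
    also have "pd (Wc F N) (pd (Pc A K) L) v = sg ((par F + par N) * (par A + par K)) *\<^sub>R ?y"
      using pd_commute[OF D sm v, of "Wc F N" "Pc A K"] by simp
    finally have "?x = - sg ((par F + par K) * (par A + par N) + (par A * par F + (par A + par F) * par K)
        + (par F + par N) * (par A + par K)) *\<^sub>R ?y"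
      by (simp add: power_add)
    also have "(-1::real) ^ ((par F + par K) * (par A + par N) + (par A * par F + (par A + par F) * par K)
        + (par F + par N) * (par A + par K)) = (-1) ^ (par F * par A + (par F + par A) * par N)"
      by (rule minus_one_power_cong) auto
    finally show ?thesis .
  qed
  show ?thesis
    by (insert R, (elim PlusE; (hypsubst)+; unfold rowc.simps rpar.simps;
          rule P PW W WP; (assumption | rule K)))
qed


section \<open>An explicit formula for the stability isomorphism\<close>

text \<open>With the row \<open>R\<^sub>0\<close> of \<open>w\<close> this is the stability isomorphism, with \<open>R\<^sub>0\<close> a row of \<open>p\<close> the coefficient
  of \<open>X\<^sup>A\<close> in \<open>e(X)\<close>.\<close>
definition adjoin :: "nat \<Rightarrow> (sindex + sindex) set \<Rightarrow> sindex set \<Rightarrow> sindex + sindex \<Rightarrow> sfun \<Rightarrow> sfun" where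
  "adjoin p Rs Ks R\<^sub>0 L v = var (rowc R\<^sub>0 (Ev p)) v * L v
     - (\<Sum>R\<in>Rs. \<Sum>K\<in>Ks. sg (rpar R * par K) *\<^sub>R
          (var (rowc R\<^sub>0 K) v * (var (rowc R (Ev p)) v * pd (rowc R K) L v)))"

section \<open>Closure properties of superfunctions\<close>

lemma superfun_mono:
  assumes "superfun C D F" "C \<subseteq> C'" shows "superfun C' D F"
  unfolding superfun_def
proof (intro conjI ballI allI impI)
  fix v v' assume "v \<in> D" "\<forall>c\<in>C'. even (cpar c) \<longrightarrow> v c = v' c"
  then show "F v = F v'" using assms(2) by (intro superfun_eq[OF assms(1)]) auto
next
  fix v assume "v \<in> D"
  then have "gens_in {c \<in> C. odd (cpar c)} (F v)" using assms(1) by (simp add: superfun_def)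
  then show "gens_in {c \<in> C'. odd (cpar c)} (F v)" by (rule gens_in_mono) (use assms(2) in auto)
next
  fix I show "smooth_on D (\<lambda>v. coeff (F v) I)" using assms(1) by (simp add: superfun_def)
qed

lemma superfun_pointwise:
  assumes "superfun C D F" "superfun C D G" "smooth_sfun D (\<lambda>v. h (F v) (G v))"
    and "\<And>N a b. gens_in N a \<Longrightarrow> gens_in N b \<Longrightarrow> gens_in N (h a b)"
  shows "superfun C D (\<lambda>v. h (F v) (G v))"
  unfolding superfun_def
proof (intro conjI ballI allI impI)
  fix v v' assume "v \<in> D" "\<forall>c\<in>C. even (cpar c) \<longrightarrow> v c = v' c"
  then have "F v = F v'" "G v = G v'"
    by (auto intro!: superfun_eq[OF assms(1)] superfun_eq[OF assms(2)])
  then show "h (F v) (G v) = h (F v') (G v')" by simp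
next
  fix v assume "v \<in> D"
  then show "gens_in {c \<in> C. odd (cpar c)} (h (F v) (G v))"
    using assms(1,2) by (intro assms(4)) (simp_all add: superfun_def)
next
  fix I show "smooth_on D (\<lambda>v. coeff (h (F v) (G v)) I)"
    using assms(3) by (simp add: smooth_sfun_def)
qed

lemma superfun_scaleR: "open D \<Longrightarrow> superfun C D F \<Longrightarrow> superfun C D (\<lambda>v. k *\<^sub>R F v)"
  by (rule superfun_pointwise[where G = F and h = "\<lambda>a b. k *\<^sub>R a"])
     (auto intro: smooth_sfun_scaleR superfun_smooth gens_in_scaleR)

lemma superfun_add: "open D \<Longrightarrow> superfun C D F \<Longrightarrow> superfun C D G \<Longrightarrow> superfun C D (\<lambda>v. F v + G v)"
  by (rule superfun_pointwise) (auto intro: smooth_sfun_add superfun_smooth gens_in_add)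

lemma superfun_diff: "open D \<Longrightarrow> superfun C D F \<Longrightarrow> superfun C D G \<Longrightarrow> superfun C D (\<lambda>v. F v - G v)"
  by (rule superfun_pointwise) (auto intro: smooth_sfun_diff superfun_smooth gens_in_diff)

lemma superfun_mult: "open D \<Longrightarrow> superfun C D F \<Longrightarrow> superfun C D G \<Longrightarrow> superfun C D (\<lambda>v. F v * G v)"
  by (rule superfun_pointwise) (auto intro: smooth_sfun_mult superfun_smooth gens_in_times)

lemma superfun_zero: "open D \<Longrightarrow> superfun C D (\<lambda>v. 0)"
  by (simp add: superfun_def smooth_on_const)

lemma superfun_sum:
  "open D \<Longrightarrow> (\<And>i. i \<in> A \<Longrightarrow> superfun C D (F i)) \<Longrightarrow> superfun C D (\<lambda>v. \<Sum>i\<in>A. F i v)"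
  by (induction A rule: infinite_finite_induct) (auto intro: superfun_zero superfun_add)

lemma superfun_var: "open D \<Longrightarrow> c \<in> C \<Longrightarrow> superfun C D (var c)"
  using smooth_sfun_var[of D c] unfolding superfun_def smooth_sfun_def
  by (auto simp: var_def intro: gens_in_gen)

lemma superfun_adjoin:
  assumes "open D" "superfun C D L" "rowc R\<^sub>0 (Ev p) \<in> C" "\<And>K. K \<in> Ks \<Longrightarrow> rowc R\<^sub>0 K \<in> C"
    "\<And>R. R \<in> Rs \<Longrightarrow> rowc R (Ev p) \<in> C"
  shows "superfun C D (adjoin p Rs Ks R\<^sub>0 L)"
  unfolding adjoin_def[abs_def]
  by (intro superfun_diff superfun_mult superfun_scaleR superfun_sum superfun_var superfun_pd assms)

lemma eq_minus_imp_zero: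
  fixes x :: "'a::real_vector"
  assumes "x = - x" shows "x = 0"
proof -
  have "2 *\<^sub>R x = x + x" by (rule scaleR_2)
  also have "\<dots> = x + - x" by (rule arg_cong[OF assms])
  finally show ?thesis by simp
qed

text \<open>The argument of \<open>L\<close> in the definition of \<sigma> differs from the point
  \<open>v\<close> by the new column times the new row divided by the corner entry. Along this
  direction \<open>L\<close> is affine, so the value is \<open>L\<close> minus one first derivative;
  multiplying by the corner entry, which is the Berezinian, clears the denominator.\<close>

lemma adjoin_eq_sfeval:
  assumes L: "local_mixed_form n m r s p q U L" and U: "openin (Euclidean_space n) U"
    and v: "v \<in> mdom n m s q U" and t: "v (Wc (Ev r) (Ev p)) \<noteq> 0"
    and z: "\<And>A. z (Xc A) = var (Xc A) v"
      "\<And>R K. z (rowc R K) = var (rowc R K) v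
         - var (rowc R (Ev p)) v * ((1 / v (Wc (Ev r) (Ev p))) *\<^sub>R var (Wc (Ev r) K) v)"
  shows "sfeval L z * of_real (v (Wc (Ev r) (Ev p))) = adjoin p (arg_rows n m r s) (indices p q) (Inr (Ev r)) L v"
proof -
  let ?C = "mcoords n m r s p q" and ?D = "mdom n m s q U" and ?t = "v (Wc (Ev r) (Ev p))"
  define y where "y R = var (rowc R (Ev p)) v" for R
  define u where "u K = (1 / ?t) *\<^sub>R var (Wc (Ev r) K) v" for K
  define nn where "nn c = var c v - z c" for c
  have nX: "nn (Xc A) = 0" for A by (simp add: nn_def z)
  have nR: "nn (rowc R K) = y R * u K" for R K by (simp add: nn_def z y_def u_def)
  have hy: "homog (rpar R) (y R)" for R using homog_var[of "rowc R (Ev p)" v] by (simp add: y_def)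
  have hu: "homog (par K) (u K)" for K using homog_var[of "Wc (Ev r) K" v] by (simp add: u_def homog_scaleR)
  note D = open_mdom[OF U, of m s q]
  note F = local_mixed_form_superfun[OF L]
  \<comment> \<open>The direction involves entries of the new row and column, so its generators come
    from the variables of the larger form.\<close>
  let ?N = "mcoords n m (r + 1) s (p + 1) q"
  have gvar: "gens_in ?N (var c v)" if "c \<in> ?N" for c
    using that by (auto simp: var_def intro: gens_in_gen)
  have cases: "(\<exists>A. c = Xc A) \<or> (\<exists>R\<in>arg_rows n m r s. \<exists>K\<in>indices p q. c = rowc R K)" if "c \<in> ?C" for c
    using that unfolding mcoords_eq xcoords_def by auto
  have r_in: "Inr (Ev r) \<in> arg_rows n m (r + 1) s" "\<And>R. R \<in> arg_rows n m r s \<Longrightarrow> R \<in> arg_rows n m (r + 1) s"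
    "Ev p \<in> indices (p + 1) q" "\<And>K. K \<in> indices p q \<Longrightarrow> K \<in> indices (p + 1) q"
    unfolding indices_Suc by auto
  interpret superline ?C ?D v nn ?N
  proof
    fix c assume c: "c \<in> ?C"
    show "homog (cpar c) (nn c)"
      using cases[OF c] homog_times[OF hy hu]
      by (elim disjE exE bexE) (simp_all add: nX nR del: rpar.simps rowc.simps)
    have "gens_in ?N (y R * u K)" if "R \<in> arg_rows n m r s" "K \<in> indices p q" for R K
      unfolding y_def u_def using that r_in rowc_in_mcoords[of "Inr (Ev r)" n m "r + 1" s K "p + 1" q]
      by (intro gens_in_times gens_in_scaleR gvar rowc_in_mcoords) auto
    then show "gens_in ?N (nn c)"
      using cases[OF c] by (elim disjE exE bexE) (simp_all add: nX nR del: rpar.simps rowc.simps)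
  next
    fix \<tau> :: real
    \<comment> \<open>In an odd row the new, even column has an odd entry, without body. So the line
      moves no entry that admissibility depends on.\<close>
    have b0: "body (y R * u K) = 0" if "odd (rpar R)" for R K
      using body_homog[OF hy that] by (simp add: body_times)
    show "(\<lambda>c. body (var c v - \<tau> *\<^sub>R nn c)) \<in> ?D"
    proof (rule mdom_cong[OF _ _ _ v])
      fix a k
      show "v (Xc (Ev a)) = body (var (Xc (Ev a)) v - \<tau> *\<^sub>R nn (Xc (Ev a)))"
        by (simp add: nX var_def)
      show "v (Pc (Od a) (Od k)) = body (var (Pc (Od a) (Od k)) v - \<tau> *\<^sub>R nn (Pc (Od a) (Od k)))"
        using nR[of "Inl (Od a)" "Od k"] b0[of "Inl (Od a)" "Od k"]
        by (simp add: body_diff body_scaleR) (simp add: var_def)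
      show "v (Wc (Od a) (Od k)) = body (var (Wc (Od a) (Od k)) v - \<tau> *\<^sub>R nn (Wc (Od a) (Od k)))"
        using nR[of "Inr (Od a)" "Od k"] b0[of "Inr (Od a)" "Od k"]
        by (simp add: body_diff body_scaleR) (simp add: var_def)
    qed
  qed (simp_all add: D finite_mcoords)
  have z1: "local.z 1 = z" by (rule ext) (simp add: local.z_def nn_def)
  have second: "(\<Sum>c\<in>?C. \<Sum>d\<in>?C. nn c * (nn d * sfeval (pd d (pd c L)) (local.z \<tau>))) = 0" for \<tau>
  proof -
    let ?a = "\<lambda>R K Q N. y R * u K * (y Q * u N * sfeval (pd (rowc Q N) (pd (rowc R K) L)) (local.z \<tau>))"
    \<comment> \<open>Exchanging the rows \<open>R\<close> and \<open>Q\<close> with columns fixed: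
      reordering the four factors of the direction produces exactly the sign of the row equation
      apart from its minus.\<close>
    have anti: "?a R K Q N = - ?a Q K R N"
      if "R \<in> arg_rows n m r s" "Q \<in> arg_rows n m r s" "K \<in> indices p q" "N \<in> indices p q" for R K Q N
    proof -
      let ?s = "sfeval (pd (rowc R N) (pd (rowc Q K) L)) (local.z \<tau>)"
      have sf: "sfeval (pd (rowc Q N) (pd (rowc R K) L)) (local.z \<tau>)
          = - sg (rpar Q * rpar R + (rpar Q + rpar R) * par K) *\<^sub>R ?s"
        by (rule sfeval_scaleR[OF superfun_pd[OF D superfun_pd[OF D F]] superfun_pd[OF D superfun_pd[OF D F]]])
           (rule row_exchange[OF L U _ that(2,1,4,3)])
      have "y R * u K * (y Q * x) = sg ((rpar R + par K) * rpar Q) *\<^sub>R (y Q * (y R * u K * x))" for x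
        by (rule supercommute_left[OF homog_times[OF hy hu] hy])
      moreover have "y R * u K = sg (rpar R * par K) *\<^sub>R (u K * y R)"
        by (rule supercommute[OF hy hu])
      ultimately have "y R * u K * (y Q * u N * x)
          = sg ((rpar R + par K) * rpar Q + rpar R * par K) *\<^sub>R (y Q * u K * (y R * u N * x))" for x
        by (simp add: mult.assoc power_add)
      then have "?a R K Q N = - sg ((rpar R + par K) * rpar Q + rpar R * par K
          + (rpar Q * rpar R + (rpar Q + rpar R) * par K)) *\<^sub>R (y Q * u K * (y R * u N * ?s))"
        unfolding sf by (simp add: power_add)
      also have "(-1::real) ^ ((rpar R + par K) * rpar Q + rpar R * par K
          + (rpar Q * rpar R + (rpar Q + rpar R) * par K)) = (-1) ^ 0"
        by (rule minus_one_power_cong) auto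
      finally show ?thesis by simp
    qed
    let ?T = "\<Sum>R\<in>arg_rows n m r s. \<Sum>K\<in>indices p q. \<Sum>Q\<in>arg_rows n m r s. \<Sum>N\<in>indices p q. ?a R K Q N"
    \<comment> \<open>Renaming the two rows turns the full sum into its own negative.\<close>
    have "?T = - (\<Sum>R\<in>arg_rows n m r s. \<Sum>K\<in>indices p q. \<Sum>Q\<in>arg_rows n m r s. \<Sum>N\<in>indices p q. ?a Q K R N)"
      unfolding sum_negf[symmetric] by (intro sum.cong refl anti)
    also have "(\<Sum>R\<in>arg_rows n m r s. \<Sum>K\<in>indices p q. \<Sum>Q\<in>arg_rows n m r s. \<Sum>N\<in>indices p q. ?a Q K R N)
        = (\<Sum>K\<in>indices p q. \<Sum>R\<in>arg_rows n m r s. \<Sum>Q\<in>arg_rows n m r s. \<Sum>N\<in>indices p q. ?a Q K R N)"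
      by (rule sum.swap)
    also have "\<dots> = (\<Sum>K\<in>indices p q. \<Sum>Q\<in>arg_rows n m r s. \<Sum>R\<in>arg_rows n m r s. \<Sum>N\<in>indices p q. ?a Q K R N)"
      by (intro sum.cong refl sum.swap)
    also have "\<dots> = ?T" by (rule sum.swap)
    finally have "?T = - ?T" .
    then have "?T = 0" by (rule eq_minus_imp_zero)
    moreover have "(\<Sum>c\<in>?C. \<Sum>d\<in>?C. nn c * (nn d * sfeval (pd d (pd c L)) (local.z \<tau>))) = ?T"
      by (subst sum_mcoords, simp add: nX)
         (intro sum.cong refl, subst sum_mcoords, simp_all add: nX nR)
    ultimately show ?thesis by simp
  qed
  have "sfeval L z = L v - (\<Sum>c\<in>?C. nn c * pd c L v)"
    using sfeval_affine[OF F v second] z1 by simp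
  also have "(\<Sum>c\<in>?C. nn c * pd c L v) = (\<Sum>R\<in>arg_rows n m r s. \<Sum>K\<in>indices p q. y R * u K * pd (rowc R K) L v)"
    by (subst sum_mcoords) (simp_all add: nX nR)
  finally have "sfeval L z * of_real ?t = ?t *\<^sub>R L v
      - (\<Sum>R\<in>arg_rows n m r s. \<Sum>K\<in>indices p q. ?t *\<^sub>R (y R * u K * pd (rowc R K) L v))"
    by (simp add: of_real_def left_diff_distrib scaleR_sum_right scaleR_diff_right)
  also have "(\<Sum>R\<in>arg_rows n m r s. \<Sum>K\<in>indices p q. ?t *\<^sub>R (y R * u K * pd (rowc R K) L v))
     = (\<Sum>R\<in>arg_rows n m r s. \<Sum>K\<in>indices p q. sg (rpar R * par K) *\<^sub>R
          (var (rowc (Inr (Ev r)) K) v * (var (rowc R (Ev p)) v * pd (rowc R K) L v)))"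
  proof (intro sum.cong refl)
    fix R K
    have "?t *\<^sub>R (y R * u K) = y R * var (Wc (Ev r) K) v" using t by (simp add: u_def)
    also have "\<dots> = sg (rpar R * par K) *\<^sub>R (var (Wc (Ev r) K) v * y R)"
      using supercommute[OF hy homog_var, of R "Wc (Ev r) K"] by simp
    finally show "?t *\<^sub>R (y R * u K * pd (rowc R K) L v) = sg (rpar R * par K) *\<^sub>R
          (var (rowc (Inr (Ev r)) K) v * (var (rowc R (Ev p)) v * pd (rowc R K) L v))"
      unfolding y_def by (metis (no_types, lifting) mult.assoc mult_scaleR_left rowc.simps(2))
  qed
  finally show ?thesis by (simp add: adjoin_def var_def of_real_def)
qed

section \<open>Matrices of size 1|0 and the stability isomorphism\<close>

lemma indices_1_0: "indices 1 0 = {Ev 0}" and indices_0_0: "indices 0 0 = {}"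
  by (auto simp: indices_def)

lemma of_real_times_gr: "of_real t * (a::'g::linorder gr) = t *\<^sub>R a" "a * of_real t = t *\<^sub>R a"
  by (simp_all add: of_real_def)

lemma is_sinv_1_0:
  assumes "M (Ev 0) (Ev 0) = of_real t"
  shows "is_sinv (indices 1 0) M N \<longleftrightarrow> t \<noteq> 0 \<and> N (Ev 0) (Ev 0) = of_real (1 / t)"
proof -
  have "is_sinv (indices 1 0) M N \<longleftrightarrow> t *\<^sub>R N (Ev 0) (Ev 0) = 1"
    unfolding indices_1_0 by (simp add: is_sinv_def smul_def assms of_real_times_gr)
  also have "\<dots> \<longleftrightarrow> t \<noteq> 0 \<and> N (Ev 0) (Ev 0) = of_real (1 / t)"
  proof
    assume *: "t *\<^sub>R N (Ev 0) (Ev 0) = 1"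
    then have t: "t \<noteq> 0" by auto
    then have "N (Ev 0) (Ev 0) = (1 / t) *\<^sub>R (t *\<^sub>R N (Ev 0) (Ev 0))" by simp
    then show "t \<noteq> 0 \<and> N (Ev 0) (Ev 0) = of_real (1 / t)" using t unfolding * by (simp add: of_real_def)
  qed (auto simp: of_real_def)
  finally show ?thesis .
qed

lemma sinvertible_1_0:
  assumes "M (Ev 0) (Ev 0) = of_real t"
  shows "sinvertible (indices 1 0) M \<longleftrightarrow> t \<noteq> 0"
  unfolding sinvertible_def is_sinv_1_0[of M t, OF assms] by auto

lemma sinv_1_0:
  assumes "M (Ev 0) (Ev 0) = of_real t" "t \<noteq> 0"
  shows "sinv (indices 1 0) M (Ev 0) (Ev 0) = of_real (1 / t)"
proof -
  have "sinv (indices 1 0) M = (\<lambda>F K. if F = Ev 0 \<and> K = Ev 0 then of_real (1 / t) else 0)"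
    unfolding sinv_def is_sinv_1_0[of M t, OF assms(1)] unfolding indices_1_0
    by (rule the_equality) (use assms(2) in \<open>auto simp: fun_eq_iff\<close>)
  then show ?thesis by simp
qed

lemma Ber_1_0: "Ber 1 0 M = M (Ev 0) (Ev 0)"
proof -
  have "{\<pi>. \<pi> permutes {..<1::nat}} = {id}" by (simp add: lessThan_Suc)
  then show ?thesis
    by (simp add: Ber_def Let_def smul_def indices_0_0 block_det_def)
qed

text \<open>The explicit formula is polynomial in the new row and column, hence a superfunction on
  all of \<open>D\<close>, and by \<open>adjoin_eq_sfeval\<close> it satisfies the description
  wherever the corner entry is nonzero. Any other solution agrees with it there and, by continuity
  in that entry, also at its zeros.\<close>

lemma stab_1_0_eq:
  assumes L: "local_mixed_form (edim M) (odim M) r s p q (cmap M i ` cdom M i) (L i)"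
    and U: "openin (Euclidean_space (edim M)) (cmap M i ` cdom M i)"
    and v: "v \<in> mdom (edim M) (odim M) s q (cmap M i ` cdom M i)"
  shows "stab 1 0 M r s p q L i v =
     adjoin p (arg_rows (edim M) (odim M) r s) (indices p q) (Inr (Ev r)) (L i) v"
proof -
  let ?n = "edim M" and ?m = "odim M"
  let ?D = "mdom ?n ?m s q (cmap M i ` cdom M i)" and ?C = "mcoords ?n ?m (r + 1) s (p + 1) q"
  let ?A = "adjoin p (arg_rows ?n ?m r s) (indices p q) (Inr (Ev r)) (L i)"
  let ?c = "Wc (Ev r) (Ev p)"
  note D = open_mdom[OF U, of ?m s q]
  \<comment> \<open>These abbreviations follow the local bindings of \<open>stab\<close>, so that
    its description unfolds to \<open>is_stab\<close>.\<close>
  define w22 where "w22 v = (\<lambda>F K. var (Wc (shift r s F) (shift p q K)) v)" for v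
  define u where "u v = smul (indices 1 0) (sinv (indices 1 0) (w22 v)) (\<lambda>F K. var (Wc (shift r s F) K) v)" for v
  define z where "z v = point (\<lambda>A. var (Xc A) v)
      (\<lambda>A K. var (Pc A K) v - smul (indices 1 0) (\<lambda>A K. var (Pc A (shift p q K)) v) (u v) A K)
      (\<lambda>F K. var (Wc F K) v - smul (indices 1 0) (\<lambda>F K. var (Wc F (shift p q K)) v) (u v) F K)" for v
  have w22: "w22 v (Ev 0) (Ev 0) = of_real (v ?c)" for v
    by (simp add: w22_def var_def)
  have inv: "sinvertible (indices 1 0) (w22 v) \<longleftrightarrow> v ?c \<noteq> 0" for v
    by (rule sinvertible_1_0[of "w22 v" "v ?c", OF w22])
  have val: "sfeval (L i) (z v) * Ber 1 0 (w22 v) = ?A v" if "v \<in> ?D" "v ?c \<noteq> 0" for v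
    unfolding Ber_1_0 w22
  proof (rule adjoin_eq_sfeval[OF L U that])
    fix R K
    have "u v (Ev 0) K = (1 / v ?c) *\<^sub>R var (Wc (Ev r) K) v"
      using sinv_1_0[of "w22 v" "v ?c", OF w22 that(2)] unfolding u_def smul_def indices_1_0
      by (simp add: of_real_times_gr del: of_real_divide)
    then show "z v (rowc R K) = var (rowc R K) v - var (rowc R (Ev p)) v * ((1 / v ?c) *\<^sub>R var (Wc (Ev r) K) v)"
      unfolding z_def smul_def indices_1_0 by (cases R) simp_all
  qed (simp add: z_def)
  define is_stab where "is_stab S \<longleftrightarrow> superfun ?C ?D S \<and> (\<forall>v. v \<notin> ?D \<longrightarrow> S v = 0) \<and>
      (\<forall>v\<in>?D. sinvertible (indices 1 0) (w22 v) \<longrightarrow> S v = sfeval (L i) (z v) * Ber 1 0 (w22 v))" for S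
  have stab: "stab 1 0 M r s p q L i = (THE S. is_stab S)"
    unfolding stab_def is_stab_def z_def u_def w22_def Let_def by (simp only: add_0_right)
  have in_D: "v' \<in> ?D" if "v \<in> ?D" "\<And>c. c \<in> ?C \<Longrightarrow> even (cpar c) \<Longrightarrow> c \<noteq> ?c \<Longrightarrow> v c = v' c" for v v'
    by (rule mdom_cong[OF _ _ _ that(1)]; rule that(2))
       (auto simp: mcoords_def xcoords_def indices_def)
  have sA: "superfun ?C ?D ?A"
  proof (rule superfun_adjoin[OF D superfun_mono[OF local_mixed_form_superfun[OF L] mcoords_mono]])
    show "rowc (Inr (Ev r)) (Ev p) \<in> ?C" by (rule rowc_in_mcoords) (auto simp: indices_def)
    show "rowc (Inr (Ev r)) K \<in> ?C" if "K \<in> indices p q" for K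
      by (rule rowc_in_mcoords) (use that in \<open>auto simp: indices_def\<close>)
    show "rowc R (Ev p) \<in> ?C" if "R \<in> arg_rows ?n ?m r s" for R
      by (rule rowc_in_mcoords) (use that in \<open>auto simp: indices_def\<close>)
  qed
  \<comment> \<open>Zero outside \<open>D\<close> is the normalization in \<open>stab\<close>; it
    makes the described function unique.\<close>
  define S where "S v = (if v \<in> ?D then ?A v else 0)" for v
  have "is_stab S"
    unfolding is_stab_def
  proof (intro conjI allI ballI impI)
    show "superfun ?C ?D S"
      unfolding superfun_def
    proof (intro conjI ballI allI impI)
      fix v v' assume v: "v \<in> ?D" "\<forall>c\<in>?C. even (cpar c) \<longrightarrow> v c = v' c"
      then have "v' \<in> ?D" by (intro in_D[OF v(1)]) auto
      moreover have "?A v = ?A v'" using v(2) by (intro superfun_eq[OF sA v(1)]) auto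
      ultimately show "S v = S v'" using v(1) by (simp add: S_def)
    next
      fix v assume "v \<in> ?D"
      then show "gens_in {c \<in> ?C. odd (cpar c)} (S v)" using sA by (simp add: S_def superfun_def)
    next
      fix I
      have "smooth_sfun ?D S" by (rule smooth_sfun_cong[OF D superfun_smooth[OF sA]]) (simp add: S_def)
      then show "smooth_on ?D (\<lambda>v. coeff (S v) I)" by (simp add: smooth_sfun_def)
    qed
  qed (auto simp: S_def inv val simp del: One_nat_def)
  moreover have "T = S" if T: "is_stab T" for T
  proof
    fix v
    show "T v = S v"
    proof (cases "v \<in> ?D")
      case True
      have nz: "T v = ?A v" if "v \<in> ?D" "v ?c \<noteq> 0" for v
        using T that by (simp add: is_stab_def inv val del: One_nat_def)
      show ?thesis
      proof (cases "v ?c = 0")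
        case False
        then show ?thesis using nz[OF True] True by (simp add: S_def)
      next
        case zero: True
        \<comment> \<open>The corner entry is unrestricted, so \<open>v\<close> can be approached
          through points with nonzero corner entry.\<close>
        have mem: "v(?c := t) \<in> ?D" for t by (rule in_D[OF True]) auto
        have "T v = ?A v"
        proof (rule gr_eqI)
          fix J :: "coord set"
          have cont: "((\<lambda>t. coeff (F (v(?c := t))) J) \<longlongrightarrow> coeff (F v) J) (at 0)" if "superfun ?C ?D F" for F
          proof -
            have "((\<lambda>t. coeff (F (v(?c := t))) J) has_real_derivative coeff (pd ?c F v) J) (at (v ?c))"
              by (rule coeff_has_derivative[OF superfun_smooth[OF that] True]) simp
            then have "isCont (\<lambda>t. coeff (F (v(?c := t))) J) (v ?c)" by (rule DERIV_isCont)
            then show ?thesis using zero fun_upd_triv[of v ?c] by (simp add: isCont_def)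
          qed
          have "superfun ?C ?D T" using T by (simp add: is_stab_def)
          from cont[OF this] have "((\<lambda>t. coeff (?A (v(?c := t))) J) \<longlongrightarrow> coeff (T v) J) (at 0)"
          proof (rule Lim_transform_eventually)
            show "\<forall>\<^sub>F t in at 0. coeff (T (v(?c := t))) J = coeff (?A (v(?c := t))) J"
              unfolding eventually_at_filter
              by (rule always_eventually) (simp add: nz[OF mem])
          qed
          with cont[OF sA] show "coeff (T v) J = coeff (?A v) J"
            using tendsto_unique[OF trivial_limit_at] by blast
        qed
        then show ?thesis using True by (simp add: S_def)
      qed
    qed (use T in \<open>simp add: is_stab_def S_def\<close>)
  qed
  ultimately have "stab 1 0 M r s p q L i = S"
    unfolding stab by (rule the_equality)
  then show ?thesis using v by (simp add: S_def)
qed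


section \<open>Derivatives of the operators\<close>

text \<open>A relational form of the derivative that carries smoothness along, so that derivatives
  of nested expressions are assembled by composing rules.\<close>

definition has_pd :: "(coord \<Rightarrow> real) set \<Rightarrow> coord \<Rightarrow> sfun \<Rightarrow> sfun \<Rightarrow> bool" where
  "has_pd D c F F' \<longleftrightarrow> smooth_sfun D F \<and> (\<forall>v\<in>D. pd c F v = F' v)"

lemma has_pdD: "has_pd D c F F' \<Longrightarrow> v \<in> D \<Longrightarrow> pd c F v = F' v"
  by (simp add: has_pd_def)

lemma has_pd_smooth: "smooth_sfun D F \<Longrightarrow> has_pd D c F (pd c F)"
  by (simp add: has_pd_def)

lemma has_pd_zero: "smooth_sfun D F \<Longrightarrow> (\<And>v. v \<in> D \<Longrightarrow> pd c F v = 0) \<Longrightarrow> has_pd D c F (\<lambda>v. 0)"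
  by (simp add: has_pd_def)

lemma has_pd_cong:
  assumes "open D" "has_pd D c F F'" "\<And>v. v \<in> D \<Longrightarrow> G v = F v" "\<And>v. v \<in> D \<Longrightarrow> F' v = G' v"
  shows "has_pd D c G G'"
proof -
  have "pd c G v = G' v" if "v \<in> D" for v
    using pd_cong[OF assms(1,3) that, where c = c] assms(2,4) that by (simp add: has_pd_def)
  then show ?thesis using smooth_sfun_cong[OF assms(1) _ assms(3)] assms(2) by (simp add: has_pd_def)
qed

lemma has_pd_add:
  "open D \<Longrightarrow> has_pd D c F F' \<Longrightarrow> has_pd D c G G' \<Longrightarrow> has_pd D c (\<lambda>v. F v + G v) (\<lambda>v. F' v + G' v)"
  by (auto simp: has_pd_def intro: smooth_sfun_add simp: pd_add[of D F G])

lemma has_pd_diff: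
  "open D \<Longrightarrow> has_pd D c F F' \<Longrightarrow> has_pd D c G G' \<Longrightarrow> has_pd D c (\<lambda>v. F v - G v) (\<lambda>v. F' v - G' v)"
  by (auto simp: has_pd_def intro: smooth_sfun_diff simp: pd_diff[of D F G])

lemma has_pd_scaleR:
  "open D \<Longrightarrow> has_pd D c F F' \<Longrightarrow> has_pd D c (\<lambda>v. k *\<^sub>R F v) (\<lambda>v. k *\<^sub>R F' v)"
  by (auto simp: has_pd_def intro: smooth_sfun_scaleR simp: pd_scaleR[of D F])

lemma has_pd_sum:
  "open D \<Longrightarrow> (\<And>i. i \<in> A \<Longrightarrow> has_pd D c (F i) (F' i)) \<Longrightarrow>
     has_pd D c (\<lambda>v. \<Sum>i\<in>A. F i v) (\<lambda>v. \<Sum>i\<in>A. F' i v)"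
  by (auto simp: has_pd_def intro: smooth_sfun_sum simp: pd_sum[of D A F])

lemma has_pd_mult:
  "open D \<Longrightarrow> has_pd D c F F' \<Longrightarrow> (\<And>v. v \<in> D \<Longrightarrow> homog a (F v)) \<Longrightarrow> has_pd D c G G' \<Longrightarrow>
     has_pd D c (\<lambda>v. F v * G v) (\<lambda>v. F' v * G v + sg (cpar c * a) *\<^sub>R (F v * G' v))"
  by (auto simp: has_pd_def intro: smooth_sfun_mult simp: pd_mult[of D F G _ a])

lemma has_pd_mult_const:
  assumes "open D" "smooth_sfun D F" "\<And>v. v \<in> D \<Longrightarrow> pd c F v = 0" "\<And>v. v \<in> D \<Longrightarrow> homog a (F v)" "has_pd D c G G'"
  shows "has_pd D c (\<lambda>v. F v * G v) (\<lambda>v. sg (cpar c * a) *\<^sub>R (F v * G' v))"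
  using has_pd_mult[OF assms(1) has_pd_zero[OF assms(2,3)] assms(4,5)] by simp

lemma has_pd_var_mult:
  assumes "open D" "has_pd D c G G'"
  shows "has_pd D c (\<lambda>v. var d v * G v)
     (\<lambda>v. (if c = d then G v else 0) + sg (cpar c * cpar d) *\<^sub>R (var d v * G' v))"
proof -
  have "has_pd D c (var d) (\<lambda>v. if c = d then 1 else 0)"
    using assms(1) by (simp add: has_pd_def smooth_sfun_var pd_var)
  from has_pd_mult[OF assms(1) this homog_var assms(2)]
  show ?thesis by (rule has_pd_cong[OF assms(1)]) auto
qed

text \<open>Expanded once for an arbitrary coordinate \<open>c\<close>; derivatives by
  \<open>x\<close>, by an old entry of \<open>p\<close> and by the new column are instances in which
  most cases drop out.\<close>

lemma has_pd_adjoin: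
  assumes D: "open D" and L: "smooth_sfun D L"
  shows "has_pd D c (adjoin p Rs Ks R\<^sub>0 L) (\<lambda>v.
     ((if c = rowc R\<^sub>0 (Ev p) then L v else 0) + sg (cpar c * rpar R\<^sub>0) *\<^sub>R (var (rowc R\<^sub>0 (Ev p)) v * pd c L v))
     - (\<Sum>R\<in>Rs. \<Sum>K\<in>Ks. sg (rpar R * par K) *\<^sub>R
         ((if c = rowc R\<^sub>0 K then var (rowc R (Ev p)) v * pd (rowc R K) L v else 0)
          + sg (cpar c * (rpar R\<^sub>0 + par K)) *\<^sub>R (var (rowc R\<^sub>0 K) v *
             ((if c = rowc R (Ev p) then pd (rowc R K) L v else 0)
              + sg (cpar c * rpar R) *\<^sub>R (var (rowc R (Ev p)) v * pd c (pd (rowc R K) L) v))))))"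
  unfolding adjoin_def[abs_def]
  by (rule has_pd_cong[OF D has_pd_diff[OF D has_pd_var_mult[OF D has_pd_smooth[OF L]]
        has_pd_sum[OF D has_pd_sum[OF D has_pd_scaleR[OF D has_pd_var_mult[OF D has_pd_var_mult[OF D
          has_pd_smooth[OF smooth_sfun_pd[OF D L]]]]]]]]])
     (rule refl, unfold cpar_rowc par.simps add_0_right, rule refl)

section \<open>Derivatives of the operators in one chart\<close>

declare rowc.simps [simp del]

lemma rowc_Pc: "Pc A K = rowc (Inl A) K" and rowc_Wc: "Wc F K = rowc (Inr F) K"
  by (simp_all add: rowc.simps)

lemma sum_if_left: "(\<Sum>J\<in>A. if P then f J else 0) = (if P then \<Sum>J\<in>A. f J else (0::'b::comm_monoid_add))"
  by simp

text \<open>The field is homogeneous of parity \<open>e\<close> here, so that its components can be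
  moved past variables and derivatives at the cost of a sign. Parity is asked for at every point
  because \<open>hpart\<close> supplies it everywhere.\<close>

locale form_chart =
  fixes n m r s p q :: nat and U :: "(nat \<Rightarrow> real) set" and L :: sfun
    and X :: "sindex \<Rightarrow> sfun" and e :: nat
  assumes L: "local_mixed_form n m r s p q U L"
    and U: "openin (Euclidean_space n) U"
    and X: "\<And>A. A \<in> indices n m \<Longrightarrow> superfun (xcoords n m) (xdom n U) (X A)"
    and homog_X: "\<And>A v. homog (e + par A) (X A v)"
begin

abbreviation D where "D \<equiv> mdom n m s q U"
abbreviation I where "I \<equiv> indices n m"
abbreviation Rs where "Rs \<equiv> arg_rows n m r s"
abbreviation Ks where "Ks \<equiv> indices p q"
abbreviation y where "y R K \<equiv> var (rowc R K)"
abbreviation y' where "y' R \<equiv> var (rowc R (Ev p))"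
abbreviation d where "d R K \<equiv> pd (rowc R K) L"
abbreviation S where "S \<equiv> adjoin p Rs Ks (Inr (Ev r)) L"
abbreviation dx where "dx A \<equiv> pd (Xc A)"
abbreviation dp where "dp A K \<equiv> pd (rowc (Inl A) K)"

lemma D: "open D" by (rule open_mdom[OF U])

lemma smooth_L: "smooth_sfun D L"
  by (rule superfun_smooth[OF local_mixed_form_superfun[OF L]])

lemma smooth_X: "A \<in> I \<Longrightarrow> smooth_sfun D (X A)"
  by (rule smooth_sfun_subset[OF superfun_smooth[OF X] mdom_subset_xdom])

lemma smooth_adjoin: "smooth_sfun D (adjoin p Rs Ks R L)"
  using has_pd_adjoin[OF D smooth_L] by (auto simp: has_pd_def)

lemma pd_X_row: "A \<in> I \<Longrightarrow> v \<in> D \<Longrightarrow> pd (rowc R K) (X A) v = 0"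
  by (rule superfun_pd_eq_0[OF open_xdom[OF U] X])
     (auto simp: xcoords_def dest: subsetD[OF mdom_subset_xdom])

lemma homog_dX: "A \<in> I \<Longrightarrow> v \<in> D \<Longrightarrow> homog (par B + (e + par A)) (dx B (X A) v)"
  using homog_pd[OF D homog_X, of v "Xc B" A] by simp

lemma homog_y: "homog (rpar R + par K) (y R K v)"
  using homog_var[of "rowc R K" v] by simp

lemma homog_y': "homog (rpar R) (y' R v)"
  using homog_y[of R "Ev p" v] by simp

lemma pd_extra_L: "rowc R K \<notin> mcoords n m r s p q \<Longrightarrow> superfun (mcoords n m r s p q) D F \<Longrightarrow> v \<in> D \<Longrightarrow> pd (rowc R K) F v = 0"
  using superfun_pd_eq_0[OF D] by blast

lemma rowc_notin: "rowc R (Ev p) \<notin> mcoords n m r s p q" "rowc (Inr (Ev r)) K \<notin> mcoords n m r s p q"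
  unfolding mcoords_eq xcoords_def by auto

lemmas sf_L = local_mixed_form_superfun[OF L]
lemmas sf_d = superfun_pd[OF D sf_L]

lemma Ks_neq: "K \<in> Ks \<Longrightarrow> K \<noteq> Ev p" by auto

lemma has_pd_X_mult:
  assumes "A \<in> I" "has_pd D (Xc B) G G'"
  shows "has_pd D (Xc B) (\<lambda>v. X A v * G v)
     (\<lambda>v. dx B (X A) v * G v + sg (par B * (e + par A)) *\<^sub>R (X A v * G' v))"
  using has_pd_mult[OF D has_pd_smooth[OF smooth_X[OF assms(1)]] homog_X assms(2)] by simp

lemma has_pd_row_X_mult:
  assumes "A \<in> I" "has_pd D (rowc R K) G G'"
  shows "has_pd D (rowc R K) (\<lambda>v. X A v * G v)
     (\<lambda>v. sg ((rpar R + par K) * (e + par A)) *\<^sub>R (X A v * G' v))"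
  using has_pd_mult_const[OF D smooth_X[OF assms(1)] pd_X_row[OF assms(1)] homog_X assms(2)] by simp

lemma has_pd_x_var_mult:
  assumes "has_pd D (Xc B) G G'"
  shows "has_pd D (Xc B) (\<lambda>v. y R K v * G v) (\<lambda>v. sg (par B * (rpar R + par K)) *\<^sub>R (y R K v * G' v))"
  using has_pd_var_mult[OF D assms, of "rowc R K"] by simp

lemma has_pd_x_var'_mult:
  assumes "has_pd D (Xc B) G G'"
  shows "has_pd D (Xc B) (\<lambda>v. y' R v * G v) (\<lambda>v. sg (par B * rpar R) *\<^sub>R (y' R v * G' v))"
  using has_pd_x_var_mult[OF assms, of R "Ev p"] by simp

lemma pd_x_S:
  assumes v: "v \<in> D"
  shows "dx A S v = y' (Inr (Ev r)) v * dx A L v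
     - (\<Sum>R\<in>Rs. \<Sum>K\<in>Ks. sg (rpar R * par K + par A * (par K + rpar R)) *\<^sub>R
          (y (Inr (Ev r)) K v * (y' R v * dx A (d R K) v)))"
  unfolding has_pdD[OF has_pd_adjoin[OF D smooth_L] v]
  by (simp add: power_add distrib_left)

lemma pd_p_S:
  assumes v: "v \<in> D" and K: "K \<in> Ks"
  shows "dp A K S v = y' (Inr (Ev r)) v * d (Inl A) K v
     - (\<Sum>R\<in>Rs. \<Sum>J\<in>Ks. sg (rpar R * par J + (par A + par K) * (par J + rpar R)) *\<^sub>R
          (y (Inr (Ev r)) J v * (y' R v * dp A K (d R J) v)))"
  unfolding has_pdD[OF has_pd_adjoin[OF D smooth_L] v] using Ks_neq[OF K]
  by (simp add: power_add distrib_left)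

text \<open>\<open>L\<close> and its derivatives do not contain the new column. Only the explicit
  factor \<open>y' R\<close> with \<open>R = Inl A\<close> is hit.\<close>

lemma pd_p'_S:
  assumes v: "v \<in> D" and A: "A \<in> I"
  shows "dp A (Ev p) S v = - (\<Sum>J\<in>Ks. y (Inr (Ev r)) J v * d (Inl A) J v)"
proof -
  have z: "dp A (Ev p) L v = 0" "dp A (Ev p) (d R J) v = 0" for R J
    using pd_extra_L[OF rowc_notin(1) sf_L v] pd_extra_L[OF rowc_notin(1) sf_d v] by auto
  have "dp A (Ev p) S v = - (\<Sum>R\<in>Rs. \<Sum>J\<in>Ks. if R = Inl A then y (Inr (Ev r)) J v * d (Inl A) J v else 0)"
    unfolding has_pdD[OF has_pd_adjoin[OF D smooth_L] v]
    by (simp add: z, intro sum.cong refl) (auto simp flip: power_add simp: power_mult_distrib[symmetric])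
  also have "\<dots> = - (\<Sum>R\<in>Rs. if R = Inl A then \<Sum>J\<in>Ks. y (Inr (Ev r)) J v * d (Inl A) J v else 0)"
    by (simp only: sum_if_left)
  finally show ?thesis using InlI[OF A, of "indices r s"] by simp
qed

text \<open>The middle term appears because the adjoined row is now a row of \<open>p\<close>: for
  \<open>A = C\<close> the derivative hits its entry in column \<open>K\<close>.\<close>

lemma pd_p_adjoin:
  assumes v: "v \<in> D" and K: "K \<in> Ks"
  shows "dp A K (adjoin p Rs Ks (Inl C) L) v =
     sg ((par A + par K) * par C) *\<^sub>R (y' (Inl C) v * d (Inl A) K v)
     - (if A = C then \<Sum>R\<in>Rs. sg (rpar R * par K) *\<^sub>R (y' R v * d R K v) else 0)
     - (\<Sum>R\<in>Rs. \<Sum>J\<in>Ks. sg (rpar R * par J + (par A + par K) * (par C + par J + rpar R)) *\<^sub>R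
          (y (Inl C) J v * (y' R v * dp A K (d R J) v)))"
proof -
  have "(\<Sum>R\<in>Rs. \<Sum>J\<in>Ks. sg (rpar R * par J) *\<^sub>R (if A = C \<and> K = J then y' R v * d R J v else 0))
      = (\<Sum>R\<in>Rs. \<Sum>J\<in>Ks. if K = J then (if A = C then sg (rpar R * par J) *\<^sub>R (y' R v * d R J v) else 0) else 0)"
    by (intro sum.cong refl) auto
  also have "\<dots> = (if A = C then \<Sum>R\<in>Rs. sg (rpar R * par K) *\<^sub>R (y' R v * d R K v) else 0)"
    using K by simp
  finally have *: "(\<Sum>R\<in>Rs. \<Sum>J\<in>Ks. sg (rpar R * par J) *\<^sub>R (if A = C \<and> K = J then y' R v * d R J v else 0))
      = (if A = C then \<Sum>R\<in>Rs. sg (rpar R * par K) *\<^sub>R (y' R v * d R K v) else 0)" .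
  show ?thesis
    unfolding has_pdD[OF has_pd_adjoin[OF D smooth_L] v] *[symmetric] using Ks_neq[OF K]
    by (simp add: power_add distrib_left scaleR_add_right sum.distrib)
qed

lemma pd_p'_adjoin:
  assumes v: "v \<in> D" and A: "A \<in> I"
  shows "dp A (Ev p) (adjoin p Rs Ks (Inl C) L) v =
     (if A = C then L v else 0)
     - (\<Sum>J\<in>Ks. sg (par A * par C) *\<^sub>R (y (Inl C) J v * d (Inl A) J v))"
proof -
  have z: "dp A (Ev p) L v = 0" "dp A (Ev p) (d R J) v = 0" for R J
    using pd_extra_L[OF rowc_notin(1) sf_L v] pd_extra_L[OF rowc_notin(1) sf_d v] by auto
  have "dp A (Ev p) (adjoin p Rs Ks (Inl C) L) v = (if A = C then L v else 0)
      - (\<Sum>R\<in>Rs. \<Sum>J\<in>Ks. if R = Inl A then sg (par A * par C) *\<^sub>R (y (Inl C) J v * d (Inl A) J v) else 0)"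
    unfolding has_pdD[OF has_pd_adjoin[OF D smooth_L] v]
    by (simp add: z, intro sum.cong refl)
       (auto simp: Ks_neq simp flip: power_add intro!: arg_cong2[where f = scaleR] minus_one_power_cong)
  also have "(\<Sum>R\<in>Rs. \<Sum>J\<in>Ks. if R = Inl A then sg (par A * par C) *\<^sub>R (y (Inl C) J v * d (Inl A) J v) else 0)
      = (\<Sum>R\<in>Rs. if R = Inl A then \<Sum>J\<in>Ks. sg (par A * par C) *\<^sub>R (y (Inl C) J v * d (Inl A) J v) else 0)"
    by (simp only: sum_if_left)
  finally show ?thesis using InlI[OF A, of "indices r s"] by simp
qed

text \<open>\<open>eL\<close> and \<open>dL\<close> are \<open>e(X) L\<close> and the differential
  of \<open>L\<close> without the factor \<open>(-1) ^ r\<close>; it is restored in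
  \<open>cartan_formula_chart\<close>.\<close>

definition eL where "eL v = (\<Sum>C\<in>I. X C v * adjoin p Rs Ks (Inl C) L v)"

definition dL where "dL v = (\<Sum>K\<in>Ks. \<Sum>C\<in>I. sg (par C * par K) *\<^sub>R
   (y (Inr (Ev r)) K v * dx C (d (Inl C) K) v))"

lemma smooth_eL: "smooth_sfun D eL"
  unfolding eL_def by (intro smooth_sfun_sum smooth_sfun_mult D smooth_X smooth_adjoin)

lemma pd_p_eL:
  assumes v: "v \<in> D" and K: "K \<in> Ks" and A: "A \<in> I"
  shows "dp A K eL v =
     (\<Sum>C\<in>I. sg ((par A + par K) * e) *\<^sub>R (X C v * (y' (Inl C) v * d (Inl A) K v)))
     - (\<Sum>R\<in>Rs. sg ((par A + par K) * (e + par A) + rpar R * par K) *\<^sub>R (X A v * (y' R v * d R K v)))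
     - (\<Sum>C\<in>I. \<Sum>R\<in>Rs. \<Sum>J\<in>Ks.
          sg ((par A + par K) * (e + par C) + (rpar R * par J + (par A + par K) * (par C + par J + rpar R))) *\<^sub>R
          (X C v * (y (Inl C) J v * (y' R v * dp A K (d R J) v))))"
proof -
  let ?s = "\<lambda>C. (-1::real) ^ ((par A + par K) * (e + par C))"
  have "has_pd D (rowc (Inl A) K) eL (\<lambda>v. \<Sum>C\<in>I. sg ((rpar (Inl A) + par K) * (e + par C)) *\<^sub>R
      (X C v * dp A K (adjoin p Rs Ks (Inl C) L) v))"
    unfolding eL_def[abs_def]
    by (intro has_pd_sum[OF D] has_pd_row_X_mult has_pd_smooth smooth_adjoin)
  from has_pdD[OF this v] have "dp A K eL v = (\<Sum>C\<in>I. ?s C *\<^sub>R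
      (X C v * dp A K (adjoin p Rs Ks (Inl C) L) v))" by simp
  also have "\<dots> = (\<Sum>C\<in>I. ?s C *\<^sub>R (X C v * (sg ((par A + par K) * par C) *\<^sub>R (y' (Inl C) v * d (Inl A) K v))))
     - (\<Sum>C\<in>I. ?s C *\<^sub>R (X C v * (if A = C then \<Sum>R\<in>Rs. sg (rpar R * par K) *\<^sub>R (y' R v * d R K v) else 0)))
     - (\<Sum>C\<in>I. ?s C *\<^sub>R (X C v * (\<Sum>R\<in>Rs. \<Sum>J\<in>Ks. sg (rpar R * par J + (par A + par K) * (par C + par J + rpar R)) *\<^sub>R
          (y (Inl C) J v * (y' R v * dp A K (d R J) v)))))"
    unfolding pd_p_adjoin[OF v K] by (simp only: right_diff_distrib scaleR_diff_right sum_subtractf)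
  also have "(\<Sum>C\<in>I. ?s C *\<^sub>R (X C v * (sg ((par A + par K) * par C) *\<^sub>R (y' (Inl C) v * d (Inl A) K v))))
     = (\<Sum>C\<in>I. sg ((par A + par K) * e) *\<^sub>R (X C v * (y' (Inl C) v * d (Inl A) K v)))"
    by (intro sum.cong refl)
       (auto simp flip: power_add intro!: arg_cong2[where f = scaleR] minus_one_power_cong)
  also have "(\<Sum>C\<in>I. ?s C *\<^sub>R (X C v * (if A = C then \<Sum>R\<in>Rs. sg (rpar R * par K) *\<^sub>R (y' R v * d R K v) else 0)))
     = (\<Sum>C\<in>I. if A = C then ?s C *\<^sub>R (X C v * (\<Sum>R\<in>Rs. sg (rpar R * par K) *\<^sub>R (y' R v * d R K v))) else 0)"
    by (intro sum.cong refl) auto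
  also have "\<dots> = (\<Sum>R\<in>Rs. sg ((par A + par K) * (e + par A) + rpar R * par K) *\<^sub>R (X A v * (y' R v * d R K v)))"
    using A by (simp add: sum_distrib_left scaleR_sum_right power_add)
  also have "(\<Sum>C\<in>I. ?s C *\<^sub>R (X C v * (\<Sum>R\<in>Rs. \<Sum>J\<in>Ks. sg (rpar R * par J + (par A + par K) * (par C + par J + rpar R)) *\<^sub>R
          (y (Inl C) J v * (y' R v * dp A K (d R J) v)))))
     = (\<Sum>C\<in>I. \<Sum>R\<in>Rs. \<Sum>J\<in>Ks.
          sg ((par A + par K) * (e + par C) + (rpar R * par J + (par A + par K) * (par C + par J + rpar R))) *\<^sub>R
          (X C v * (y (Inl C) J v * (y' R v * dp A K (d R J) v))))"
    by (simp only: sum_distrib_left scaleR_sum_right mult_scaleR_right scaleR_scaleR power_add)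
  finally show ?thesis .
qed

lemma pd_p'_eL:
  assumes v: "v \<in> D" and A: "A \<in> I"
  shows "dp A (Ev p) eL v =
     sg (par A * (e + par A)) *\<^sub>R (X A v * L v)
     - (\<Sum>C\<in>I. \<Sum>J\<in>Ks. sg (par A * e) *\<^sub>R (X C v * (y (Inl C) J v * d (Inl A) J v)))"
proof -
  let ?s = "\<lambda>C. (-1::real) ^ (par A * (e + par C))"
  have "has_pd D (rowc (Inl A) (Ev p)) eL (\<lambda>v. \<Sum>C\<in>I. sg ((rpar (Inl A) + par (Ev p)) * (e + par C)) *\<^sub>R
      (X C v * dp A (Ev p) (adjoin p Rs Ks (Inl C) L) v))"
    unfolding eL_def[abs_def]
    by (intro has_pd_sum[OF D] has_pd_row_X_mult has_pd_smooth smooth_adjoin)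
  from has_pdD[OF this v] have "dp A (Ev p) eL v = (\<Sum>C\<in>I. ?s C *\<^sub>R
      (X C v * dp A (Ev p) (adjoin p Rs Ks (Inl C) L) v))" by simp
  also have "\<dots> = (\<Sum>C\<in>I. ?s C *\<^sub>R (X C v * (if A = C then L v else 0)))
     - (\<Sum>C\<in>I. ?s C *\<^sub>R (X C v * (\<Sum>J\<in>Ks. sg (par A * par C) *\<^sub>R (y (Inl C) J v * d (Inl A) J v))))"
    unfolding pd_p'_adjoin[OF v A] by (simp only: right_diff_distrib scaleR_diff_right sum_subtractf)
  also have "(\<Sum>C\<in>I. ?s C *\<^sub>R (X C v * (if A = C then L v else 0)))
     = (\<Sum>C\<in>I. if A = C then ?s C *\<^sub>R (X C v * L v) else 0)"
    by (intro sum.cong refl) auto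
  also have "\<dots> = ?s A *\<^sub>R (X A v * L v)" using A by simp
  also have "(\<Sum>C\<in>I. ?s C *\<^sub>R (X C v * (\<Sum>J\<in>Ks. sg (par A * par C) *\<^sub>R (y (Inl C) J v * d (Inl A) J v))))
     = (\<Sum>C\<in>I. \<Sum>J\<in>Ks. sg (par A * e) *\<^sub>R (X C v * (y (Inl C) J v * d (Inl A) J v)))"
    unfolding sum_distrib_left scaleR_sum_right
    by (intro sum.cong refl)
       (auto simp flip: power_add intro!: arg_cong2[where f = scaleR] minus_one_power_cong)
  finally show ?thesis .
qed

text \<open>No sign survives: the one from passing the entry of the new row cancels the one from
  commuting with the two derivatives inside.\<close>

lemma pd_row_dL:
  assumes v: "v \<in> D" and R: "R \<in> Rs" and K: "K \<in> Ks"
  shows "pd (rowc R K) dL v = (\<Sum>J\<in>Ks. \<Sum>C\<in>I. sg (par C * par J) *\<^sub>R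
     (y (Inr (Ev r)) J v * dx C (dp C J (d R K)) v))"
proof -
  have R': "R \<noteq> Inr (Ev r)" using R by auto
  have "has_pd D (rowc R K) dL (\<lambda>v. \<Sum>J\<in>Ks. \<Sum>C\<in>I. sg (par C * par J) *\<^sub>R
      ((if rowc R K = rowc (Inr (Ev r)) J then dx C (d (Inl C) J) v else 0)
       + sg (cpar (rowc R K) * cpar (rowc (Inr (Ev r)) J)) *\<^sub>R
         (y (Inr (Ev r)) J v * pd (rowc R K) (dx C (d (Inl C) J)) v)))"
    unfolding dL_def[abs_def]
    by (intro has_pd_sum[OF D] has_pd_scaleR[OF D] has_pd_var_mult[OF D] has_pd_smooth smooth_sfun_pd D smooth_L)
  from has_pdD[OF this v] have "pd (rowc R K) dL v = (\<Sum>J\<in>Ks. \<Sum>C\<in>I. sg (par C * par J) *\<^sub>R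
      (sg ((rpar R + par K) * par J) *\<^sub>R
         (y (Inr (Ev r)) J v * pd (rowc R K) (dx C (d (Inl C) J)) v)))"
    using R' by simp
  also have "\<dots> = (\<Sum>J\<in>Ks. \<Sum>C\<in>I. sg (par C * par J) *\<^sub>R
     (y (Inr (Ev r)) J v * dx C (dp C J (d R K)) v))"
  proof (intro sum.cong refl)
    fix J C
    have "pd (rowc R K) (dx C (d (Inl C) J)) v =
        sg ((rpar R + par K) * par C) *\<^sub>R dx C (pd (rowc R K) (d (Inl C) J)) v"
      using pd_commute[OF D smooth_sfun_pd[OF D smooth_L] v, of "rowc R K" "Xc C" "rowc (Inl C) J"] by simp
    also have "dx C (pd (rowc R K) (d (Inl C) J)) v =
        dx C (\<lambda>v. sg ((rpar R + par K) * (par C + par J)) *\<^sub>R dp C J (d R K) v) v"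
      by (rule pd_cong[OF D _ v])
         (use pd_commute[OF D smooth_L, of _ "rowc R K" "rowc (Inl C) J"] in simp)
    also have "\<dots> = sg ((rpar R + par K) * (par C + par J)) *\<^sub>R dx C (dp C J (d R K)) v"
      by (rule pd_scaleR[OF _ v]) (intro smooth_sfun_pd D smooth_L)
    finally have "pd (rowc R K) (dx C (d (Inl C) J)) v =
        sg ((rpar R + par K) * par J) *\<^sub>R dx C (dp C J (d R K)) v"
      by (auto simp flip: power_add intro!: arg_cong2[where f = scaleR] minus_one_power_cong)
    then show "sg (par C * par J) *\<^sub>R (sg ((rpar R + par K) * par J) *\<^sub>R
         (y (Inr (Ev r)) J v * pd (rowc R K) (dx C (d (Inl C) J)) v))
       = sg (par C * par J) *\<^sub>R (y (Inr (Ev r)) J v * dx C (dp C J (d R K)) v)"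
      by (simp flip: power_add mult_2)
  qed
  finally show ?thesis .
qed

text \<open>\<open>L\<close> does not contain the new row, so only the explicit linear factor is
  differentiated.\<close>

lemma pd_new_row_dL:
  assumes v: "v \<in> D" and K: "K \<in> Ks"
  shows "pd (rowc (Inr (Ev r)) K) dL v = (\<Sum>C\<in>I. sg (par C * par K) *\<^sub>R dx C (d (Inl C) K) v)"
proof -
  have "has_pd D (rowc (Inr (Ev r)) K) dL (\<lambda>v. \<Sum>J\<in>Ks. \<Sum>C\<in>I. sg (par C * par J) *\<^sub>R
      ((if rowc (Inr (Ev r)) K = rowc (Inr (Ev r)) J then dx C (d (Inl C) J) v else 0)
       + sg (cpar (rowc (Inr (Ev r)) K) * cpar (rowc (Inr (Ev r)) J)) *\<^sub>R
         (y (Inr (Ev r)) J v * pd (rowc (Inr (Ev r)) K) (dx C (d (Inl C) J)) v)))"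
    unfolding dL_def[abs_def]
    by (intro has_pd_sum[OF D] has_pd_scaleR[OF D] has_pd_var_mult[OF D] has_pd_smooth smooth_sfun_pd D smooth_L)
  moreover have "pd (rowc (Inr (Ev r)) K) (dx C (d (Inl C) J)) v = 0" for C J
    by (rule pd_extra_L[OF rowc_notin(2) superfun_pd[OF D sf_d] v])
  ultimately have "pd (rowc (Inr (Ev r)) K) dL v = (\<Sum>J\<in>Ks. \<Sum>C\<in>I. sg (par C * par J) *\<^sub>R
      (if K = J then dx C (d (Inl C) J) v else 0))"
    using has_pdD[OF _ v] by simp
  also have "\<dots> = (\<Sum>J\<in>Ks. if K = J then \<Sum>C\<in>I. sg (par C * par J) *\<^sub>R dx C (d (Inl C) J) v else 0)"
    by (intro sum.cong refl) auto
  finally show ?thesis using K by simp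
qed

end

section \<open>Leibniz expansion of both sides\<close>

lemma sign_cong: "(even a \<longleftrightarrow> even b) \<Longrightarrow> sg a *\<^sub>R x = sg b *\<^sub>R (x::'a::real_vector)"
  by (simp only: minus_one_power_cong[of a b])

lemma sum_rotate:
  "(\<Sum>a\<in>A. \<Sum>b\<in>B. \<Sum>c\<in>C. f a b c) = (\<Sum>b\<in>B. \<Sum>c\<in>C. \<Sum>a\<in>A. f a b c :: 'x::comm_monoid_add)"
proof -
  have "(\<Sum>a\<in>A. \<Sum>b\<in>B. \<Sum>c\<in>C. f a b c) = (\<Sum>b\<in>B. \<Sum>a\<in>A. \<Sum>c\<in>C. f a b c)" by (rule sum.swap)
  also have "\<dots> = (\<Sum>b\<in>B. \<Sum>c\<in>C. \<Sum>a\<in>A. f a b c)" by (intro sum.cong refl sum.swap)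
  finally show ?thesis .
qed

context form_chart
begin

lemmas merge_signs = mult_scaleR_left mult_scaleR_right scaleR_scaleR power_add[symmetric]

lemma has_pd_x_p_eL:
  assumes K: "K \<in> Ks" and A: "A \<in> I"
  shows "has_pd D (Xc A) (dp A K eL) (\<lambda>v.
     (\<Sum>C\<in>I. sg ((par A + par K) * e) *\<^sub>R
        (dx A (X C) v * (y' (Inl C) v * d (Inl A) K v)
         + sg (par A * (e + par C)) *\<^sub>R (X C v *
             (sg (par A * rpar (Inl C)) *\<^sub>R (y' (Inl C) v * dx A (d (Inl A) K) v)))))
     - (\<Sum>R\<in>Rs. sg ((par A + par K) * (e + par A) + rpar R * par K) *\<^sub>R
        (dx A (X A) v * (y' R v * d R K v)
         + sg (par A * (e + par A)) *\<^sub>R (X A v *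
             (sg (par A * rpar R) *\<^sub>R (y' R v * dx A (d R K) v)))))
     - (\<Sum>C\<in>I. \<Sum>R\<in>Rs. \<Sum>J\<in>Ks.
          sg ((par A + par K) * (e + par C) + (rpar R * par J + (par A + par K) * (par C + par J + rpar R))) *\<^sub>R
          (dx A (X C) v * (y (Inl C) J v * (y' R v * dp A K (d R J) v))
           + sg (par A * (e + par C)) *\<^sub>R (X C v *
               (sg (par A * (rpar (Inl C) + par J)) *\<^sub>R (y (Inl C) J v *
                 (sg (par A * rpar R) *\<^sub>R (y' R v * dx A (dp A K (d R J)) v))))))))"
proof -
  note sd = smooth_sfun_pd[OF D smooth_L]
  show ?thesis
    by (rule has_pd_cong[OF D has_pd_diff[OF D has_pd_diff[OF D
          has_pd_sum[OF D has_pd_scaleR[OF D has_pd_X_mult[OF _ has_pd_x_var'_mult[OF has_pd_smooth[OF sd]]]]]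
          has_pd_sum[OF D has_pd_scaleR[OF D has_pd_X_mult[OF _ has_pd_x_var'_mult[OF has_pd_smooth[OF sd]]]]]]
          has_pd_sum[OF D has_pd_sum[OF D has_pd_sum[OF D has_pd_scaleR[OF D has_pd_X_mult[OF _
            has_pd_x_var_mult[OF has_pd_x_var'_mult[OF has_pd_smooth[OF smooth_sfun_pd[OF D sd]]]]]]]]]]
        pd_p_eL[OF _ K A] refl]) (simp_all only: A)
qed

lemma has_pd_x_p'_eL:
  assumes A: "A \<in> I"
  shows "has_pd D (Xc A) (dp A (Ev p) eL) (\<lambda>v.
     sg (par A * (e + par A)) *\<^sub>R
       (dx A (X A) v * L v + sg (par A * (e + par A)) *\<^sub>R (X A v * dx A L v))
     - (\<Sum>C\<in>I. \<Sum>J\<in>Ks. sg (par A * e) *\<^sub>R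
         (dx A (X C) v * (y (Inl C) J v * d (Inl A) J v)
          + sg (par A * (e + par C)) *\<^sub>R (X C v *
             (sg (par A * (rpar (Inl C) + par J)) *\<^sub>R (y (Inl C) J v * dx A (d (Inl A) J) v))))))"
proof -
  note sd = smooth_sfun_pd[OF D smooth_L]
  show ?thesis
    by (rule has_pd_cong[OF D has_pd_diff[OF D
          has_pd_scaleR[OF D has_pd_X_mult[OF A has_pd_smooth[OF smooth_L]]]
          has_pd_sum[OF D has_pd_sum[OF D has_pd_scaleR[OF D has_pd_X_mult[OF _
            has_pd_x_var_mult[OF has_pd_smooth[OF sd]]]]]]]
        pd_p'_eL[OF _ A] refl])
qed

context
  fixes v assumes v: "v \<in> D"
begin

abbreviation w where "w K \<equiv> y (Inr (Ev r)) K v"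
abbreviation w' where "w' \<equiv> y' (Inr (Ev r)) v"
abbreviation dX where "dX A C \<equiv> dx A (X C) v"
abbreviation d2 where "d2 A K R J \<equiv> dp A K (d R J) v"

text \<open>The terms of both sides after the Leibniz expansion; \<open>A\<close> is always the index of \<open>\<partial>/\<partial>x\<^sup>A\<close>. The terms \<open>R\<close>
  occur on both sides, the terms \<open>Q\<close> cancel within the left-hand side.\<close>
definition "R1 A = X A v * (w' * dx A L v)"
definition "R2 A R K = sg (rpar R * par K + par A * (par K + rpar R)) *\<^sub>R
  (X A v * (w K * (y' R v * dx A (d R K) v)))"
definition "R3 A C J = sg (par A * e) *\<^sub>R (dX A C * (y (Inl C) J v * (w' * d (Inl A) J v)))"
definition "R4 A C R J K = sg (par A * e + (rpar R * par K + (par A + par J) * (par K + rpar R))) *\<^sub>R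
  (dX A C * (y (Inl C) J v * (w K * (y' R v * d2 A J R K))))"
definition "R5 A C K = sg (par A * e) *\<^sub>R (dX A C * (y' (Inl C) v * (w K * d (Inl A) K v)))"
definition "R6 A = sg (par A * (e + 1)) *\<^sub>R (dX A A * (w' * L v))"
definition "R7 A R K = sg (par A * (e + 1) + rpar R * par K) *\<^sub>R (dX A A * (w K * (y' R v * d R K v)))"
definition "Q2 A C K = sg (par A * par K) *\<^sub>R (X C v * (y' (Inl C) v * (w K * dx A (d (Inl A) K) v)))"
definition "Q4 A C J = sg (par A * par J) *\<^sub>R (X C v * (y (Inl C) J v * (w' * dx A (d (Inl A) J) v)))"
definition "Q6 A C R J K = sg (rpar R * par J + par A * par K) *\<^sub>R
  (X C v * (y (Inl C) J v * (y' R v * (w K * dx A (dp A K (d R J)) v))))"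

lemma homog_w: "homog (par K) (w K)"
  using homog_y[of "Inr (Ev r)" K v] by simp

lemma w'_central: "w' * (x * z) = x * (w' * z)"
proof -
  have "homog 0 w'" using homog_y'[of "Inr (Ev r)" v] by simp
  then show ?thesis using even_central[of w' x] by (simp flip: mult.assoc)
qed

lemma w_X: "w K * (X C v * z) = sg (par K * (e + par C)) *\<^sub>R (X C v * (w K * z))"
  by (rule supercommute_left[OF homog_w homog_X])

lemma w_dX: "C \<in> I \<Longrightarrow> w K * (dX A C * z) = sg (par K * (par A + (e + par C))) *\<^sub>R (dX A C * (w K * z))"
  by (rule supercommute_left[OF homog_w homog_dX[OF _ v]])

lemma w_y': "w K * (y' R v * z) = sg (par K * rpar R) *\<^sub>R (y' R v * (w K * z))"
  by (rule supercommute_left[OF homog_w homog_y'])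

lemma w_y: "w K * (y R J v * z) = sg (par K * (rpar R + par J)) *\<^sub>R (y R J v * (w K * z))"
  by (rule supercommute_left[OF homog_w homog_y])

text \<open>The row equation exchanges the rows; commuting the derivatives afterwards puts the rows
  back and leaves the columns \<open>K\<close> and \<open>J\<close> exchanged. The resulting sign
  does not depend on \<open>R\<close>.\<close>

lemma d2_exchange:
  assumes "A \<in> I" "R \<in> Rs" "K \<in> Ks" "J \<in> Ks"
  shows "d2 A K R J = - sg (par A * par J + par K * par A + par K * par J) *\<^sub>R d2 A J R K"
proof -
  have "d2 A K R J = - sg (rpar (Inl A) * rpar R + (rpar (Inl A) + rpar R) * par J) *\<^sub>R
      pd (rowc R K) (d (Inl A) J) v"
    by (rule row_exchange[OF L U v]) (use assms in auto)
  also have "pd (rowc R K) (d (Inl A) J) v = sg ((rpar R + par K) * (par A + par J)) *\<^sub>R d2 A J R K"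
    using pd_commute[OF D smooth_L v, of "rowc R K" "rowc (Inl A) J"] by simp
  finally have "d2 A K R J = - (sg ((rpar (Inl A) * rpar R + (rpar (Inl A) + rpar R) * par J)
      + (rpar R + par K) * (par A + par J)) *\<^sub>R d2 A J R K)"
    by (simp add: power_add)
  also have "sg ((rpar (Inl A) * rpar R + (rpar (Inl A) + rpar R) * par J)
      + (rpar R + par K) * (par A + par J)) *\<^sub>R d2 A J R K
      = sg (par A * par J + par K * par A + par K * par J) *\<^sub>R d2 A J R K"
    by (rule sign_cong) auto
  finally show ?thesis by simp
qed

text \<open>The new column in the differential of \<open>e(X) L\<close>; its variable
  \<open>w'\<close> is even and moves without sign.\<close>

lemma left_extra: "(\<Sum>A\<in>I. w' * dx A (dp A (Ev p) eL) v)
   = (\<Sum>A\<in>I. R6 A) + (\<Sum>A\<in>I. R1 A) - ((\<Sum>A\<in>I. \<Sum>C\<in>I. \<Sum>J\<in>Ks. R3 A C J) + (\<Sum>A\<in>I. \<Sum>C\<in>I. \<Sum>J\<in>Ks. Q4 A C J))"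
proof -
  have "w' * dx A (dp A (Ev p) eL) v
      = R6 A + R1 A - (\<Sum>C\<in>I. \<Sum>J\<in>Ks. R3 A C J + Q4 A C J)" if A: "A \<in> I" for A
  proof -
    have 1: "w' * (sg (par A * (e + par A)) *\<^sub>R (dX A A * L v)) = R6 A"
      unfolding R6_def by (simp only: merge_signs w'_central, rule sign_cong) auto
    have 2: "w' * (sg (par A * (e + par A)) *\<^sub>R (sg (par A * (e + par A)) *\<^sub>R (X A v * dx A L v))) = R1 A"
      unfolding R1_def by (simp only: merge_signs w'_central) (simp flip: power_add mult_2)
    have 3: "w' * (sg (par A * e) *\<^sub>R (dX A C * (y (Inl C) J v * d (Inl A) J v))) = R3 A C J" for C J
      unfolding R3_def by (simp only: merge_signs w'_central)
    have 4: "w' * (sg (par A * e) *\<^sub>R (sg (par A * (e + par C)) *\<^sub>R (X C v *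
             (sg (par A * (rpar (Inl C) + par J)) *\<^sub>R (y (Inl C) J v * dx A (d (Inl A) J) v))))) = Q4 A C J" for C J
      unfolding Q4_def by (simp only: merge_signs w'_central, rule sign_cong) auto
    show ?thesis
      unfolding has_pdD[OF has_pd_x_p'_eL[OF A] v]
      by (simp only: scaleR_add_right right_diff_distrib distrib_left[where 'a = "coord gr"] sum_distrib_left 1 2 3 4)
  qed
  then show ?thesis by (simp add: sum.distrib sum_subtractf)
qed

lemma left_main: "(\<Sum>K\<in>Ks. \<Sum>A\<in>I. sg (par A * par K) *\<^sub>R (w K * dx A (dp A K eL) v))
   = (\<Sum>K\<in>Ks. \<Sum>A\<in>I. \<Sum>C\<in>I. R5 A C K) + (\<Sum>K\<in>Ks. \<Sum>A\<in>I. \<Sum>C\<in>I. Q2 A C K)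
     - ((\<Sum>K\<in>Ks. \<Sum>A\<in>I. \<Sum>R\<in>Rs. R7 A R K) + (\<Sum>K\<in>Ks. \<Sum>A\<in>I. \<Sum>R\<in>Rs. R2 A R K))
     - ((\<Sum>K\<in>Ks. \<Sum>A\<in>I. \<Sum>C\<in>I. \<Sum>R\<in>Rs. \<Sum>J\<in>Ks. Q6 A C R J K) - (\<Sum>K\<in>Ks. \<Sum>A\<in>I. \<Sum>C\<in>I. \<Sum>R\<in>Rs. \<Sum>J\<in>Ks. R4 A C R J K))"
proof -
  have "sg (par A * par K) *\<^sub>R (w K * dx A (dp A K eL) v)
      = (\<Sum>C\<in>I. R5 A C K + Q2 A C K) - (\<Sum>R\<in>Rs. R7 A R K + R2 A R K)
        - (\<Sum>C\<in>I. \<Sum>R\<in>Rs. \<Sum>J\<in>Ks. - R4 A C R J K + Q6 A C R J K)" if A: "A \<in> I" and K: "K \<in> Ks" for A K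
  proof -
    let ?s = "(-1::real) ^ (par A * par K)"
    let ?t = "\<lambda>C R J. (-1::real) ^ ((par A + par K) * (e + par C) + (rpar R * par J + (par A + par K) * (par C + par J + rpar R)))"
    have 1: "?s *\<^sub>R (w K * (sg ((par A + par K) * e) *\<^sub>R (dX A C * (y' (Inl C) v * d (Inl A) K v)))) = R5 A C K"
      if "C \<in> I" for C
      unfolding R5_def by (simp only: merge_signs w_dX[OF that] w_y', rule sign_cong) auto
    have 2: "?s *\<^sub>R (w K * (sg ((par A + par K) * e) *\<^sub>R (sg (par A * (e + par C)) *\<^sub>R (X C v *
             (sg (par A * rpar (Inl C)) *\<^sub>R (y' (Inl C) v * dx A (d (Inl A) K) v)))))) = Q2 A C K" for C
      unfolding Q2_def by (simp only: merge_signs w_X w_y', rule sign_cong) auto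
    have 3: "?s *\<^sub>R (w K * (sg ((par A + par K) * (e + par A) + rpar R * par K) *\<^sub>R
        (dX A A * (y' R v * d R K v)))) = R7 A R K" for R
      unfolding R7_def by (simp only: merge_signs w_dX[OF A], rule sign_cong) auto
    have 4: "?s *\<^sub>R (w K * (sg ((par A + par K) * (e + par A) + rpar R * par K) *\<^sub>R
        (sg (par A * (e + par A)) *\<^sub>R (X A v *
             (sg (par A * rpar R) *\<^sub>R (y' R v * dx A (d R K) v)))))) = R2 A R K" for R
      unfolding R2_def by (simp only: merge_signs w_X, rule sign_cong) auto
    \<comment> \<open>The term with a derivative of \<open>X\<close> and a second derivative of
      \<open>L\<close> has its columns in the opposite order from the right-hand side;
      \<open>d2_exchange\<close> corrects this and supplies the minus sign.\<close>
    have 5: "?s *\<^sub>R (w K * (?t C R J *\<^sub>R (dX A C * (y (Inl C) J v * (y' R v * d2 A K R J))))) = - R4 A C R J K"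
      if "C \<in> I" "R \<in> Rs" "J \<in> Ks" for C R J
    proof -
      have "?s *\<^sub>R (w K * (?t C R J *\<^sub>R (dX A C * (y (Inl C) J v * (y' R v *
          (sg (par A * par J + par K * par A + par K * par J) *\<^sub>R d2 A J R K)))))) = R4 A C R J K"
        unfolding R4_def by (simp only: merge_signs w_dX[OF that(1)] w_y[of K "Inl C" J], rule sign_cong) auto
      then show ?thesis
        unfolding d2_exchange[OF A that(2) K that(3)] by (simp only: scaleR_minus_left mult_minus_right scaleR_minus_right)
    qed
    have 6: "?s *\<^sub>R (w K * (?t C R J *\<^sub>R (sg (par A * (e + par C)) *\<^sub>R (X C v *
               (sg (par A * (rpar (Inl C) + par J)) *\<^sub>R (y (Inl C) J v *
                 (sg (par A * rpar R) *\<^sub>R (y' R v * dx A (dp A K (d R J)) v)))))))) = Q6 A C R J K" for C R J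
      unfolding Q6_def by (simp only: merge_signs w_X w_y[of K "Inl C" J] w_y', rule sign_cong) auto
    have c: "(\<Sum>C\<in>I. ?s *\<^sub>R (w K * (sg ((par A + par K) * e) *\<^sub>R
        (dX A C * (y' (Inl C) v * d (Inl A) K v)
         + sg (par A * (e + par C)) *\<^sub>R (X C v *
             (sg (par A * rpar (Inl C)) *\<^sub>R (y' (Inl C) v * dx A (d (Inl A) K) v)))))))
       = (\<Sum>C\<in>I. R5 A C K + Q2 A C K)"
      by (rule sum.cong[OF refl]) (simp only: scaleR_add_right distrib_left[where 'a = "coord gr"] 1 2)
    have f: "(\<Sum>C\<in>I. \<Sum>R\<in>Rs. \<Sum>J\<in>Ks. ?s *\<^sub>R (w K * (?t C R J *\<^sub>R
          (dX A C * (y (Inl C) J v * (y' R v * d2 A K R J))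
           + sg (par A * (e + par C)) *\<^sub>R (X C v *
               (sg (par A * (rpar (Inl C) + par J)) *\<^sub>R (y (Inl C) J v *
                 (sg (par A * rpar R) *\<^sub>R (y' R v * dx A (dp A K (d R J)) v)))))))))
       = (\<Sum>C\<in>I. \<Sum>R\<in>Rs. \<Sum>J\<in>Ks. - R4 A C R J K + Q6 A C R J K)"
      by (intro sum.cong[OF refl]) (simp only: scaleR_add_right distrib_left[where 'a = "coord gr"] 5 6)
    have r: "(\<Sum>R\<in>Rs. ?s *\<^sub>R (w K * (sg ((par A + par K) * (e + par A) + rpar R * par K) *\<^sub>R
        (dX A A * (y' R v * d R K v)
         + sg (par A * (e + par A)) *\<^sub>R (X A v *
             (sg (par A * rpar R) *\<^sub>R (y' R v * dx A (d R K) v)))))))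
       = (\<Sum>R\<in>Rs. R7 A R K + R2 A R K)"
      by (rule sum.cong[OF refl]) (simp only: scaleR_add_right distrib_left[where 'a = "coord gr"] 3 4)
    show ?thesis
      unfolding has_pdD[OF has_pd_x_p_eL[OF K A] v] right_diff_distrib scaleR_diff_right
        sum_distrib_left scaleR_sum_right c r f ..
  qed
  then have "(\<Sum>K\<in>Ks. \<Sum>A\<in>I. sg (par A * par K) *\<^sub>R (w K * dx A (dp A K eL) v))
      = (\<Sum>K\<in>Ks. \<Sum>A\<in>I. (\<Sum>C\<in>I. R5 A C K + Q2 A C K) - (\<Sum>R\<in>Rs. R7 A R K + R2 A R K)
        - (\<Sum>C\<in>I. \<Sum>R\<in>Rs. \<Sum>J\<in>Ks. - R4 A C R J K + Q6 A C R J K))"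
    by (intro sum.cong refl)
  then show ?thesis by (simp add: sum.distrib sum_subtractf sum_negf)
qed

lemma left_e: "(\<Sum>C\<in>I. X C v * adjoin p (arg_rows n m (r + 1) s) Ks (Inl C) dL v)
   = (\<Sum>C\<in>I. \<Sum>K\<in>Ks. \<Sum>A\<in>I. Q2 A C K) - (\<Sum>C\<in>I. \<Sum>R\<in>Rs. \<Sum>J\<in>Ks. \<Sum>K\<in>Ks. \<Sum>A\<in>I. Q6 A C R J K)
     - (\<Sum>C\<in>I. \<Sum>J\<in>Ks. \<Sum>A\<in>I. Q4 A C J)"
proof -
  have "X C v * adjoin p (arg_rows n m (r + 1) s) Ks (Inl C) dL v
     = (\<Sum>K\<in>Ks. \<Sum>A\<in>I. Q2 A C K) - (\<Sum>R\<in>Rs. \<Sum>J\<in>Ks. \<Sum>K\<in>Ks. \<Sum>A\<in>I. Q6 A C R J K) - (\<Sum>J\<in>Ks. \<Sum>A\<in>I. Q4 A C J)" for C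
  proof -
    \<comment> \<open>The form \<open>dL\<close> has one row more than \<open>L\<close>. That row
      yields the terms \<open>Q4\<close>, which cancel against those of
      \<open>left_extra\<close>.\<close>
    have arg_rows: "arg_rows n m (r + 1) s = insert (Inr (Ev r)) Rs" unfolding indices_Suc by (auto simp: Plus_def)
    have "Inr (Ev r) \<notin> Rs" by auto
    moreover have "finite Rs" by simp
    ultimately have "X C v * adjoin p (arg_rows n m (r + 1) s) Ks (Inl C) dL v
        = X C v * (y' (Inl C) v * dL v)
        - (\<Sum>R\<in>Rs. \<Sum>J\<in>Ks. X C v * (sg (rpar R * par J) *\<^sub>R (y (Inl C) J v * (y' R v * pd (rowc R J) dL v))))
        - (\<Sum>J\<in>Ks. X C v * (y (Inl C) J v * (w' * pd (rowc (Inr (Ev r)) J) dL v)))"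
      unfolding adjoin_def arg_rows by (simp add: right_diff_distrib distrib_left sum_distrib_left)
    also have "X C v * (y' (Inl C) v * dL v) = (\<Sum>K\<in>Ks. \<Sum>A\<in>I. Q2 A C K)"
      unfolding dL_def Q2_def by (simp only: sum_distrib_left mult_scaleR_right)
    also have "(\<Sum>R\<in>Rs. \<Sum>J\<in>Ks. X C v * (sg (rpar R * par J) *\<^sub>R (y (Inl C) J v * (y' R v * pd (rowc R J) dL v))))
        = (\<Sum>R\<in>Rs. \<Sum>J\<in>Ks. \<Sum>K\<in>Ks. \<Sum>A\<in>I. Q6 A C R J K)"
      by (intro sum.cong[OF refl])
         (simp only: pd_row_dL[OF v] Q6_def sum_distrib_left scaleR_sum_right merge_signs)
    also have "(\<Sum>J\<in>Ks. X C v * (y (Inl C) J v * (w' * pd (rowc (Inr (Ev r)) J) dL v))) = (\<Sum>J\<in>Ks. \<Sum>A\<in>I. Q4 A C J)"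
      by (intro sum.cong[OF refl])
         (simp only: pd_new_row_dL[OF v] Q4_def sum_distrib_left merge_signs)
    finally show ?thesis .
  qed
  then show ?thesis by (simp add: sum_subtractf)
qed

lemma right_1: "(\<Sum>A\<in>I. X A v * dx A S v) = (\<Sum>A\<in>I. R1 A) - (\<Sum>A\<in>I. \<Sum>R\<in>Rs. \<Sum>K\<in>Ks. R2 A R K)"
  unfolding pd_x_S[OF v] R1_def R2_def
  by (simp only: right_diff_distrib sum_subtractf sum_distrib_left merge_signs)

lemma right_2: "(\<Sum>A\<in>I. \<Sum>C\<in>I. \<Sum>K\<in>insert (Ev p) Ks. sg (par A * e) *\<^sub>R
     (dX A C * (y (Inl C) K v * dp A K S v)))
   = (\<Sum>A\<in>I. \<Sum>C\<in>I. \<Sum>J\<in>Ks. R3 A C J) - (\<Sum>A\<in>I. \<Sum>C\<in>I. \<Sum>J\<in>Ks. \<Sum>R\<in>Rs. \<Sum>K\<in>Ks. R4 A C R J K)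
     - (\<Sum>A\<in>I. \<Sum>C\<in>I. \<Sum>J\<in>Ks. R5 A C J)"
proof -
  have "(\<Sum>K\<in>insert (Ev p) Ks. sg (par A * e) *\<^sub>R (dX A C * (y (Inl C) K v * dp A K S v)))
     = (\<Sum>J\<in>Ks. R3 A C J) - (\<Sum>J\<in>Ks. \<Sum>R\<in>Rs. \<Sum>K\<in>Ks. R4 A C R J K) - (\<Sum>J\<in>Ks. R5 A C J)" if A: "A \<in> I" for A C
  proof -
    \<comment> \<open>The new column contributes \<open>R5\<close>; the old columns give
      \<open>R3\<close> and \<open>R4\<close>.\<close>
    have "sg (par A * e) *\<^sub>R (dX A C * (y' (Inl C) v * dp A (Ev p) S v)) = - (\<Sum>J\<in>Ks. R5 A C J)"
      unfolding pd_p'_S[OF v A] R5_def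
      by (simp only: mult_minus_right scaleR_minus_right sum_distrib_left scaleR_sum_right)
    moreover have "sg (par A * e) *\<^sub>R (dX A C * (y (Inl C) J v * dp A J S v))
        = R3 A C J - (\<Sum>R\<in>Rs. \<Sum>K\<in>Ks. R4 A C R J K)" if "J \<in> Ks" for J
      unfolding pd_p_S[OF v that] R3_def R4_def
      by (simp only: right_diff_distrib scaleR_diff_right sum_distrib_left scaleR_sum_right merge_signs)
    ultimately show ?thesis by (simp add: sum_subtractf)
  qed
  then show ?thesis by (simp add: sum_subtractf)
qed

lemma right_3: "(\<Sum>A\<in>I. sg (par A * (e + 1)) *\<^sub>R (dX A A * S v))
    = (\<Sum>A\<in>I. R6 A) - (\<Sum>A\<in>I. \<Sum>R\<in>Rs. \<Sum>K\<in>Ks. R7 A R K)"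
  unfolding R6_def R7_def adjoin_def
  by (simp only: right_diff_distrib scaleR_diff_right sum_subtractf sum_distrib_left scaleR_sum_right merge_signs)

text \<open>The anticommutator appears as a difference because the factors \<open>(-1) ^ r\<close>
  and \<open>(-1) ^ (r + 1)\<close> of \<open>e(X)\<close> before and after the differential have
  been left out. Once the orders of summation are aligned, the families of terms match.\<close>

lemma cartan_chart:
  "(\<Sum>K\<in>insert (Ev p) Ks. \<Sum>A\<in>I. sg (par A * par K) *\<^sub>R (w K * dx A (dp A K eL) v))
     - (\<Sum>C\<in>I. X C v * adjoin p (arg_rows n m (r + 1) s) Ks (Inl C) dL v)
   = (\<Sum>A\<in>I. X A v * dx A S v)
     - (\<Sum>A\<in>I. \<Sum>C\<in>I. \<Sum>K\<in>insert (Ev p) Ks. sg (par A * e) *\<^sub>R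
          (dX A C * (y (Inl C) K v * dp A K S v)))
     + (\<Sum>A\<in>I. sg (par A * (e + 1)) *\<^sub>R (dX A A * S v))"
proof -
  have ins: "(\<Sum>K\<in>insert (Ev p) Ks. \<Sum>A\<in>I. sg (par A * par K) *\<^sub>R (w K * dx A (dp A K eL) v))
     = (\<Sum>A\<in>I. w' * dx A (dp A (Ev p) eL) v)
       + (\<Sum>K\<in>Ks. \<Sum>A\<in>I. sg (par A * par K) *\<^sub>R (w K * dx A (dp A K eL) v))"
    by simp
  have r5: "(\<Sum>K\<in>Ks. \<Sum>A\<in>I. \<Sum>C\<in>I. R5 A C K) = (\<Sum>A\<in>I. \<Sum>C\<in>I. \<Sum>J\<in>Ks. R5 A C J)"
    by (rule sum_rotate)
  have q2: "(\<Sum>C\<in>I. \<Sum>K\<in>Ks. \<Sum>A\<in>I. Q2 A C K) = (\<Sum>K\<in>Ks. \<Sum>A\<in>I. \<Sum>C\<in>I. Q2 A C K)"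
    by (rule sum_rotate)
  have q4: "(\<Sum>A\<in>I. \<Sum>C\<in>I. \<Sum>J\<in>Ks. Q4 A C J) = (\<Sum>C\<in>I. \<Sum>J\<in>Ks. \<Sum>A\<in>I. Q4 A C J)"
    by (rule sum_rotate)
  have r7: "(\<Sum>K\<in>Ks. \<Sum>A\<in>I. \<Sum>R\<in>Rs. R7 A R K) = (\<Sum>A\<in>I. \<Sum>R\<in>Rs. \<Sum>K\<in>Ks. R7 A R K)"
    by (rule sum_rotate)
  have r2: "(\<Sum>K\<in>Ks. \<Sum>A\<in>I. \<Sum>R\<in>Rs. R2 A R K) = (\<Sum>A\<in>I. \<Sum>R\<in>Rs. \<Sum>K\<in>Ks. R2 A R K)"
    by (rule sum_rotate)
  have r4: "(\<Sum>K\<in>Ks. \<Sum>A\<in>I. \<Sum>C\<in>I. \<Sum>R\<in>Rs. \<Sum>J\<in>Ks. R4 A C R J K)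
      = (\<Sum>A\<in>I. \<Sum>C\<in>I. \<Sum>J\<in>Ks. \<Sum>R\<in>Rs. \<Sum>K\<in>Ks. R4 A C R J K)"
  proof -
    have "(\<Sum>K\<in>Ks. \<Sum>A\<in>I. \<Sum>C\<in>I. \<Sum>R\<in>Rs. \<Sum>J\<in>Ks. R4 A C R J K)
        = (\<Sum>A\<in>I. \<Sum>C\<in>I. \<Sum>K\<in>Ks. \<Sum>R\<in>Rs. \<Sum>J\<in>Ks. R4 A C R J K)" by (rule sum_rotate)
    also have "\<dots> = (\<Sum>A\<in>I. \<Sum>C\<in>I. \<Sum>R\<in>Rs. \<Sum>J\<in>Ks. \<Sum>K\<in>Ks. R4 A C R J K)"
      by (intro sum.cong[OF refl] sum_rotate)
    also have "\<dots> = (\<Sum>A\<in>I. \<Sum>C\<in>I. \<Sum>J\<in>Ks. \<Sum>R\<in>Rs. \<Sum>K\<in>Ks. R4 A C R J K)"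
      by (intro sum.cong[OF refl] sum.swap)
    finally show ?thesis .
  qed
  have q6: "(\<Sum>K\<in>Ks. \<Sum>A\<in>I. \<Sum>C\<in>I. \<Sum>R\<in>Rs. \<Sum>J\<in>Ks. Q6 A C R J K)
      = (\<Sum>C\<in>I. \<Sum>R\<in>Rs. \<Sum>J\<in>Ks. \<Sum>K\<in>Ks. \<Sum>A\<in>I. Q6 A C R J K)"
  proof -
    have "(\<Sum>C\<in>I. \<Sum>R\<in>Rs. \<Sum>J\<in>Ks. \<Sum>K\<in>Ks. \<Sum>A\<in>I. Q6 A C R J K)
        = (\<Sum>C\<in>I. \<Sum>R\<in>Rs. \<Sum>K\<in>Ks. \<Sum>A\<in>I. \<Sum>J\<in>Ks. Q6 A C R J K)"
      by (intro sum.cong[OF refl] sum_rotate)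
    also have "\<dots> = (\<Sum>C\<in>I. \<Sum>K\<in>Ks. \<Sum>A\<in>I. \<Sum>R\<in>Rs. \<Sum>J\<in>Ks. Q6 A C R J K)"
      by (intro sum.cong[OF refl] sum_rotate)
    also have "\<dots> = (\<Sum>K\<in>Ks. \<Sum>A\<in>I. \<Sum>C\<in>I. \<Sum>R\<in>Rs. \<Sum>J\<in>Ks. Q6 A C R J K)"
      by (rule sum_rotate)
    finally show ?thesis ..
  qed
  show ?thesis
    unfolding ins left_extra left_main left_e right_1 right_2 right_3 r5 q2 q4 r7 r2 r4 q6
    by (simp add: algebra_simps)
qed

end

end

section \<open>From homogeneous fields in a chart to the identity of mixed forms\<close>

lemma superfun_hpart:
  assumes D: "open D" and F: "superfun C D F"
  shows "superfun C D (\<lambda>v. hpart e (F v))"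
  by (rule superfun_pointwise[OF F F, where h = "\<lambda>a b. hpart e a"])
     (auto simp: gens_in_iff coeff_hpart intro: smooth_sfun_hpart D superfun_smooth[OF F])

lemma adjoin_scaleR:
  assumes "smooth_sfun D F" "v \<in> D"
  shows "adjoin p Rs Ks R (\<lambda>v. k *\<^sub>R F v) v = k *\<^sub>R adjoin p Rs Ks R F v"
  unfolding adjoin_def pd_scaleR[OF assms]
  by (simp add: scaleR_diff_right scaleR_sum_right mult.commute)

text \<open>The sums over rows of \<open>p\<close> and of \<open>w\<close> in \<open>e(X)\<close>
  merge into one sum over the disjoint union of rows.\<close>

lemma e_op_eq_adjoin:
  "e_op M X r s p q L i v = sg r *\<^sub>R
     (\<Sum>A\<in>idx M. X i A v * adjoin p (idx M <+> indices r s) (indices p q) (Inl A) (L i) v)"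
  unfolding e_op_def adjoin_def
  by (simp add: idx_def sum.Plus rowc.simps mult.assoc diff_diff_eq)

context form_chart
begin

lemma dbar_eq:
  assumes "idx M = I" "F i = L"
  shows "dbar M r s p q F i = (\<lambda>v. sg r *\<^sub>R dL v)"
  unfolding dbar_def dL_def assms by (simp add: rowc_Pc rowc_Wc mult.assoc)

lemma smooth_dL: "smooth_sfun D dL"
  unfolding dL_def
  by (intro smooth_sfun_sum smooth_sfun_scaleR smooth_sfun_mult smooth_sfun_var smooth_sfun_pd D smooth_L)

lemma lie_homog_eq:
  assumes "idx M = I" "Y i = X" and T: "\<And>u. u \<in> D \<Longrightarrow> T i u = S u" and v: "v \<in> D"
  shows "lie_homog M e Y r' s' (p + 1) q T i v =
     (\<Sum>A\<in>I. X A v * dx A S v)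
     - (\<Sum>A\<in>I. \<Sum>C\<in>I. \<Sum>K\<in>insert (Ev p) Ks. sg (par A * e) *\<^sub>R
          (dx A (X C) v * (y (Inl C) K v * dp A K S v)))
     + (\<Sum>A\<in>I. sg (par A * (e + 1)) *\<^sub>R (dx A (X A) v * S v))"
proof -
  have "pd c (T i) v = pd c S v" for c by (rule pd_cong[OF D T v])
  then show ?thesis
    unfolding lie_homog_def assms(1,2) indices_Suc T[OF v] rowc_Pc
    by (simp only: minus_one_power_gr mult.assoc mult_scaleR_left)
qed

end

text \<open>Both sides are additive in \<open>X\<close>, so the two homogeneous parts are treated
  separately. Agreement of \<open>T\<close> with the explicit formula on the open set
  \<open>D\<close> suffices, since it entails agreement of derivatives.\<close>

lemma cartan_formula_chart:
  fixes M :: "('a, 'i) atlas" and X :: "'i \<Rightarrow> sindex \<Rightarrow> sfun" and L :: "'i \<Rightarrow> sfun"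
  assumes L: "local_mixed_form (edim M) (odim M) r s p q U (L i)"
    and U: "openin (Euclidean_space (edim M)) U"
    and X: "\<And>A. A \<in> idx M \<Longrightarrow> superfun (xcoords (edim M) (odim M)) (xdom (edim M) U) (X i A)"
    and T: "\<And>u. u \<in> mdom (edim M) (odim M) s q U \<Longrightarrow>
      T i u = adjoin p (arg_rows (edim M) (odim M) r s) (indices p q) (Inr (Ev r)) (L i) u"
    and v: "v \<in> mdom (edim M) (odim M) s q U"
  shows "dbar M r s (p + 1) q (e_op M X r s p q L) i v + e_op M X (r + 1) s p q (dbar M r s p q L) i v
     = lie M X (r + 1) s (p + 1) q T i v"
proof -
  let ?n = "edim M" and ?m = "odim M"
  let ?D = "mdom ?n ?m s q U"
  have chart: "form_chart ?n ?m r s p q U (L i) (vpart e X i) e" for e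
  proof
    fix A assume "A \<in> indices ?n ?m"
    then show "superfun (xcoords ?n ?m) (xdom ?n U) (vpart e X i A)"
      unfolding vpart_def[abs_def] using X by (intro superfun_hpart open_xdom U) (simp add: idx_def)
  qed (simp_all add: L U vpart_def homog_hpart)
  interpret F0: form_chart ?n ?m r s p q U "L i" "vpart 0 X i" 0 by (rule chart)
  interpret F1: form_chart ?n ?m r s p q U "L i" "vpart 1 X i" 1 by (rule chart)
  have idx: "idx M = indices ?n ?m" by (simp add: idx_def)
  \<comment> \<open>For each \<open>A\<close> the two parts take the parities \<open>par A\<close>
    and \<open>par A + 1\<close>, so together they exhaust the component.\<close>
  have split: "X i A u = vpart 0 X i A u + vpart 1 X i A u" for A u
    unfolding vpart_def using hpart_sum[of "par A" "X i A u"] by simp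
  have e_op: "e_op M X r s p q L i = (\<lambda>u. sg r *\<^sub>R (F0.eL u + F1.eL u))"
    unfolding e_op_eq_adjoin[abs_def] F0.eL_def F1.eL_def idx split
    by (simp only: distrib_right sum.distrib)
  have pp: "pd (Xc A) (pd (rowc (Inl A) K) (e_op M X r s p q L i)) v =
      sg r *\<^sub>R (pd (Xc A) (pd (rowc (Inl A) K) F0.eL) v + pd (Xc A) (pd (rowc (Inl A) K) F1.eL) v)" for A K
  proof -
    have 1: "has_pd ?D (rowc (Inl A) K) (e_op M X r s p q L i)
        (\<lambda>u. sg r *\<^sub>R (pd (rowc (Inl A) K) F0.eL u + pd (rowc (Inl A) K) F1.eL u))"
      unfolding e_op
      by (rule has_pd_scaleR[OF F0.D has_pd_add[OF F0.D has_pd_smooth[OF F0.smooth_eL] has_pd_smooth[OF F1.smooth_eL]]])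
    have "has_pd ?D (Xc A) (pd (rowc (Inl A) K) (e_op M X r s p q L i))
        (\<lambda>u. sg r *\<^sub>R (pd (Xc A) (pd (rowc (Inl A) K) F0.eL) u + pd (Xc A) (pd (rowc (Inl A) K) F1.eL) u))"
      by (rule has_pd_cong[OF F0.D has_pd_scaleR[OF F0.D has_pd_add[OF F0.D
            has_pd_smooth[OF smooth_sfun_pd[OF F0.D F0.smooth_eL]] has_pd_smooth[OF smooth_sfun_pd[OF F0.D F1.smooth_eL]]]]
            has_pdD[OF 1] refl])
    then show ?thesis using v by (rule has_pdD)
  qed
  let ?l = "\<lambda>eL. \<Sum>K\<in>insert (Ev p) (indices p q). \<Sum>A\<in>indices ?n ?m. sg (par A * par K) *\<^sub>R
      (var (rowc (Inr (Ev r)) K) v * pd (Xc A) (pd (rowc (Inl A) K) eL) v)"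
  let ?d = "\<lambda>X. \<Sum>A\<in>indices ?n ?m. X A v * adjoin p (arg_rows ?n ?m (r + 1) s) (indices p q) (Inl A) F0.dL v"
  have "dbar M r s (p + 1) q (e_op M X r s p q L) i v = ?l F0.eL + ?l F1.eL"
  proof -
    have "dbar M r s (p + 1) q (e_op M X r s p q L) i v =
        sg r *\<^sub>R (\<Sum>K\<in>insert (Ev p) (indices p q). \<Sum>A\<in>indices ?n ?m. sg (par A * par K) *\<^sub>R
          (var (rowc (Inr (Ev r)) K) v * (sg r *\<^sub>R (pd (Xc A) (pd (rowc (Inl A) K) F0.eL) v + pd (Xc A) (pd (rowc (Inl A) K) F1.eL) v))))"
      unfolding dbar_def idx indices_Suc rowc_Pc rowc_Wc pp
      by (simp only: minus_one_power_gr minus_one_power_gr_right mult.assoc mult_scaleR_left)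
    \<comment> \<open>Both operators carry the factor \<open>(-1) ^ r\<close> here, and its square
      is 1.\<close>
    also have "\<dots> = (\<Sum>K\<in>insert (Ev p) (indices p q). \<Sum>A\<in>indices ?n ?m. sg (par A * par K) *\<^sub>R
          (var (rowc (Inr (Ev r)) K) v * (pd (Xc A) (pd (rowc (Inl A) K) F0.eL) v + pd (Xc A) (pd (rowc (Inl A) K) F1.eL) v)))"
      unfolding scaleR_sum_right
      by (intro sum.cong refl) (simp add: mult.left_commute flip: power_mult_distrib)
    also have "\<dots> = ?l F0.eL + ?l F1.eL"
      by (simp only: distrib_left[where 'a = "coord gr"] scaleR_add_right sum.distrib)
    finally show ?thesis .
  qed
  moreover have "e_op M X (r + 1) s p q (dbar M r s p q L) i v = - (?d (vpart 0 X i) + ?d (vpart 1 X i))"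
  proof -
    have "e_op M X (r + 1) s p q (dbar M r s p q L) i v = sg (r + 1) *\<^sub>R
        (\<Sum>A\<in>indices ?n ?m. X i A v * (sg r *\<^sub>R adjoin p (arg_rows ?n ?m (r + 1) s) (indices p q) (Inl A) F0.dL v))"
      unfolding e_op_eq_adjoin F0.dbar_eq[where F = L and i = i, OF idx refl] adjoin_scaleR[OF F0.smooth_dL v] idx ..
    \<comment> \<open>In this order \<open>e(X)\<close> acts on a form with \<open>r + 1\<close>
      even rows, so the two factors multiply to -1.\<close>
    also have "\<dots> = - (\<Sum>A\<in>indices ?n ?m. X i A v * adjoin p (arg_rows ?n ?m (r + 1) s) (indices p q) (Inl A) F0.dL v)"
      by (simp add: scaleR_sum_right sum_negf flip: power_mult_distrib)
    finally show ?thesis by (simp only: split distrib_right[where 'a = "coord gr"] sum.distrib)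
  qed
  moreover have "lie_homog M 0 (vpart 0 X) (r + 1) s (p + 1) q T i v = ?l F0.eL - ?d (vpart 0 X i)"
    by (rule trans[OF F0.lie_homog_eq[where M = M and Y = "vpart 0 X" and T = T and i = i, OF idx refl T v] F0.cartan_chart[OF v, symmetric]])
  moreover have "lie_homog M 1 (vpart 1 X) (r + 1) s (p + 1) q T i v = ?l F1.eL - ?d (vpart 1 X i)"
    by (rule trans[OF F1.lie_homog_eq[where M = M and Y = "vpart 1 X" and T = T and i = i, OF idx refl T v] F1.cartan_chart[OF v, symmetric]])
  ultimately show ?thesis unfolding lie_def by simp
qed

theorem theorem2p2:
  fixes M :: "('a, 'i) atlas" and X :: "'i \<Rightarrow> sindex \<Rightarrow> sfun" and L :: "'i \<Rightarrow> sfun"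
    and r s p q :: nat
  assumes "supermanifold M"
    and "vector_field M X"
    and "mixed_form M r s p q L"
  shows "mform_eq M (r + 1) s (p + 1) q
           (\<lambda>i v. dbar M r s (p + 1) q (e_op M X r s p q L) i v
                  + e_op M X (r + 1) s p q (dbar M r s p q L) i v)
           (lie M X (r + 1) s (p + 1) q (stab 1 0 M r s p q L))"
  unfolding mform_eq_def
proof (intro ballI)
  \<comment> \<open>Raising \<open>r\<close> and \<open>p\<close> does not affect
    \<open>mdom\<close>, so the points considered are those admissible for \<open>L\<close>
    itself.\<close>
  fix i v assume i: "i \<in> charts M"
    and v: "v \<in> mdom (edim M) (odim M) s q (cmap M i ` cdom M i)"
  have L: "local_mixed_form (edim M) (odim M) r s p q (cmap M i ` cdom M i) (L i)"
    using assms(3) i unfolding mixed_form_def by blast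
  have U: "openin (Euclidean_space (edim M)) (cmap M i ` cdom M i)"
    using assms(1) i unfolding supermanifold_def by blast
  have X: "superfun (xcoords (edim M) (odim M)) (xdom (edim M) (cmap M i ` cdom M i)) (X i A)"
    if "A \<in> idx M" for A
    using assms(2) i that unfolding vector_field_def by blast
  show "dbar M r s (p + 1) q (e_op M X r s p q L) i v + e_op M X (r + 1) s p q (dbar M r s p q L) i v
      = lie M X (r + 1) s (p + 1) q (stab 1 0 M r s p q L) i v"
    by (rule cartan_formula_chart[where M = M and L = L and i = i and X = X and T = "stab 1 0 M r s p q L",
        OF L U X stab_1_0_eq[where M = M and L = L and i = i, OF L U] v])
qed

end
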